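(* Let $p$ and $q$ be prime numbers such that $p \mid q-1$, and let $r \in \mathbb{Z}_q^{\times}$ be an element of order $p$. Let $K$ be a number field containing a primitive $p$-th root of unity $\zeta$, and let $\mathcal{B}_{p,q}(\zeta)$ be the Hopf algebra over $K$ defined in the context. Let $R \subset K$ be a Dedekind domain such that $\mathcal{O}_K \subseteq R$, where $\mathcal{O}_K$ is the ring of algebraic integers of $K$. If $\mathcal{B}_{p,q}(\zeta)$ admits a Hopf order over $R$, then $\frac{1}{p} \in R$. As a consequence, $\mathcal{B}_{p,q}(\zeta)$ does not admit a Hopf order over any number ring.
   Context: Definition of $\mathcal{B}_{p,q}(\zeta)$. Consider the finite group $$G=\big\langle \sigma,\tau,a,b : \sigma^p=\tau^p=1,\ a^q=b^q=1,\ \sigma a\sigma^{-1}=a^r,\ \tau b\tau^{-1}=b^r,\ [\sigma,b]=[\tau,a]=[a,b]=[\sigma,\tau]=1\big\rangle,$$ which is isomorphic to $(\mathbb{Z}_q\times\mathbb{Z}_q)\rtimes(\mathbb{Z}_p\times\mathbb{Z}_p)$. The element $$J=\frac{1}{p}\sum_{u,v=0}^{p-1}\zeta^{-uv}\,\tau^u\otimes\sigma^v\in KG\otimes KG$$ is a twist for the group Hopf algebra $KG$ (i.e. it is invertible, $(1\otimes J)(\mathrm{id}\otimes\Delta)(J)=(J\otimes 1)(\Delta\otimes \mathrm{id})(J)$ and $(\varepsilon\otimes \mathrm{id})(J)=(\mathrm{id}\otimes\varepsilon)(J)=1$), with inverse $J^{-1}=\frac{1}{p}\sum_{u,v=0}^{p-1}\zeta^{uv}\tau^u\otimes\sigma^v$.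 The Hopf algebra $\mathcal{B}_{p,q}(\zeta)=(KG)_J$ is the Drinfel'd twist of $KG$ by $J$: it equals $KG$ as an algebra, has the same counit as $KG$ ($\varepsilon(g)=1$ for $g\in G$), comultiplication $\Delta_J(g)=J(g\otimes g)J^{-1}$ and antipode $S_J(g)=U_J g^{-1}U_J^{-1}$ for $g\in G$, where $U_J=\sum J^{(1)}S(J^{(2)})$ for $J=\sum J^{(1)}\otimes J^{(2)}$, and $S$ is the antipode of $KG$. Hopf orders. Let $H$ be a finite dimensional Hopf algebra over a field $K$ and $R$ a subring of $K$. A Hopf order of $H$ over $R$ is a finitely generated projective $R$-submodule $X$ of $H$ such that the natural map $X\otimes_R K\to H$ is an isomorphism, $1_H\in X$, $XX\subseteq X$, $\Delta(X)\subseteq X\otimes_R X$ (where $X\otimes_R X$ is viewed inside $H\otimes H$), $\varepsilon(X)\subseteq R$ and $S(X)\subseteq X$. A number ring is the ring of algebraic integers of a number field. *)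

theory Defs
  imports "HOL-Algebra.Algebraic_Closure_Type" "HOL-Number_Theory.Number_Theory"
begin

section \<open>Number fields and their subrings\<close>

class number_field = field_char_0 +
  assumes finite_over_rat:
    "\<exists>B. finite B \<and> (\<forall>x. \<exists>c. x = (\<Sum>b\<in>B. of_rat (c b) * b))"

definition ring_of_integers :: "'k::number_field set" where
  "ring_of_integers = {x. algebraic_int x}"

text \<open>The ambient field \<open>K\<close> is a type, its subrings are sets.  A subfield \<open>L\<close> of a number
  field is again a number field, so these are the number rings contained in \<open>K\<close>.\<close>

definition number_ring :: "'k::number_field set \<Rightarrow> bool" where
  "number_ring R \<longleftrightarrow>
     (\<exists>L. subfield L (ring_of_type_algebra :: 'k ring) \<and> R = {x \<in> L. algebraic_int x})"

definition fractions :: "'k::field set \<Rightarrow> 'k set" where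
  "fractions R = {a / b | a b. a \<in> R \<and> b \<in> R \<and> b \<noteq> 0}"

definition integral_over :: "'k::field set \<Rightarrow> 'k \<Rightarrow> bool" where
  "integral_over R x \<longleftrightarrow>
     (\<exists>f :: 'k poly. Polynomial.lead_coeff f = 1 \<and> (\<forall>i. Polynomial.coeff f i \<in> R) \<and> poly f x = 0)"

text \<open>Fields are allowed as Dedekind domains.\<close>

definition dedekind_subring :: "'k::field set \<Rightarrow> bool" where
  "dedekind_subring R \<longleftrightarrow>
     (let K = (ring_of_type_algebra :: 'k ring); S = K\<lparr>carrier := R\<rparr> in
        subring R K \<and>
        noetherian_domain S \<and>
        (\<forall>x \<in> fractions R. integral_over R x \<longrightarrow> x \<in> R) \<and>
        (\<forall>P. primeideal P S \<and> P \<noteq> {0} \<longrightarrow> maximalideal P S))"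

definition primitive_root_of_unity :: "nat \<Rightarrow> 'k::field \<Rightarrow> bool" where
  "primitive_root_of_unity n z \<longleftrightarrow> z ^ n = 1 \<and> (\<forall>k. 0 < k \<and> k < n \<longrightarrow> z ^ k \<noteq> 1)"


section \<open>Modules over a subring \<open>R\<close> of the field \<open>K\<close>\<close>

text \<open>All modules that occur are sets of functions \<open>'i \<Rightarrow> 'k\<close> with the pointwise operations.\<close>

definition is_submodule :: "'k::field set \<Rightarrow> ('i \<Rightarrow> 'k) set \<Rightarrow> bool" where
  "is_submodule R M \<longleftrightarrow>
     (\<lambda>_. 0) \<in> M \<and>
     (\<forall>x\<in>M. \<forall>y\<in>M. (\<lambda>i. x i + y i) \<in> M) \<and>
     (\<forall>r\<in>R. \<forall>x\<in>M. (\<lambda>i. r * x i) \<in> M)"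

definition finitely_generated :: "'k::field set \<Rightarrow> ('i \<Rightarrow> 'k) set \<Rightarrow> bool" where
  "finitely_generated R M \<longleftrightarrow>
     (\<exists>n e. (\<forall>j<n. e j \<in> M) \<and>
        (\<forall>x\<in>M. \<exists>c. (\<forall>j<n. c j \<in> R) \<and> x = (\<lambda>i. \<Sum>j<(n::nat). c j * e j i)))"

definition linear_map ::
    "'k::field set \<Rightarrow> ('i \<Rightarrow> 'k) set \<Rightarrow> ('j \<Rightarrow> 'k) set \<Rightarrow> (('i \<Rightarrow> 'k) \<Rightarrow> ('j \<Rightarrow> 'k)) \<Rightarrow> bool" where
  "linear_map R M Y f \<longleftrightarrow>
     (\<forall>x\<in>M. f x \<in> Y) \<and>
     (\<forall>x\<in>M. \<forall>y\<in>M. f (\<lambda>i. x i + y i) = (\<lambda>j. f x j + f y j)) \<and>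
     (\<forall>r\<in>R. \<forall>x\<in>M. f (\<lambda>i. r * x i) = (\<lambda>j. r * f x j))"

definition free_module :: "'k::field set \<Rightarrow> 'j set \<Rightarrow> ('j \<Rightarrow> 'k) set" where
  "free_module R J =
     {c. finite {j. c j \<noteq> 0} \<and> (\<forall>j\<in>J. c j \<in> R) \<and> (\<forall>j. j \<notin> J \<longrightarrow> c j = 0)}"

text \<open>Projective means: a direct summand of a free module.  Basis sets \<open>J\<close> in the type of the
  module elements suffice, because \<open>M\<close> is a quotient of the free module on the set \<open>M\<close>.\<close>

definition projective :: "'k::field set \<Rightarrow> ('i \<Rightarrow> 'k) set \<Rightarrow> bool" where
  "projective R M \<longleftrightarrow>
     (\<exists>(J :: ('i \<Rightarrow> 'k) set) \<iota> \<pi>.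
        linear_map R M (free_module R J) \<iota> \<and>
        linear_map R (free_module R J) M \<pi> \<and>
        (\<forall>x\<in>M. \<pi> (\<iota> x) = x))"

text \<open>The tensor product of \<open>M\<close> and \<open>K\<close> over \<open>R\<close>, as formal sums (lists) of pairs
  \<open>(x, c)\<close> modulo the congruence generated by commutativity and bilinearity.\<close>

inductive tensor_eq ::
    "'k::field set \<Rightarrow> ('i \<Rightarrow> 'k) set \<Rightarrow> (('i \<Rightarrow> 'k) \<times> 'k) list \<Rightarrow> (('i \<Rightarrow> 'k) \<times> 'k) list \<Rightarrow> bool"
  for R M where
  refl: "tensor_eq R M s s"
| sym: "tensor_eq R M s t \<Longrightarrow> tensor_eq R M t s"
| trans: "tensor_eq R M s t \<Longrightarrow> tensor_eq R M t u \<Longrightarrow> tensor_eq R M s u"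
| append: "tensor_eq R M s t \<Longrightarrow> set u \<subseteq> M \<times> UNIV \<Longrightarrow> tensor_eq R M (s @ u) (t @ u)"
| commute: "set s \<subseteq> M \<times> UNIV \<Longrightarrow> set t \<subseteq> M \<times> UNIV \<Longrightarrow> tensor_eq R M (s @ t) (t @ s)"
| zero: "tensor_eq R M [(\<lambda>_. 0, c)] []"
| add_left: "x \<in> M \<Longrightarrow> y \<in> M \<Longrightarrow> tensor_eq R M [(\<lambda>i. x i + y i, c)] [(x, c), (y, c)]"
| add_right: "x \<in> M \<Longrightarrow> tensor_eq R M [(x, c + d)] [(x, c), (x, d)]"
| scale: "r \<in> R \<Longrightarrow> x \<in> M \<Longrightarrow> tensor_eq R M [(\<lambda>i. r * x i, c)] [(x, r * c)]"

definition natural_map :: "(('i \<Rightarrow> 'k::field) \<times> 'k) list \<Rightarrow> 'i \<Rightarrow> 'k" where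
  "natural_map s = (\<lambda>i. \<Sum>(x, c)\<leftarrow>s. c * x i)"

definition natural_map_iso :: "'k::field set \<Rightarrow> ('i \<Rightarrow> 'k) set \<Rightarrow> ('i \<Rightarrow> 'k) set \<Rightarrow> bool" where
  "natural_map_iso R M H \<longleftrightarrow>
     (\<forall>s t. set s \<subseteq> M \<times> UNIV \<and> set t \<subseteq> M \<times> UNIV \<and> natural_map s = natural_map t
        \<longrightarrow> tensor_eq R M s t) \<and>
     natural_map ` {s. set s \<subseteq> M \<times> UNIV} = H"

definition tensor :: "('i \<Rightarrow> 'k::field) \<Rightarrow> ('j \<Rightarrow> 'k) \<Rightarrow> 'i \<times> 'j \<Rightarrow> 'k" where
  "tensor x y = (\<lambda>(i, j). x i * y j)"

text \<open>For an \<open>R\<close>-submodule \<open>M\<close> of \<open>H\<close>, the image of the tensor square of \<open>M\<close> over \<open>R\<close> in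
  the tensor square of \<open>H\<close> over \<open>K\<close>: all finite sums of pure tensors.\<close>

definition tensor_square :: "('i \<Rightarrow> 'k::field) set \<Rightarrow> ('i \<times> 'i \<Rightarrow> 'k) set" where
  "tensor_square M = {\<lambda>z. \<Sum>(x, y)\<leftarrow>s. tensor x y z | s. set s \<subseteq> M \<times> M}"


section \<open>Hopf algebras and Hopf orders\<close>

text \<open>The structure maps of a Hopf algebra whose underlying space is a space of functions on a
  basis; its tensor square is then a space of functions on pairs of basis elements.\<close>

record ('k, 'i) hopf_algebra = "('i \<Rightarrow> 'k) ring" +
  comult :: "('i \<Rightarrow> 'k) \<Rightarrow> ('i \<times> 'i \<Rightarrow> 'k)"
  counit :: "('i \<Rightarrow> 'k) \<Rightarrow> 'k"
  antipode :: "('i \<Rightarrow> 'k) \<Rightarrow> ('i \<Rightarrow> 'k)"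

definition hopf_order :: "'k::field set \<Rightarrow> ('k, 'i) hopf_algebra \<Rightarrow> ('i \<Rightarrow> 'k) set \<Rightarrow> bool" where
  "hopf_order R H M \<longleftrightarrow>
     subring R (ring_of_type_algebra :: 'k ring) \<and>
     M \<subseteq> carrier H \<and> is_submodule R M \<and>
     finitely_generated R M \<and> projective R M \<and>
     natural_map_iso R M (carrier H) \<and>
     \<one>\<^bsub>H\<^esub> \<in> M \<and>
     (\<forall>x\<in>M. \<forall>y\<in>M. x \<otimes>\<^bsub>H\<^esub> y \<in> M) \<and>
     (\<forall>x\<in>M. comult H x \<in> tensor_square M) \<and>
     (\<forall>x\<in>M. counit H x \<in> R) \<and>
     (\<forall>x\<in>M. antipode H x \<in> M)"

definition admits_hopf_order :: "'k::field set \<Rightarrow> ('k, 'i) hopf_algebra \<Rightarrow> bool" where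
  "admits_hopf_order R H \<longleftrightarrow> (\<exists>M. hopf_order R H M)"


section \<open>Group algebras of finite groups and their Drinfel'd twists\<close>

definition group_element :: "'g \<Rightarrow> 'g \<Rightarrow> 'k::field" where
  "group_element g = (\<lambda>x. if x = g then 1 else 0)"

definition group_algebra :: "('g, 'm) monoid_scheme \<Rightarrow> ('g \<Rightarrow> 'k::field) ring" where
  "group_algebra G =
     \<lparr>carrier = {f. \<forall>x. x \<notin> carrier G \<longrightarrow> f x = 0},
      monoid.mult = (\<lambda>f h x. if x \<in> carrier G
        then \<Sum>y\<in>carrier G. f y * h (inv\<^bsub>G\<^esub> y \<otimes>\<^bsub>G\<^esub> x) else 0),
      one = group_element \<one>\<^bsub>G\<^esub>,
      ring.zero = (\<lambda>_. 0),
      add = (\<lambda>f h x. f x + h x)\<rparr>"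

definition group_hopf_algebra :: "('g, 'm) monoid_scheme \<Rightarrow> ('k::field, 'g) hopf_algebra" where
  "group_hopf_algebra G =
     ring.extend (group_algebra G)
       (hopf_algebra.fields
         (\<lambda>f (x, y). if x = y then f x else 0)
         (\<lambda>f. \<Sum>x\<in>carrier G. f x)
         (\<lambda>f x. if x \<in> carrier G then f (inv\<^bsub>G\<^esub> x) else 0))"

text \<open>For \<open>J = \<Sum> J\<^sup>1 \<otimes> J\<^sup>2\<close> this is \<open>\<Sum> J\<^sup>1 S(J\<^sup>2)\<close>.\<close>

definition twist_U :: "('g, 'm) monoid_scheme \<Rightarrow> ('g \<times> 'g \<Rightarrow> 'k::field) \<Rightarrow> 'g \<Rightarrow> 'k" where
  "twist_U G J = (\<lambda>x. \<Sum>(g, h) \<in> carrier G \<times> carrier G. J (g, h) *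
     (group_element g \<otimes>\<^bsub>group_algebra G\<^esub> antipode (group_hopf_algebra G) (group_element h)) x)"

text \<open>The tensor square of \<open>KG\<close>, as an algebra, is the group algebra of \<open>G \<times>\<times> G\<close>.\<close>

definition drinfeld_twist ::
    "('g, 'm) monoid_scheme \<Rightarrow> ('g \<times> 'g \<Rightarrow> 'k::field) \<Rightarrow> ('k, 'g) hopf_algebra" where
  "drinfeld_twist G J =
     (let KG = group_hopf_algebra G; KGG = group_algebra (G \<times>\<times> G); U = twist_U G J in
      KG\<lparr>comult := \<lambda>f. J \<otimes>\<^bsub>KGG\<^esub> comult KG f \<otimes>\<^bsub>KGG\<^esub> inv\<^bsub>KGG\<^esub> J,
         antipode := \<lambda>f. U \<otimes>\<^bsub>KG\<^esub> antipode KG f \<otimes>\<^bsub>KG\<^esub> inv\<^bsub>KG\<^esub> U\<rparr>)"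


section \<open>Groups given by generators and relations\<close>

text \<open>The letter \<open>(x, True)\<close> is the generator \<open>x\<close> and \<open>(x, False)\<close> its inverse.\<close>

type_synonym 'x word = "('x \<times> bool) list"

inductive word_eq :: "('x word \<times> 'x word) set \<Rightarrow> 'x word \<Rightarrow> 'x word \<Rightarrow> bool" for rels where
  refl: "word_eq rels u u"
| sym: "word_eq rels u v \<Longrightarrow> word_eq rels v u"
| trans: "word_eq rels u v \<Longrightarrow> word_eq rels v w \<Longrightarrow> word_eq rels u w"
| cancel: "word_eq rels (u @ [(x, e), (x, \<not> e)] @ v) (u @ v)"
| relation: "(s, t) \<in> rels \<Longrightarrow> word_eq rels (u @ s @ v) (u @ t @ v)"

definition word_class :: "('x word \<times> 'x word) set \<Rightarrow> 'x word \<Rightarrow> 'x word set" where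
  "word_class rels u = {v. word_eq rels u v}"

definition presented_group :: "('x word \<times> 'x word) set \<Rightarrow> 'x word set monoid" where
  "presented_group rels =
     \<lparr>carrier = range (word_class rels),
      monoid.mult = (\<lambda>A B. {w. \<exists>u\<in>A. \<exists>v\<in>B. word_eq rels (u @ v) w}),
      one = word_class rels []\<rparr>"


section \<open>The Hopf algebra \<open>\<B>\<^bsub>p,q\<^esub>(\<zeta>)\<close>\<close>

datatype generator = Gen_sigma | Gen_tau | Gen_a | Gen_b

definition gen_power :: "'x \<Rightarrow> nat \<Rightarrow> 'x word" where
  "gen_power x n = replicate n (x, True)"

definition gen_conj :: "'x \<Rightarrow> 'x \<Rightarrow> 'x word" where
  "gen_conj x y = [(x, True), (y, True), (x, False)]"

definition gen_commutator :: "'x \<Rightarrow> 'x \<Rightarrow> 'x word" where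
  "gen_commutator x y = [(x, True), (y, True), (x, False), (y, False)]"

definition relations_G :: "nat \<Rightarrow> nat \<Rightarrow> nat \<Rightarrow> (generator word \<times> generator word) set" where
  "relations_G p q r =
     {(gen_power Gen_sigma p, []), (gen_power Gen_tau p, []), (gen_power Gen_a q, []), (gen_power Gen_b q, []),
      (gen_conj Gen_sigma Gen_a, gen_power Gen_a r), (gen_conj Gen_tau Gen_b, gen_power Gen_b r),
      (gen_commutator Gen_sigma Gen_b, []), (gen_commutator Gen_tau Gen_a, []),
      (gen_commutator Gen_a Gen_b, []), (gen_commutator Gen_sigma Gen_tau, [])}"

definition group_G :: "nat \<Rightarrow> nat \<Rightarrow> nat \<Rightarrow> generator word set monoid" where
  "group_G p q r = presented_group (relations_G p q r)"

definition gen_G :: "nat \<Rightarrow> nat \<Rightarrow> nat \<Rightarrow> generator \<Rightarrow> generator word set" where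
  "gen_G p q r x = word_class (relations_G p q r) [(x, True)]"

definition twist_J ::
    "nat \<Rightarrow> nat \<Rightarrow> nat \<Rightarrow> 'k::field \<Rightarrow> generator word set \<times> generator word set \<Rightarrow> 'k" where
  "twist_J p q r \<zeta> =
     (let G = group_G p q r; \<sigma> = gen_G p q r Gen_sigma; \<tau> = gen_G p q r Gen_tau in
      (\<lambda>z. 1 / of_nat p * (\<Sum>u<p. \<Sum>v<p. inverse (\<zeta> ^ (u * v)) *
            tensor (group_element (\<tau> [^]\<^bsub>G\<^esub> u)) (group_element (\<sigma> [^]\<^bsub>G\<^esub> v)) z)))"

definition hopf_B :: "nat \<Rightarrow> nat \<Rightarrow> nat \<Rightarrow> 'k::field \<Rightarrow> ('k, generator word set) hopf_algebra" where
  "hopf_B p q r \<zeta> = drinfeld_twist (group_G p q r) (twist_J p q r \<zeta>)"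

end

theory Submission
  imports Defs
begin

text \<open>Suppose that \<open>1/p \<notin> R\<close>. A maximal subring \<open>V \<supseteq> R\<close> of \<open>K\<close> with \<open>1/p \<notin> V\<close> is a valuation
  ring, and it suffices to work over \<open>V\<close>, where finitely generated lattices have bases.
  Let \<open>D\<close> be the dual of the order and \<open>X\<close> its bidual.  The span of the elements \<open>e\<^sub>s a\<^sup>l\<close>, with \<open>e\<^sub>s\<close>
  the idempotents of \<open>K\<langle>\<tau>\<rangle>\<close>, is a subcoalgebra for \<open>\<Delta>\<^sub>J\<close>; \<open>D\<close> acts on the corresponding comodule
  and the trace of this action shows that \<open>e\<^sub>0 (a + \<dots> + a\<^sup>q\<^sup>-\<^sup>1)\<close> lies in \<open>X\<close>.  Symmetrically
  \<open>f\<^sub>0 (b + \<dots> + b\<^sup>q\<^sup>-\<^sup>1)\<close> lies in \<open>X\<close>, with \<open>f\<^sub>0\<close> the trivial idempotent of \<open>K\<langle>\<sigma>\<rangle>\<close>.  Contracting the product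
  of their twisted coproducts with the character \<open>\<chi> = (fix\<^sub>1 - 1)(fix\<^sub>2 - 1)\<close>, where \<open>fix\<^sub>1\<close> and
  \<open>fix\<^sub>2\<close> are the permutation characters of the two affine actions on \<open>\<int>\<^sub>q\<close>, gives
  \<open>w = p\<^sup>-\<^sup>2 (a + \<dots> + a\<^sup>q\<^sup>-\<^sup>1)(b + \<dots> + b\<^sup>q\<^sup>-\<^sup>1) \<in> X\<close>, because \<open>\<chi>\<close> kills all terms involving \<open>\<sigma>\<close> or \<open>\<tau>\<close>.
  Now \<open>w\<close> acts as \<open>p\<^sup>-\<^sup>2\<close> on the representation of \<open>\<chi>\<close>, hence \<open>p\<^sup>-\<^sup>2\<^sup>n \<chi>(1) = p\<^sup>-\<^sup>2\<^sup>n (q - 1)\<^sup>2\<close> lies in \<open>V\<close>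
  for all \<open>n\<close>, which forces \<open>1/p \<in> V\<close>.\<close>

section \<open>Valuation rings\<close>

text \<open>The group ring RG is a Hopf order of the untwisted KG, so the twist itself must force
  1/p into R. It enters through the product of D, which is dual to \<open>\<Delta>\<^sub>J\<close>.
  The elements \<open>z_a\<close> and \<open>z_b\<close> that the traces produce do not yet suffice:
  on the representation of \<open>\<chi>\<close> they act, up to sign, as the trivial idempotents of
  K<tau> and K<sigma>, so their powers have no growing denominators. The contraction with
  \<open>\<chi>\<close> strips off sigma and tau but keeps the factor p^-2. As a + ... + a^(q-1) and
  b + ... + b^(q-1) act by -1 on the reduced permutation representations, what is left acts as the
  scalar p^-2. D consists of the functionals with values in V on M, so the passage from R to V
  leaves M unchanged. A trace tests an element against D only, which is why membership is obtained
  in the bidual. Elements of KG and of its tensor square are compared through the values of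
  functionals on them, so that \<open>\<Delta>\<^sub>J\<close> becomes a finite sum over roots of
  unity.\<close>

locale field_subring =
  fixes V :: "'k::field set"
  assumes one_mem: "1 \<in> V"
    and diff_mem: "x \<in> V \<Longrightarrow> y \<in> V \<Longrightarrow> x - y \<in> V"
    and mult_mem: "x \<in> V \<Longrightarrow> y \<in> V \<Longrightarrow> x * y \<in> V"
begin

lemma zero_mem: "0 \<in> V"
  using diff_mem[OF one_mem one_mem] by simp

lemma uminus_mem: "x \<in> V \<Longrightarrow> - x \<in> V"
  using diff_mem[OF zero_mem] by simp

lemma add_mem: "x \<in> V \<Longrightarrow> y \<in> V \<Longrightarrow> x + y \<in> V"
  using diff_mem[OF _ uminus_mem] by force

lemma sum_mem: "(\<And>i. i \<in> I \<Longrightarrow> f i \<in> V) \<Longrightarrow> sum f I \<in> V"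
  by (induction I rule: infinite_finite_induct) (auto intro: zero_mem add_mem)

lemma sum_list_mem: "(\<And>x. x \<in> set xs \<Longrightarrow> f x \<in> V) \<Longrightarrow> sum_list (map f xs) \<in> V"
  by (induction xs) (auto intro: zero_mem add_mem)

lemma power_mem: "x \<in> V \<Longrightarrow> x ^ n \<in> V"
  by (induction n) (auto intro: one_mem mult_mem)

lemma of_nat_mem: "of_nat n \<in> V"
  by (induction n) (auto intro: zero_mem one_mem add_mem)

lemma of_int_mem: "of_int n \<in> V"
  by (cases n rule: int_cases2) (auto intro: of_nat_mem uminus_mem)

end

locale valuation_ring = field_subring V for V :: "'k::field set" +
  assumes mem_or_inverse_mem: "x \<in> V \<or> inverse x \<in> V"
begin

text \<open>An element of minimal valuation. When a new value is not a V-multiple of the current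
  minimum, the reverse quotient lies in V and the new value becomes the minimum. This supplies the
  pivots for elimination over V.\<close>

lemma exists_dividing_all:
  assumes "finite T" "\<exists>t\<in>T. g t \<noteq> 0"
  shows "\<exists>t0\<in>T. g t0 \<noteq> 0 \<and> (\<forall>t\<in>T. g t / g t0 \<in> V)"
  using assms
proof (induction T rule: finite_induct)
  case (insert s T)
  show ?case
  proof (cases "\<exists>t\<in>T. g t \<noteq> 0")
    case False
    then have "g s \<noteq> 0" and "\<forall>t\<in>T. g t = 0" using insert by auto
    then show ?thesis using zero_mem one_mem by auto
  next
    case True
    then obtain t0 where t0: "t0 \<in> T" "g t0 \<noteq> 0" "\<forall>t\<in>T. g t / g t0 \<in> V"
      using insert by blast
    show ?thesis
    proof (cases "g s / g t0 \<in> V")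
      case True
      then show ?thesis using t0 by blast
    next
      case False
      then have inv: "g t0 / g s \<in> V" and "g s \<noteq> 0"
        using mem_or_inverse_mem[of "g s / g t0"] zero_mem by auto
      have "g t / g s \<in> V" if "t \<in> T" for t
        using mult_mem[OF t0(3)[rule_format, OF that] inv] t0(2) by simp
      then show ?thesis using \<open>g s \<noteq> 0\<close> one_mem by (intro bexI[of _ s]) auto
    qed
  qed
qed auto

end

lemma field_subring_adjoin:
  assumes "field_subring (V :: 'k::field set)"
  shows "field_subring {poly f x | f. \<forall>i. Polynomial.coeff f i \<in> V}" (is "field_subring ?A")
proof -
  interpret field_subring V by fact
  show ?thesis
  proof
    show "1 \<in> ?A"
      by (auto intro!: exI[of _ "1 :: 'k poly"] simp: one_mem zero_mem coeff_1)
    show "y - z \<in> ?A" if "y \<in> ?A" "z \<in> ?A" for y z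
    proof -
      from that obtain f g where "y = poly f x" "\<forall>i. Polynomial.coeff f i \<in> V"
        "z = poly g x" "\<forall>i. Polynomial.coeff g i \<in> V" by auto
      then show ?thesis by (auto intro!: exI[of _ "f - g"] simp: diff_mem)
    qed
    show "y * z \<in> ?A" if "y \<in> ?A" "z \<in> ?A" for y z
    proof -
      from that obtain f g where "y = poly f x" "\<forall>i. Polynomial.coeff f i \<in> V"
        "z = poly g x" "\<forall>i. Polynomial.coeff g i \<in> V" by auto
      then show ?thesis
        by (auto intro!: exI[of _ "f * g"] sum_mem mult_mem simp: Polynomial.coeff_mult)
    qed
  qed
qed

lemma adjoin_supset:
  assumes "field_subring (V :: 'k::field set)"
  shows "insert x V \<subseteq> {poly f x | f. \<forall>i. Polynomial.coeff f i \<in> V}"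
proof -
  interpret field_subring V by fact
  have "x = poly [:0, 1:] x \<and> (\<forall>i. Polynomial.coeff [:0, 1:] i \<in> V)"
    by (auto simp: coeff_pCons zero_mem one_mem split: nat.splits)
  moreover have "y = poly [:y:] x \<and> (\<forall>i. Polynomial.coeff [:y:] i \<in> V)" if "y \<in> V" for y
    using that by (auto simp: coeff_pCons zero_mem split: nat.splits)
  ultimately show ?thesis by blast
qed

text \<open>Among the relations \<open>1 = y f(x)\<close> and \<open>1 = y g(1/x)\<close> pick ones of minimal degree; the
  relation of larger degree can be shortened by the other one, because \<open>1 - y c\<close> is a unit.\<close>

lemma relations_shorten:
  fixes x y :: "'k::field"
  assumes "field_subring V" and "y \<in> V" and x: "x \<noteq> 0"
    and units: "\<And>c. c \<in> V \<Longrightarrow> 1 - y * c \<noteq> 0 \<and> inverse (1 - y * c) \<in> V"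
    and f: "\<And>i. f i \<in> V" "1 = y * (\<Sum>i\<le>m. f i * x ^ i)"
    and g: "\<And>i. g i \<in> V" "1 = y * (\<Sum>i\<le>n. g i * inverse x ^ i)"
    and "n \<le> m" "0 < m"
  shows "\<exists>h. (\<forall>i. h i \<in> V) \<and> 1 = y * (\<Sum>i\<le>m - 1. h i * x ^ i)"
proof -
  interpret field_subring V by fact
  define d where "d = inverse (1 - y * g 0)"
  have d: "d \<in> V" "d * (1 - y * g 0) = 1" using units[OF g(1)[of 0]] by (auto simp: d_def)
  \<comment> \<open>\<open>h\<close> replaces the leading term of \<open>f\<close> by lower powers:
    the relation for \<open>g\<close>, multiplied by x^m and divided by the unit 1 - y g(0), writes
    x^m through the powers from m - n to m - 1.\<close>
  define h where "h = (\<lambda>i. f i + d * y * f m * (if m - n \<le> i \<and> i < m then g (m - i) else 0))"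
  have hV: "h i \<in> V" for i
    using f(1) g(1) \<open>d \<in> V\<close> \<open>y \<in> V\<close> zero_mem by (auto simp: h_def intro!: add_mem mult_mem)
  have "(\<Sum>i\<le>n. g i * inverse x ^ i) = g 0 + (\<Sum>i=1..n. g i * inverse x ^ i)"
    by (simp add: sum.atMost_shift sum.atLeast1_atMost_eq)
  then have "1 - y * g 0 = y * (\<Sum>i=1..n. g i * inverse x ^ i)"
    by (subst g(2)) (simp add: algebra_simps)
  then have "x ^ m * d * (1 - y * g 0) = d * y * (\<Sum>i=1..n. g i * (x ^ m * inverse x ^ i))"
    by (simp add: sum_distrib_left mult_ac)
  also have "(\<Sum>i=1..n. g i * (x ^ m * inverse x ^ i)) = (\<Sum>i=1..n. g i * x ^ (m - i))"
    using x \<open>n \<le> m\<close> by (intro sum.cong) (auto simp: power_diff field_simps)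
  also have "\<dots> = (\<Sum>i\<in>{m-n..<m}. g (m - i) * x ^ i)"
    using \<open>n \<le> m\<close> by (intro sum.reindex_bij_witness[of _ "\<lambda>i. m - i" "\<lambda>i. m - i"]) auto
  finally have xm: "x ^ m = d * y * (\<Sum>i\<in>{m-n..<m}. g (m - i) * x ^ i)"
    using d by (simp add: mult.assoc)
  have "(\<Sum>i<m. h i * x ^ i) = (\<Sum>i<m. f i * x ^ i)
      + f m * (d * y * (\<Sum>i<m. (if m - n \<le> i \<and> i < m then g (m - i) else 0) * x ^ i))"
    by (simp add: h_def algebra_simps sum.distrib sum_distrib_left)
  also have "(\<Sum>i<m. (if m - n \<le> i \<and> i < m then g (m - i) else 0) * x ^ i)
      = (\<Sum>i\<in>{m-n..<m}. g (m - i) * x ^ i)"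
    by (intro sum.mono_neutral_cong_right) auto
  also have "(\<Sum>i<m. f i * x ^ i) + f m * (d * y * (\<Sum>i\<in>{m-n..<m}. g (m - i) * x ^ i))
     = (\<Sum>i\<le>m. f i * x ^ i)"
    by (simp add: xm[symmetric] lessThan_Suc_atMost[symmetric])
  finally have eq: "(\<Sum>i<m. h i * x ^ i) = (\<Sum>i\<le>m. f i * x ^ i)" .
  have "{..m - 1} = {..<m}" using \<open>0 < m\<close> by auto
  then have "1 = y * (\<Sum>i\<le>m - 1. h i * x ^ i)" by (simp only: eq f(2)[symmetric])
  then show ?thesis using hV by blast
qed

text \<open>By maximality, adjoining any z outside V brings in 1/y, that is, 1 = y f(z) for a
  polynomial f over V. If neither z nor 1/z were in V, two such relations of minimal degree, one in
  each, would contradict \<open>relations_shorten\<close>.\<close>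

lemma maximal_subring_valuation_ring:
  fixes V :: "'k::field set"
  assumes "field_subring V" and "y \<in> V" and y: "inverse y \<notin> V"
    and max: "\<And>W. field_subring W \<Longrightarrow> V \<subseteq> W \<Longrightarrow> inverse y \<notin> W \<Longrightarrow> W = V"
  shows "valuation_ring V"
proof -
  interpret field_subring V by fact
  have "y \<noteq> 0" using y zero_mem by auto
  have adjoin: "\<exists>m f. (\<forall>i. f i \<in> V) \<and> 1 = y * (\<Sum>i\<le>m. f i * z ^ i)" if "z \<notin> V" for z
  proof -
    have "inverse y \<in> {poly f z | f. \<forall>i. Polynomial.coeff f i \<in> V}"
      using max[OF field_subring_adjoin[OF assms(1), of z]] adjoin_supset[OF assms(1), of z] that
      by blast
    then obtain f where f: "inverse y = poly f z" "\<forall>i. Polynomial.coeff f i \<in> V" by auto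
    then have "1 = y * poly f z" using \<open>y \<noteq> 0\<close> by (metis right_inverse)
    then show ?thesis using f(2) unfolding poly_altdef by blast
  qed
  \<comment> \<open>y lies in the Jacobson radical of V. If e = 1 - y c were not invertible in V,
    maximality would give 1 = y f(1/e); clearing denominators makes e^m a multiple of y, while e^m
    is congruent to 1 modulo y, so y would be a unit.\<close>
  have units: "1 - y * c \<noteq> 0 \<and> inverse (1 - y * c) \<in> V" if "c \<in> V" for c
  proof
    show nz: "1 - y * c \<noteq> 0"
      using that y \<open>y \<noteq> 0\<close> by (metis eq_iff_diff_eq_0 inverse_unique)
    show "inverse (1 - y * c) \<in> V"
    proof (rule ccontr)
      let ?e = "1 - y * c"
      have e: "?e \<in> V" using that \<open>y \<in> V\<close> by (intro diff_mem mult_mem one_mem)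
      assume "inverse ?e \<notin> V"
      then obtain m f where f: "\<forall>i. f i \<in> V" "1 = y * (\<Sum>i\<le>m. f i * inverse ?e ^ i)"
        using adjoin by blast
      have "?e ^ m = y * (\<Sum>i\<le>m. f i * (?e ^ m * inverse ?e ^ i))"
        using f(2)[THEN arg_cong[where f = "\<lambda>x. ?e ^ m * x"]]
        by (simp only: mult_1_left mult_1_right sum_distrib_left mult_ac)
      also have "(\<Sum>i\<le>m. f i * (?e ^ m * inverse ?e ^ i)) = (\<Sum>i\<le>m. f i * ?e ^ (m - i))"
        using nz by (intro sum.cong) (auto simp: power_diff field_simps)
      finally have "?e ^ m = y * (\<Sum>i\<le>m. f i * ?e ^ (m - i))" .
      moreover have "(\<Sum>i\<le>m. f i * ?e ^ (m - i)) \<in> V"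
        using f(1) e by (intro sum_mem mult_mem power_mem) auto
      ultimately obtain s where s: "s \<in> V" "?e ^ m = y * s" by blast
      have "\<exists>t\<in>V. ?e ^ m = 1 - y * t" for m
      proof (induction m)
        case 0
        then show ?case using zero_mem by force
      next
        case (Suc m)
        then obtain t where "t \<in> V" "?e ^ m = 1 - y * t" by blast
        then have "?e ^ Suc m = 1 - y * (c + t - y * (c * t))"
          by (simp only: power_Suc) (simp add: algebra_simps)
        moreover have "c + t - y * (c * t) \<in> V"
          using \<open>t \<in> V\<close> that \<open>y \<in> V\<close> by (intro diff_mem add_mem mult_mem)
        ultimately show ?case by blast
      qed
      then obtain t where "t \<in> V" "?e ^ m = 1 - y * t" by blast
      then have "y * (s + t) = 1" "s + t \<in> V" using s by (auto simp: algebra_simps add_mem)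
      then show False using y inverse_unique by metis
    qed
  qed
  have "z \<in> V \<or> inverse z \<in> V" for z
  proof (rule ccontr)
    assume "\<not> ?thesis"
    then have z: "z \<notin> V" "inverse z \<notin> V" and z0: "z \<noteq> 0" using zero_mem by auto
    define P where "P = (\<lambda>x m. \<exists>f. (\<forall>i. f i \<in> V) \<and> 1 = y * (\<Sum>i\<le>m. f i * x ^ i))"
    \<comment> \<open>Degree 0 would mean y f(0) = 1, hence 1/y in V. So both minimal degrees are
      positive, and lowering one of them is a contradiction.\<close>
    have P0: "\<not> P x 0" for x
    proof
      assume "P x 0"
      then obtain f where f: "\<forall>i. f i \<in> V" "1 = y * (\<Sum>i\<le>0. f i * x ^ i)"
        unfolding P_def by blast
      have "y * f 0 = 1" using f(2) by simp
      then show False using y f(1) inverse_unique by metis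
    qed
    define m where "m = (LEAST m. P z m)"
    define n where "n = (LEAST m. P (inverse z) m)"
    have "\<exists>m. P z m" unfolding P_def by (rule adjoin[OF z(1)])
    then have m: "P z m" unfolding m_def by (rule LeastI_ex)
    have "\<exists>m. P (inverse z) m" unfolding P_def by (rule adjoin[OF z(2)])
    then have n: "P (inverse z) n" unfolding n_def by (rule LeastI_ex)
    have "m \<noteq> 0"
    proof
      assume "m = 0"
      then show False using m P0[of z] by simp
    qed
    moreover have "n \<noteq> 0"
    proof
      assume "n = 0"
      then show False using n P0[of "inverse z"] by simp
    qed
    ultimately have pos: "0 < m" "0 < n" by simp_all
    obtain f where f: "\<And>i. f i \<in> V" "1 = y * (\<Sum>i\<le>m. f i * z ^ i)"
      using m unfolding P_def by blast
    obtain g where g: "\<And>i. g i \<in> V" "1 = y * (\<Sum>i\<le>n. g i * inverse z ^ i)"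
      using n unfolding P_def by blast
    show False
    proof (cases "n \<le> m")
      case True
      have "P z (m - 1)"
        unfolding P_def by (rule relations_shorten[OF assms(1,2) z0 units f g True pos(1)])
      then show False using pos(1) Least_le[of "P z" "m - 1"] by (simp add: m_def)
    next
      case False
      then have "m \<le> n" by simp
      have f': "1 = y * (\<Sum>i\<le>m. f i * inverse (inverse z) ^ i)" unfolding inverse_inverse_eq by (rule f(2))
      have "inverse z \<noteq> 0" using z0 by simp
      then have "P (inverse z) (n - 1)"
        unfolding P_def
        by (rule relations_shorten[OF assms(1,2) _ units g f(1) f' \<open>m \<le> n\<close> pos(2)])
      then show False using pos(2) Least_le[of "P (inverse z)" "n - 1"] by (simp add: n_def)
    qed
  qed
  then show ?thesis by unfold_locales
qed

text \<open>Zorn's lemma: any two elements of the union of a chain lie in a common member, so the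
  union is again a subring. It is applied with y = p.\<close>

lemma valuation_ring_excluding_inverse:
  fixes R :: "'k::field set"
  assumes "field_subring R" and "y \<in> R" and "inverse y \<notin> R"
  shows "\<exists>V. valuation_ring V \<and> R \<subseteq> V \<and> inverse y \<notin> V"
proof -
  define A where "A = {W. field_subring W \<and> R \<subseteq> W \<and> inverse y \<notin> W}"
  have "\<exists>V\<in>A. \<forall>W\<in>A. V \<subseteq> W \<longrightarrow> W = V"
  proof (rule subset_Zorn_nonempty)
    show "A \<noteq> {}" using assms by (auto simp: A_def)
    fix C assume C: "C \<noteq> {}" "subset.chain A C"
    have sub: "field_subring W" if "W \<in> C" for W using C that by (auto simp: subset.chain_def A_def)
    have join: "\<exists>W\<in>C. a \<in> W \<and> b \<in> W" if ab: "a \<in> \<Union>C" "b \<in> \<Union>C" for a b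
    proof -
      obtain W W' where "W \<in> C" "a \<in> W" "W' \<in> C" "b \<in> W'" using ab by auto
      moreover have "W \<subseteq> W' \<or> W' \<subseteq> W"
        using C(2) \<open>W \<in> C\<close> \<open>W' \<in> C\<close> by (auto simp: subset.chain_def)
      ultimately show ?thesis by blast
    qed
    have "field_subring (\<Union>C)"
    proof
      show "1 \<in> \<Union>C" using C(1) sub field_subring.one_mem by blast
      show "a - b \<in> \<Union>C" if "a \<in> \<Union>C" "b \<in> \<Union>C" for a b
        using join[OF that] sub field_subring.diff_mem by blast
      show "a * b \<in> \<Union>C" if "a \<in> \<Union>C" "b \<in> \<Union>C" for a b
        using join[OF that] sub field_subring.mult_mem by blast
    qed
    moreover have "R \<subseteq> W \<and> inverse y \<notin> W" if "W \<in> C" for W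
      using C that by (auto simp: subset.chain_def A_def)
    then have "R \<subseteq> \<Union>C" "inverse y \<notin> \<Union>C" using C(1) by blast+
    ultimately show "\<Union>C \<in> A" by (simp add: A_def)
  qed
  then obtain V where V: "V \<in> A" "\<And>W. W \<in> A \<Longrightarrow> V \<subseteq> W \<Longrightarrow> W = V" by blast
  then have V': "field_subring V" "R \<subseteq> V" "inverse y \<notin> V" by (simp_all add: A_def)
  have "valuation_ring V"
  proof (rule maximal_subring_valuation_ring)
    show "y \<in> V" using V'(2) assms(2) by blast
    show "W = V" if "field_subring W" "V \<subseteq> W" "inverse y \<notin> W" for W
      using that V'(2) by (intro V(2)) (auto simp: A_def)
  qed (use V' in auto)
  then show ?thesis using V' by blast
qed

section \<open>Finitely generated lattices\<close>

text \<open>Elimination over V, one coordinate at a time. The \<open>b m\<close> with the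
  functionals \<open>f m\<close> form a dual system: each \<open>v t\<close> is expanded in the
  \<open>b m\<close> with coefficients in V, which is all that computing a trace takes. L is a
  parameter because it is a span of matrix columns in one application and the bidual in the
  other.\<close>

lemma (in valuation_ring) dual_basis:
  fixes v :: "'t \<Rightarrow> 'i \<Rightarrow> 'k"
  assumes "finite I" "finite T" "is_submodule V L" "\<And>t. t \<in> T \<Longrightarrow> v t \<in> L"
  shows "\<exists>(N::nat) b f. (\<forall>m<N. b m \<in> L) \<and>
     (\<forall>m<N. \<forall>t\<in>T. (\<Sum>i\<in>I. f m i * v t i) \<in> V) \<and>
     (\<forall>t\<in>T. \<forall>i\<in>I. v t i = (\<Sum>m<N. (\<Sum>j\<in>I. f m j * v t j) * b m i))"
  using assms(1,3,4)
proof (induction I arbitrary: L v rule: finite_induct)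
  case empty
  then show ?case by (auto intro!: exI[of _ 0])
next
  case (insert i0 I)
  define L' where "L' = {x \<in> L. x i0 = 0}"
  have L': "is_submodule V L'"
    using insert.prems(1) unfolding is_submodule_def L'_def by auto
  show ?case
  proof (cases "\<exists>t\<in>T. v t i0 \<noteq> 0")
    case False
    then have "v t \<in> L'" if "t \<in> T" for t using that insert.prems(2) by (auto simp: L'_def)
    then obtain N :: nat and b f where bf: "\<forall>m<N. b m \<in> L'"
      "\<forall>m<N. \<forall>t\<in>T. (\<Sum>i\<in>I. f m i * v t i) \<in> V"
      "\<forall>t\<in>T. \<forall>i\<in>I. v t i = (\<Sum>m<N. (\<Sum>j\<in>I. f m j * v t j) * b m i)"
      using insert.IH[OF L', of v] by blast
    have "(\<Sum>i\<in>insert i0 I. f m i * v t i) = (\<Sum>i\<in>I. f m i * v t i)" if "t \<in> T" for m t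
      using False that insert.hyps by simp
    note eq = this
    have "\<forall>m<N. b m \<in> L" using bf(1) by (simp add: L'_def)
    moreover have "\<forall>m<N. \<forall>t\<in>T. (\<Sum>i\<in>insert i0 I. f m i * v t i) \<in> V"
      using bf(2) eq by (metis (no_types, lifting))
    moreover have "v t i = (\<Sum>m<N. (\<Sum>j\<in>insert i0 I. f m j * v t j) * b m i)"
      if "t \<in> T" "i \<in> insert i0 I" for t i
    proof (cases "i = i0")
      case True
      then show ?thesis using False bf(1) that(1) by (simp add: L'_def)
    next
      case False
      then have "i \<in> I" using that by simp
      then show ?thesis unfolding eq[OF that(1)] using bf(3) that(1) by blast
    qed
    ultimately show ?thesis by blast
  next
    case True
    then obtain t0 where t0: "t0 \<in> T" "v t0 i0 \<noteq> 0" "\<forall>t\<in>T. v t i0 / v t0 i0 \<in> V"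
      using exists_dividing_all[OF \<open>finite T\<close>, of "\<lambda>t. v t i0"] by blast
    \<comment> \<open>The pivot \<open>t0\<close> has minimal valuation at the coordinate
      \<open>i0\<close>, so the multipliers \<open>c t\<close> lie in V and the reduced vectors
      \<open>v' t\<close> vanish at \<open>i0\<close>.\<close>
    define c where "c = (\<lambda>t. v t i0 / v t0 i0)"
    define v' where "v' = (\<lambda>t i. v t i + (- c t) * v t0 i)"
    have "v' t \<in> L'" if "t \<in> T" for t
    proof -
      have "- c t \<in> V" using t0(3) that by (auto simp: c_def intro: uminus_mem)
      then have "(\<lambda>i. (- c t) * v t0 i) \<in> L"
        using insert.prems t0(1) unfolding is_submodule_def by blast
      moreover have "(\<lambda>i. x i + y i) \<in> L" if "x \<in> L" "y \<in> L" for x y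
        using insert.prems(1) that unfolding is_submodule_def by blast
      ultimately have "v' t \<in> L" using insert.prems(2)[OF that] unfolding v'_def by blast
      then show ?thesis using t0(2) by (simp add: L'_def v'_def c_def)
    qed
    then obtain N :: nat and b f where bf: "\<forall>m<N. b m \<in> L'"
      "\<forall>m<N. \<forall>t\<in>T. (\<Sum>i\<in>I. f m i * v' t i) \<in> V"
      "\<forall>t\<in>T. \<forall>i\<in>I. v' t i = (\<Sum>m<N. (\<Sum>j\<in>I. f m j * v' t j) * b m i)"
      using insert.IH[OF L', of v'] by blast
    define b' where "b' = (\<lambda>m. if m < N then b m else v t0)"
    \<comment> \<open>A functional on the reduced vectors is composed with the reduction, which
      alters only its coefficient at \<open>i0\<close>; the one extra functional reads off the
      multiplier \<open>c\<close>.\<close>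
    define f' where "f' = (\<lambda>m i. if m < N
        then (if i = i0 then - (\<Sum>i\<in>I. f m i * v t0 i) / v t0 i0 else f m i)
        else (if i = i0 then 1 / v t0 i0 else 0))"
    have f'_less: "(\<Sum>i\<in>insert i0 I. f' m i * v t i) = (\<Sum>i\<in>I. f m i * v' t i)" if "m < N" for m t
    proof -
      have "(\<Sum>i\<in>I. f' m i * v t i) = (\<Sum>i\<in>I. f m i * v t i)"
        using insert.hyps that by (intro sum.cong) (auto simp: f'_def)
      then show ?thesis using insert.hyps that t0(2)
        by (simp add: f'_def v'_def c_def algebra_simps sum.distrib sum_distrib_left sum_negf
            sum_subtractf sum_divide_distrib)
    qed
    have f'_N: "(\<Sum>i\<in>insert i0 I. f' N i * v t i) = c t" for t
    proof -
      have "(\<Sum>i\<in>I. f' N i * v t i) = 0"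
        using insert.hyps by (intro sum.neutral) (auto simp: f'_def)
      then show ?thesis using insert.hyps by (simp add: f'_def c_def)
    qed
    have "b' m \<in> L" if "m < Suc N" for m
      using bf(1) insert.prems(2) t0(1) by (auto simp: b'_def L'_def)
    moreover have "(\<Sum>i\<in>insert i0 I. f' m i * v t i) \<in> V" if "m < Suc N" "t \<in> T" for m t
      using that bf(2) f'_less f'_N t0(3) by (cases "m = N") (auto simp: c_def less_Suc_eq)
    moreover have "v t i = (\<Sum>m<Suc N. (\<Sum>j\<in>insert i0 I. f' m j * v t j) * b' m i)"
      if "t \<in> T" "i \<in> insert i0 I" for t i
    proof -
      have "v' t i = (\<Sum>m<N. (\<Sum>j\<in>I. f m j * v' t j) * b m i)"
      proof (cases "i = i0")
        case True
        then have "(\<Sum>m<N. (\<Sum>j\<in>I. f m j * v' t j) * b m i) = 0"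
          using bf(1) by (intro sum.neutral) (auto simp: L'_def)
        then show ?thesis using True t0(2) by (simp add: v'_def c_def)
      next
        case False
        then show ?thesis using bf(3) that by blast
      qed
      also have "\<dots> = (\<Sum>m<N. (\<Sum>j\<in>insert i0 I. f' m j * v t j) * b' m i)"
        by (intro sum.cong) (auto simp: f'_less b'_def)
      finally have v': "v' t i = (\<Sum>m<N. (\<Sum>j\<in>insert i0 I. f' m j * v t j) * b' m i)" .
      have "v t i = v' t i + c t * v t0 i" by (simp add: v'_def)
      then show ?thesis unfolding v' by (simp only: sum.lessThan_Suc f'_N) (simp add: b'_def)
    qed
    ultimately show ?thesis by blast
  qed
qed

text \<open>The columns of the matrices span a finitely generated lattice that all the matrices
  stabilize; the trace is computed in a basis of this lattice.\<close>

lemma (in valuation_ring) trace_mem: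
  fixes \<A> :: "('i \<Rightarrow> 'i \<Rightarrow> 'k) set"
  assumes "finite I" "finite T" and gens_mem: "\<And>t. t \<in> T \<Longrightarrow> A t \<in> \<A>"
    and gens: "\<And>B. B \<in> \<A> \<Longrightarrow>
      \<exists>c. (\<forall>t\<in>T. c t \<in> V) \<and> (\<forall>i\<in>I. \<forall>j\<in>I. B i j = (\<Sum>t\<in>T. c t * A t i j))"
    and mult: "\<And>B C. B \<in> \<A> \<Longrightarrow> C \<in> \<A> \<Longrightarrow>
      \<exists>E\<in>\<A>. \<forall>i\<in>I. \<forall>j\<in>I. E i j = (\<Sum>k\<in>I. B i k * C k j)"
    and one: "\<exists>E\<in>\<A>. \<forall>i\<in>I. \<forall>j\<in>I. E i j = (if i = j then 1 else 0)"
    and "B \<in> \<A>"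
  shows "(\<Sum>i\<in>I. B i i) \<in> V"
proof -
  define v where "v = (\<lambda>(t, k) i. A t i k)"
  \<comment> \<open>Only the coordinates in \<open>I\<close> matter: of two functions that agree
    there, both or neither lie in \<open>L\<close>.\<close>
  define L where "L = {x. \<exists>c. (\<forall>s\<in>T\<times>I. c s \<in> V) \<and> (\<forall>i\<in>I. x i = (\<Sum>s\<in>T\<times>I. c s * v s i))}"
  have L: "is_submodule V L"
    unfolding is_submodule_def
  proof (intro conjI ballI)
    show "(\<lambda>_. 0) \<in> L" by (auto simp: L_def zero_mem intro!: exI[of _ "\<lambda>_. 0"])
    show "(\<lambda>i. x i + y i) \<in> L" if "x \<in> L" "y \<in> L" for x y
    proof -
      obtain c d where "\<forall>s\<in>T\<times>I. c s \<in> V" "\<forall>i\<in>I. x i = (\<Sum>s\<in>T\<times>I. c s * v s i)"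
        "\<forall>s\<in>T\<times>I. d s \<in> V" "\<forall>i\<in>I. y i = (\<Sum>s\<in>T\<times>I. d s * v s i)"
        using \<open>x \<in> L\<close> \<open>y \<in> L\<close> unfolding L_def mem_Collect_eq by (elim exE conjE) (rule that)
      then show ?thesis unfolding L_def
        by (intro CollectI exI[of _ "\<lambda>s. c s + d s"]) (simp add: add_mem algebra_simps sum.distrib)
    qed
    show "(\<lambda>i. r * x i) \<in> L" if r: "r \<in> V" and "x \<in> L" for r x
    proof -
      obtain c where "\<forall>s\<in>T\<times>I. c s \<in> V" "\<forall>i\<in>I. x i = (\<Sum>s\<in>T\<times>I. c s * v s i)"
        using \<open>x \<in> L\<close> unfolding L_def mem_Collect_eq by (elim exE conjE) (rule that)
      then show ?thesis unfolding L_def using r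
        by (intro CollectI exI[of _ "\<lambda>s. r * c s"]) (simp add: mult_mem mult.assoc sum_distrib_left)
    qed
  qed
  have column: "(\<lambda>i. C i k) \<in> L" if "C \<in> \<A>" "k \<in> I" for C k
  proof -
    obtain c where c: "\<forall>t\<in>T. c t \<in> V" "\<forall>i\<in>I. \<forall>j\<in>I. C i j = (\<Sum>t\<in>T. c t * A t i j)"
      using gens[OF \<open>C \<in> \<A>\<close>] by blast
    let ?c = "\<lambda>(t, j). if j = k then c t else 0"
    have "(\<Sum>s\<in>T\<times>I. ?c s * v s i) = (\<Sum>t\<in>T. \<Sum>j\<in>I. if j = k then c t * A t i j else 0)" for i
      by (subst sum.cartesian_product) (auto intro!: sum.cong simp: v_def)
    then have "\<forall>i\<in>I. C i k = (\<Sum>s\<in>T\<times>I. ?c s * v s i)"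
      using c(2) \<open>k \<in> I\<close> \<open>finite I\<close> by simp
    then show ?thesis unfolding L_def using c(1)
      by (intro CollectI exI[of _ ?c]) (auto simp: zero_mem)
  qed
  have v_mem: "v s \<in> L" if "s \<in> T \<times> I" for s
    using that gens_mem column by (auto simp: v_def)
  obtain N :: nat and b f where bf: "\<forall>m<N. b m \<in> L"
      "\<forall>m<N. \<forall>s\<in>T\<times>I. (\<Sum>i\<in>I. f m i * v s i) \<in> V"
      "\<forall>s\<in>T\<times>I. \<forall>i\<in>I. v s i = (\<Sum>m<N. (\<Sum>j\<in>I. f m j * v s j) * b m i)"
    using dual_basis[OF \<open>finite I\<close> _ L, of "T \<times> I" v] v_mem \<open>finite T\<close> \<open>finite I\<close>
    by blast
  have pairing: "(\<Sum>i\<in>I. f m i * x i) \<in> V" if "m < N" "x \<in> L" for m x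
  proof -
    obtain c where c: "\<forall>s\<in>T\<times>I. c s \<in> V" "\<forall>i\<in>I. x i = (\<Sum>s\<in>T\<times>I. c s * v s i)"
      using \<open>x \<in> L\<close> unfolding L_def mem_Collect_eq by (elim exE conjE) (rule that)
    have "(\<Sum>i\<in>I. f m i * x i) = (\<Sum>i\<in>I. \<Sum>s\<in>T\<times>I. c s * (f m i * v s i))"
      using c(2) by (intro sum.cong) (auto simp: sum_distrib_left mult_ac)
    also have "\<dots> = (\<Sum>s\<in>T\<times>I. c s * (\<Sum>i\<in>I. f m i * v s i))"
      by (subst sum.swap) (simp add: sum_distrib_left)
    also have "\<dots> \<in> V" proof (rule sum_mem)
      show "c s * (\<Sum>i\<in>I. f m i * v s i) \<in> V" if "s \<in> T \<times> I" for s
        using c(1) bf(2) \<open>m < N\<close> that by (intro mult_mem) blast+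
    qed
    finally show ?thesis .
  qed
  have expand: "x i = (\<Sum>m<N. (\<Sum>j\<in>I. f m j * x j) * b m i)" if "x \<in> L" "i \<in> I" for x i
  proof -
    obtain c where c: "\<forall>s\<in>T\<times>I. c s \<in> V" "\<forall>i\<in>I. x i = (\<Sum>s\<in>T\<times>I. c s * v s i)"
      using \<open>x \<in> L\<close> unfolding L_def mem_Collect_eq by (elim exE conjE) (rule that)
    have "x i = (\<Sum>s\<in>T\<times>I. c s * (\<Sum>m<N. (\<Sum>j\<in>I. f m j * v s j) * b m i))"
    proof -
      have "(\<Sum>s\<in>T\<times>I. c s * v s i) = (\<Sum>s\<in>T\<times>I. c s * (\<Sum>m<N. (\<Sum>j\<in>I. f m j * v s j) * b m i))"
        using bf(3) \<open>i \<in> I\<close> by (intro sum.cong HOL.refl arg_cong2[of _ _ _ _ "(*)"]) blast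
      with c(2) \<open>i \<in> I\<close> show ?thesis by metis
    qed
    also have "\<dots> = (\<Sum>m<N. (\<Sum>s\<in>T\<times>I. \<Sum>j\<in>I. f m j * (c s * v s j)) * b m i)"
      unfolding sum_distrib_left sum_distrib_right
      by (subst sum.swap) (simp add: mult_ac)
    also have "\<dots> = (\<Sum>m<N. (\<Sum>j\<in>I. f m j * x j) * b m i)"
    proof (intro sum.cong arg_cong2[of _ _ _ _ "(*)"] HOL.refl)
      show "(\<Sum>s\<in>T\<times>I. \<Sum>j\<in>I. f m j * (c s * v s j)) = (\<Sum>j\<in>I. f m j * x j)" for m
        using c(2) by (subst sum.swap) (simp add: sum_distrib_left)
    qed
    finally show ?thesis .
  qed
  have stable: "(\<lambda>i. \<Sum>j\<in>I. B i j * x j) \<in> L" if "x \<in> L" for x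
  proof -
    obtain c where c: "\<forall>s\<in>T\<times>I. c s \<in> V" "\<forall>i\<in>I. x i = (\<Sum>s\<in>T\<times>I. c s * v s i)"
      using \<open>x \<in> L\<close> unfolding L_def mem_Collect_eq by (elim exE conjE) (rule that)
    have Bv: "\<exists>d. (\<forall>s\<in>T\<times>I. d s \<in> V) \<and>
       (\<forall>i\<in>I. (\<Sum>j\<in>I. B i j * v s j) = (\<Sum>s\<in>T\<times>I. d s * v s i))" if s: "s \<in> T \<times> I" for s
    proof -
      obtain t k where tk: "s = (t, k)" "t \<in> T" "k \<in> I" using s by auto
      obtain E where E: "E \<in> \<A>" "\<forall>i\<in>I. \<forall>j\<in>I. E i j = (\<Sum>k\<in>I. B i k * A t k j)"
        using mult[OF \<open>B \<in> \<A>\<close> gens_mem[OF tk(2)]] by blast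
      have "(\<lambda>i. E i k) \<in> L" using column[OF E(1) tk(3)] .
      then show ?thesis using E(2) tk by (auto simp: L_def v_def)
    qed
    then obtain d where d: "\<And>s s'. s \<in> T\<times>I \<Longrightarrow> s' \<in> T\<times>I \<Longrightarrow> d s s' \<in> V"
      "\<And>s i. s \<in> T\<times>I \<Longrightarrow> i \<in> I \<Longrightarrow> (\<Sum>j\<in>I. B i j * v s j) = (\<Sum>s'\<in>T\<times>I. d s s' * v s' i)"
      by metis
    have "(\<Sum>j\<in>I. B i j * x j) = (\<Sum>s'\<in>T\<times>I. (\<Sum>s\<in>T\<times>I. c s * d s s') * v s' i)" if "i \<in> I" for i
    proof -
      have "(\<Sum>j\<in>I. B i j * x j) = (\<Sum>j\<in>I. \<Sum>s\<in>T\<times>I. c s * (B i j * v s j))"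
        using c(2) by (intro sum.cong) (auto simp: sum_distrib_left mult_ac)
      also have "\<dots> = (\<Sum>s\<in>T\<times>I. c s * (\<Sum>j\<in>I. B i j * v s j))"
        by (subst sum.swap) (simp add: sum_distrib_left)
      also have "\<dots> = (\<Sum>s\<in>T\<times>I. \<Sum>s'\<in>T\<times>I. c s * d s s' * v s' i)"
        using d(2) that by (simp add: sum_distrib_left mult.assoc)
      finally show ?thesis by (subst (asm) sum.swap) (simp add: sum_distrib_right)
    qed
    then show ?thesis unfolding L_def using c(1) d(1)
      by (intro CollectI exI[of _ "\<lambda>s'. \<Sum>s\<in>T\<times>I. c s * d s s'"]) (auto intro!: sum_mem mult_mem)
  qed
  obtain E where E: "E \<in> \<A>" "\<forall>i\<in>I. \<forall>j\<in>I. E i j = (if i = j then 1 else 0)" using one by blast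
  \<comment> \<open>The columns of the identity matrix lie in \<open>L\<close>, so the expansion
    applies to the unit vectors.\<close>
  have delta: "(\<Sum>m<N. f m j * b m i) = (if i = j then 1 else 0)" if "i \<in> I" "j \<in> I" for i j
  proof -
    have "(\<Sum>k\<in>I. f m k * E k j) = f m j" for m
    proof -
      have "(\<Sum>k\<in>I. f m k * E k j) = (\<Sum>k\<in>I. if k = j then f m k else 0)"
        using E(2) that by (intro sum.cong) auto
      then show ?thesis using that \<open>finite I\<close> by simp
    qed
    then have "E i j = (\<Sum>m<N. f m j * b m i)"
      by (subst expand[OF column[OF E(1) that(2)] that(1)]) simp
    then show ?thesis using E(2) that by metis
  qed
  \<comment> \<open>The trace becomes the sum over m of \<open>f m\<close> applied to the image of
    \<open>b m\<close> under \<open>B\<close>. Since \<open>B\<close> preserves \<open>L\<close> and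
    every \<open>f m\<close> is V-valued on \<open>L\<close>, each term lies in V.\<close>
  have "(\<Sum>i\<in>I. B i i) = (\<Sum>i\<in>I. \<Sum>j\<in>I. B i j * (if j = i then 1 else 0))"
    using \<open>finite I\<close> by (simp add: if_distrib[of "\<lambda>x. _ * x"] cong: if_cong)
  also have "\<dots> = (\<Sum>i\<in>I. \<Sum>j\<in>I. B i j * (\<Sum>m<N. f m i * b m j))"
    using delta by (intro sum.cong) auto
  also have "\<dots> = (\<Sum>i\<in>I. \<Sum>m<N. f m i * (\<Sum>j\<in>I. B i j * b m j))"
    unfolding sum_distrib_left by (rule sum.cong[OF HOL.refl], subst sum.swap) (simp add: mult_ac)
  also have "\<dots> = (\<Sum>m<N. \<Sum>i\<in>I. f m i * (\<Sum>j\<in>I. B i j * b m j))"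
    by (rule sum.swap)
  also have "\<dots> \<in> V"
    using bf(1) by (intro sum_mem pairing stable) auto
  finally show ?thesis .
qed

section \<open>Sums over roots of unity\<close>

text \<open>Exponents of the elements of order p and of zeta count modulo p only; shift invariance
  of sums over a full period stands in for summation over \<open>\<int>\<^sub>p\<close>.\<close>

lemma sum_shift_periodic:
  fixes h :: "nat \<Rightarrow> 'a::ab_group_add"
  assumes "\<And>n. h (n + p) = h n"
  shows "(\<Sum>u<p. h (u + c)) = (\<Sum>u<p. h u)"
proof (induction c)
  case (Suc c)
  have "(\<Sum>u<p. h (u + Suc c)) + h c = (\<Sum>u<Suc p. h (u + c))"
    by (subst sum.lessThan_Suc_shift) (simp add: add.commute)
  also have "\<dots> = (\<Sum>u<p. h (u + c)) + h c" using assms[of c] by (simp add: add.commute)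
  finally show ?case using Suc by simp
qed simp

lemma primitive_root_of_unity_power_eq_1_iff:
  assumes "primitive_root_of_unity p \<zeta>" "0 < p"
  shows "\<zeta> ^ k = 1 \<longleftrightarrow> p dvd k"
proof -
  have p: "\<zeta> ^ p = 1" using assms(1) by (simp add: primitive_root_of_unity_def)
  have "\<zeta> ^ k = \<zeta> ^ (p * (k div p) + k mod p)" by simp
  also have "\<dots> = \<zeta> ^ (k mod p)" unfolding power_add power_mult p by simp
  finally have eq: "\<zeta> ^ k = \<zeta> ^ (k mod p)" .
  show ?thesis
  proof
    assume "\<zeta> ^ k = 1"
    then have "\<not> 0 < k mod p" using eq assms by (auto simp: primitive_root_of_unity_def)
    then show "p dvd k" by (simp add: dvd_eq_mod_eq_0)
  qed (use eq in \<open>auto simp: dvd_eq_mod_eq_0\<close>)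
qed

lemma sum_powers_root_of_unity:
  assumes "primitive_root_of_unity p \<zeta>" "0 < p"
  shows "(\<Sum>u<p. \<zeta> ^ (u * k)) = (if p dvd k then of_nat p else 0)"
proof (cases "p dvd k")
  case True
  then have "\<zeta> ^ (u * k) = 1" for u
    using primitive_root_of_unity_power_eq_1_iff[OF assms] by simp
  then show ?thesis using True by simp
next
  case False
  then have "\<zeta> ^ k \<noteq> 1" using primitive_root_of_unity_power_eq_1_iff[OF assms] by simp
  moreover have "(\<zeta> ^ k) ^ p = 1"
    using primitive_root_of_unity_power_eq_1_iff[OF assms, of "k * p"] by (simp add: power_mult)
  ultimately have "(\<Sum>u<p. (\<zeta> ^ k) ^ u) = 0" by (simp add: sum_gp_strict)
  then show ?thesis using False by (simp add: power_mult[symmetric] mult.commute)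
qed

lemma primitive_root_of_unity_inverse:
  "primitive_root_of_unity p \<zeta> \<Longrightarrow> primitive_root_of_unity p (inverse \<zeta>)"
  by (simp add: primitive_root_of_unity_def power_inverse)

lemma sum_inverse_powers_root_of_unity:
  assumes "primitive_root_of_unity p \<zeta>" "0 < p"
  shows "(\<Sum>u<p. inverse (\<zeta> ^ (u * k))) = (if p dvd k then of_nat p else 0)"
  using sum_powers_root_of_unity[OF primitive_root_of_unity_inverse[OF assms(1)] assms(2)]
  by (simp add: power_inverse)

section \<open>The twisted coproduct on a metacyclic subgroup\<close>

text \<open>The linear functional dual to the twisted coproduct: \<open>F \<circ> \<Delta>\<^sub>J\<close> for a function \<open>F\<close> on
  \<open>G \<times> G\<close>, with \<open>J\<close> built from commuting elements \<open>s\<close> and \<open>t\<close>.\<close>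

definition twist_dual ::
    "('g, 'm) monoid_scheme \<Rightarrow> nat \<Rightarrow> 'k::field \<Rightarrow> 'g \<Rightarrow> 'g \<Rightarrow> ('g \<times> 'g \<Rightarrow> 'k) \<Rightarrow> 'g \<Rightarrow> 'k" where
  "twist_dual G p \<zeta> s t F g = 1 / of_nat p ^ 2 *
     (\<Sum>u<p. \<Sum>v<p. \<Sum>u'<p. \<Sum>v'<p. inverse (\<zeta> ^ (u * v)) * \<zeta> ^ (u' * v') *
        F (t [^]\<^bsub>G\<^esub> u \<otimes>\<^bsub>G\<^esub> g \<otimes>\<^bsub>G\<^esub> t [^]\<^bsub>G\<^esub> u', s [^]\<^bsub>G\<^esub> v \<otimes>\<^bsub>G\<^esub> g \<otimes>\<^bsub>G\<^esub> s [^]\<^bsub>G\<^esub> v'))"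

text \<open>The coefficient zeta^(u v) is symmetric in u and v, so exchanging s and t flips the
  tensor factors of J. Results for a carry over to b in this way.\<close>

lemma twist_dual_swap:
  fixes \<zeta> :: "'k::field"
  shows "twist_dual G p \<zeta> t s F g = twist_dual G p \<zeta> s t (\<lambda>(x, y). F (y, x)) g"
proof -
  have swap: "(\<Sum>u<p. \<Sum>v<p. \<Sum>u'<p. \<Sum>v'<p. h u v u' v') = (\<Sum>v<p. \<Sum>u<p. \<Sum>v'<p. \<Sum>u'<p. h u v u' v')"
    for h :: "nat \<Rightarrow> nat \<Rightarrow> nat \<Rightarrow> nat \<Rightarrow> 'k"
    by (subst sum.swap) (rule sum.cong[OF HOL.refl], rule sum.cong[OF HOL.refl], rule sum.swap)
  show ?thesis unfolding twist_dual_def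
    by (subst swap) (simp add: mult.commute)
qed

text \<open>One half of the group: t commutes with a, while s acts on it by the power r. It is used
  for (sigma, tau, a) and again for (tau, sigma, b), the second time with flipped tensor
  factors.\<close>

locale half_twist = group G for G (structure) +
  fixes s t a :: 'a and p q r :: nat and \<zeta> :: "'k::field"
  assumes s_closed [simp]: "s \<in> carrier G" and t_closed [simp]: "t \<in> carrier G"
    and a_closed [simp]: "a \<in> carrier G"
    and s_pow: "s [^] p = \<one>" and t_pow: "t [^] p = \<one>" and a_pow: "a [^] q = \<one>"
    and s_t: "s \<otimes> t = t \<otimes> s" and t_a: "t \<otimes> a = a \<otimes> t" and s_a: "s \<otimes> a = a [^] r \<otimes> s"
    and p_pos: "0 < p" and char: "of_nat p \<noteq> (0 :: 'k)"
    and root: "primitive_root_of_unity p \<zeta>"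
begin

lemma zeta_nz: "\<zeta> \<noteq> 0"
proof
  assume "\<zeta> = 0"
  moreover have "\<zeta> ^ p = 1" using root by (simp add: primitive_root_of_unity_def)
  ultimately show False using p_pos by (simp add: power_0_left)
qed

lemma zeta_periodic: "\<zeta> ^ ((n + p) * k) = \<zeta> ^ (n * k)" "\<zeta> ^ (k * (n + p)) = \<zeta> ^ (k * n)"
proof -
  have "\<zeta> ^ (p * k) = 1"
    using primitive_root_of_unity_power_eq_1_iff[OF root p_pos, of "p * k"] by simp
  then show "\<zeta> ^ ((n + p) * k) = \<zeta> ^ (n * k)" "\<zeta> ^ (k * (n + p)) = \<zeta> ^ (k * n)"
    by (simp_all add: add_mult_distrib add_mult_distrib2 power_add mult.commute)
qed

lemma t_periodic: "t [^] (n + p) = t [^] n"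
  by (simp add: nat_pow_mult[symmetric] t_pow)

lemma s_periodic: "s [^] (n + p) = s [^] n"
  by (simp add: nat_pow_mult[symmetric] s_pow)

lemma a_pow_cong: "[l = m] (mod q) \<Longrightarrow> a [^] l = a [^] m"
proof -
  have "a [^] l = a [^] (l mod q)" for l
  proof -
    have "a [^] l = a [^] (q * (l div q) + l mod q)" by simp
    also have "\<dots> = (a [^] q) [^] (l div q) \<otimes> a [^] (l mod q)"
      by (simp add: nat_pow_mult nat_pow_pow)
    finally show ?thesis by (simp add: a_pow)
  qed
  then show "[l = m] (mod q) \<Longrightarrow> a [^] l = a [^] m" unfolding cong_def by metis
qed

lemma s_a_pow: "s \<otimes> a [^] (l::nat) = a [^] (r * l) \<otimes> s"
proof (induction l)
  case (Suc l)
  have "s \<otimes> a [^] Suc l = a [^] (r * l) \<otimes> (s \<otimes> a)"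
    using Suc by (simp add: m_assoc[symmetric])
  also have "\<dots> = a [^] (r * Suc l) \<otimes> s"
    by (simp add: s_a m_assoc[symmetric] nat_pow_mult add.commute)
  finally show ?case .
qed simp

lemma s_pow_a_pow: "s [^] (v::nat) \<otimes> a [^] (l::nat) = a [^] (r ^ v * l) \<otimes> s [^] v"
proof (induction v arbitrary: l)
  case (Suc v)
  have "s [^] Suc v \<otimes> a [^] l = s [^] v \<otimes> (s \<otimes> a [^] l)" by (simp add: m_assoc)
  also have "\<dots> = s [^] v \<otimes> a [^] (r * l) \<otimes> s" by (simp add: s_a_pow m_assoc)
  also have "\<dots> = a [^] (r ^ Suc v * l) \<otimes> s [^] Suc v"
    by (simp add: Suc m_assoc mult_ac)
  finally show ?case .
qed simp

lemma commute_pow: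
  assumes "x \<in> carrier G" "y \<in> carrier G" "x \<otimes> y = y \<otimes> x"
  shows "x [^] (m::nat) \<otimes> y [^] (n::nat) = y [^] n \<otimes> x [^] m"
proof -
  have 1: "x [^] m \<otimes> y = y \<otimes> x [^] m" for m :: nat
  proof (induction m)
    case (Suc m)
    then show ?case using assms by (simp add: m_assoc) (simp add: m_assoc[symmetric])
  qed (use assms in simp)
  show ?thesis
  proof (induction n)
    case (Suc n)
    then show ?case using assms 1[of m] by (simp add: m_assoc[symmetric]) (simp add: m_assoc)
  qed (use assms in simp)
qed

text \<open>Since t commutes with a, the two powers of t in the first factor merge into one;
  shifting u by u' produces zeta^(u' v), and the sum over u' then forces v + v' = 0 modulo p. What
  survives in the second factor is conjugation by s^v, which sends a^l to a^(r^v l).\<close>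

lemma twist_dual_t_a:
  fixes F :: "'a \<times> 'a \<Rightarrow> 'k"
  shows "twist_dual G p \<zeta> s t F (t [^] (n::nat) \<otimes> a [^] (l::nat)) = 1 / of_nat p *
     (\<Sum>u<p. \<Sum>v<p. inverse (\<zeta> ^ (u * v)) * F (t [^] (u + n) \<otimes> a [^] l, t [^] n \<otimes> a [^] (r ^ v * l)))"
proof -
  define A where "A = (\<lambda>m. t [^] (m + n) \<otimes> a [^] l)"
  define B where "B = (\<lambda>v (w::nat). t [^] n \<otimes> a [^] (r ^ v * l) \<otimes> s [^] w)"
  have A_periodic: "A (m + p) = A m" for m
    using t_periodic[of "m + n"] by (simp add: A_def add_ac)
  have B_periodic: "B v (m + p) = B v m" for v m by (simp add: B_def s_periodic)
  have A: "t [^] u \<otimes> (t [^] n \<otimes> a [^] l) \<otimes> t [^] u' = A (u + u')" for u u' :: nat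
  proof -
    have "t [^] u \<otimes> (t [^] n \<otimes> a [^] l) \<otimes> t [^] u' = t [^] u \<otimes> t [^] n \<otimes> (a [^] l \<otimes> t [^] u')"
      by (simp add: m_assoc)
    also have "\<dots> = t [^] u \<otimes> t [^] n \<otimes> (t [^] u' \<otimes> a [^] l)"
      by (simp add: commute_pow[OF t_closed a_closed t_a])
    also have "\<dots> = t [^] u \<otimes> t [^] n \<otimes> t [^] u' \<otimes> a [^] l" by (simp add: m_assoc)
    finally show ?thesis by (simp add: A_def nat_pow_mult add_ac)
  qed
  have B: "s [^] v \<otimes> (t [^] n \<otimes> a [^] l) \<otimes> s [^] v' = B v (v + v')" for v v' :: nat
  proof -
    have "s [^] v \<otimes> (t [^] n \<otimes> a [^] l) \<otimes> s [^] v' = s [^] v \<otimes> t [^] n \<otimes> a [^] l \<otimes> s [^] v'"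
      by (simp add: m_assoc)
    also have "\<dots> = t [^] n \<otimes> (s [^] v \<otimes> a [^] l) \<otimes> s [^] v'"
      by (simp add: commute_pow[OF s_closed t_closed s_t] m_assoc)
    also have "\<dots> = t [^] n \<otimes> a [^] (r ^ v * l) \<otimes> (s [^] v \<otimes> s [^] v')"
      by (simp add: s_pow_a_pow m_assoc)
    finally show ?thesis by (simp add: B_def nat_pow_mult)
  qed
  have shift_u: "(\<Sum>u<p. inverse (\<zeta> ^ (u * v)) * F (A (u + u'), y))
      = \<zeta> ^ (u' * v) * (\<Sum>u<p. inverse (\<zeta> ^ (u * v)) * F (A u, y))" for v u' y
  proof -
    have "(\<Sum>u<p. inverse (\<zeta> ^ (u * v)) * F (A (u + u'), y))
        = (\<Sum>u<p. \<zeta> ^ (u' * v) * (inverse (\<zeta> ^ ((u + u') * v)) * F (A (u + u'), y)))"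
      using zeta_nz by (intro sum.cong HOL.refl) (simp add: add_mult_distrib power_add)
    also have "\<dots> = \<zeta> ^ (u' * v) * (\<Sum>u<p. inverse (\<zeta> ^ (u * v)) * F (A u, y))"
      unfolding sum_distrib_left[symmetric]
      by (subst sum_shift_periodic[of "\<lambda>u. inverse (\<zeta> ^ (u * v)) * F (A u, y)"])
        (simp_all add: zeta_periodic A_periodic)
    finally show ?thesis .
  qed
  have "(\<Sum>u<p. \<Sum>v<p. \<Sum>u'<p. \<Sum>v'<p. inverse (\<zeta> ^ (u * v)) * \<zeta> ^ (u' * v') * F (A (u + u'), B v (v + v')))
      = (\<Sum>v<p. \<Sum>v'<p. \<Sum>u'<p. \<zeta> ^ (u' * v') *
          (\<Sum>u<p. inverse (\<zeta> ^ (u * v)) * F (A (u + u'), B v (v + v'))))"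
  proof -
    have swap: "(\<Sum>u<p. \<Sum>v<p. \<Sum>u'<p. \<Sum>v'<p. h u v u' v') = (\<Sum>v<p. \<Sum>v'<p. \<Sum>u'<p. \<Sum>u<p. h u v u' v')"
      for h :: "nat \<Rightarrow> nat \<Rightarrow> nat \<Rightarrow> nat \<Rightarrow> 'k"
    proof -
      have "(\<Sum>u<p. \<Sum>v<p. \<Sum>u'<p. \<Sum>v'<p. h u v u' v') = (\<Sum>v<p. \<Sum>u<p. \<Sum>v'<p. \<Sum>u'<p. h u v u' v')"
        by (subst sum.swap) (rule sum.cong[OF HOL.refl], rule sum.cong[OF HOL.refl], rule sum.swap)
      also have "\<dots> = (\<Sum>v<p. \<Sum>v'<p. \<Sum>u<p. \<Sum>u'<p. h u v u' v')"
        by (rule sum.cong[OF HOL.refl], rule sum.swap)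
      also have "\<dots> = (\<Sum>v<p. \<Sum>v'<p. \<Sum>u'<p. \<Sum>u<p. h u v u' v')"
        by (rule sum.cong[OF HOL.refl], rule sum.cong[OF HOL.refl], rule sum.swap)
      finally show ?thesis .
    qed
    show ?thesis by (subst swap) (simp add: sum_distrib_left mult_ac)
  qed
  also have "\<dots> = (\<Sum>v<p. \<Sum>v'<p. (\<Sum>u'<p. \<zeta> ^ (u' * (v + v'))) *
          (\<Sum>u<p. inverse (\<zeta> ^ (u * v)) * F (A u, B v (v + v'))))"
    unfolding shift_u by (simp add: sum_distrib_right add_mult_distrib2 power_add mult_ac)
  also have "\<dots> = (\<Sum>v<p. of_nat p * (\<Sum>u<p. inverse (\<zeta> ^ (u * v)) * F (A u, B v 0)))"
  proof (intro sum.cong HOL.refl)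
    fix v
    \<comment> \<open>As a function of w = v + v' the summand is p-periodic and supported on the
      multiples of p, so any p consecutive values contribute just the term at w = 0.\<close>
    define h where "h = (\<lambda>w. if p dvd w
        then of_nat p * (\<Sum>u<p. inverse (\<zeta> ^ (u * v)) * F (A u, B v w)) else 0)"
    have "(\<Sum>v'<p. (\<Sum>u'<p. \<zeta> ^ (u' * (v + v'))) *
          (\<Sum>u<p. inverse (\<zeta> ^ (u * v)) * F (A u, B v (v + v')))) = (\<Sum>v'<p. h (v' + v))"
      unfolding sum_powers_root_of_unity[OF root p_pos] h_def
      by (intro sum.cong) (auto simp: add.commute)
    also have "\<dots> = (\<Sum>w<p. h w)"
      by (intro sum_shift_periodic) (simp add: h_def B_periodic)
    also have "\<dots> = (\<Sum>w\<in>{0}. h w)"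
      using p_pos by (intro sum.mono_neutral_right) (auto simp: h_def dest: dvd_imp_le)
    finally show "(\<Sum>v'<p. (\<Sum>u'<p. \<zeta> ^ (u' * (v + v'))) *
          (\<Sum>u<p. inverse (\<zeta> ^ (u * v)) * F (A u, B v (v + v'))))
       = of_nat p * (\<Sum>u<p. inverse (\<zeta> ^ (u * v)) * F (A u, B v 0))"
      by (simp add: h_def)
  qed
  also have "\<dots> = of_nat p * (\<Sum>u<p. \<Sum>v<p. inverse (\<zeta> ^ (u * v)) * F (A u, B v 0))"
    unfolding sum_distrib_left by (rule sum.swap)
  finally show ?thesis
    unfolding twist_dual_def A B using char
    by (simp add: power2_eq_square A_def B_def)
qed

text \<open>The value of \<open>f\<close>, extended linearly, at e_w a^l, where e_w = 1/p times the
  sum of zeta^(-w u) t^u is an idempotent of K<t>.\<close>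

definition coeff_functional :: "('a \<Rightarrow> 'k) \<Rightarrow> nat \<Rightarrow> nat \<Rightarrow> 'k" where
  "coeff_functional f w l = 1 / of_nat p * (\<Sum>u<p. inverse (\<zeta> ^ (w * u)) * f (t [^] u \<otimes> a [^] l))"

lemma coeff_functional_cong:
  "[l = m] (mod q) \<Longrightarrow> coeff_functional f w l = coeff_functional f w m"
  unfolding coeff_functional_def using a_pow_cong[of l m] by simp

text \<open>This is \<open>\<Delta>\<^sub>J\<close>(e_w a^l) = sum over v of e_v a^l (x) e_(w-v)
  a^(r^v l), which makes the span of the e_w a^l a subcoalgebra. The periodic weight
  \<open>\<kappa>\<close> takes the place of a single index w and avoids reducing w - v modulo
  p.\<close>

lemma coeff_functional_twist_dual:
  fixes f g :: "'a \<Rightarrow> 'k" and \<kappa> :: "nat \<Rightarrow> 'k"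
  assumes "\<And>w. \<kappa> (w + p) = \<kappa> w"
  shows "(\<Sum>w<p. \<kappa> w * coeff_functional (twist_dual G p \<zeta> s t (\<lambda>(x, y). f x * g y)) w l)
    = (\<Sum>v<p. \<Sum>w<p. \<kappa> (w + v) * (coeff_functional f v l * coeff_functional g w (r ^ v * l)))"
proof -
  have shift: "(\<Sum>u<p. inverse (\<zeta> ^ (u * v)) * f (t [^] (u + n) \<otimes> a [^] l))
     = \<zeta> ^ (n * v) * (of_nat p * coeff_functional f v l)" for n v
  proof -
    have "(\<Sum>u<p. inverse (\<zeta> ^ (u * v)) * f (t [^] (u + n) \<otimes> a [^] l))
        = (\<Sum>u<p. \<zeta> ^ (n * v) * (inverse (\<zeta> ^ ((u + n) * v)) * f (t [^] (u + n) \<otimes> a [^] l)))"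
      using zeta_nz by (intro sum.cong HOL.refl) (simp add: add_mult_distrib power_add)
    also have "\<dots> = \<zeta> ^ (n * v) * (\<Sum>u<p. inverse (\<zeta> ^ (u * v)) * f (t [^] u \<otimes> a [^] l))"
      unfolding sum_distrib_left[symmetric]
      by (subst sum_shift_periodic[of "\<lambda>u. inverse (\<zeta> ^ (u * v)) * f (t [^] u \<otimes> a [^] l)"])
        (simp_all add: zeta_periodic t_periodic)
    finally show ?thesis using char by (simp add: coeff_functional_def mult.commute)
  qed
  have conv: "coeff_functional (twist_dual G p \<zeta> s t (\<lambda>(x, y). f x * g y)) w l
     = (\<Sum>v<p. coeff_functional f v l * (1 / of_nat p *
         (\<Sum>n<p. inverse (\<zeta> ^ (w * n)) * \<zeta> ^ (n * v) * g (t [^] n \<otimes> a [^] (r ^ v * l)))))" for w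
  proof -
    have td: "twist_dual G p \<zeta> s t (\<lambda>(x, y). f x * g y) (t [^] n \<otimes> a [^] l)
      = (\<Sum>v<p. \<zeta> ^ (n * v) * coeff_functional f v l * g (t [^] n \<otimes> a [^] (r ^ v * l)))" for n
    proof -
      have "twist_dual G p \<zeta> s t (\<lambda>(x, y). f x * g y) (t [^] n \<otimes> a [^] l)
        = 1 / of_nat p * (\<Sum>v<p. (\<Sum>u<p. inverse (\<zeta> ^ (u * v)) * f (t [^] (u + n) \<otimes> a [^] l))
             * g (t [^] n \<otimes> a [^] (r ^ v * l)))"
        unfolding twist_dual_t_a by (subst sum.swap) (simp add: sum_distrib_right mult.assoc)
      also have "\<dots> = (\<Sum>v<p. \<zeta> ^ (n * v) * coeff_functional f v l * g (t [^] n \<otimes> a [^] (r ^ v * l)))"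
        unfolding shift sum_distrib_left using char by (intro sum.cong HOL.refl) simp
      finally show ?thesis .
    qed
    have "coeff_functional (twist_dual G p \<zeta> s t (\<lambda>(x, y). f x * g y)) w l
      = (\<Sum>n<p. \<Sum>v<p. coeff_functional f v l * (1 / of_nat p *
         (inverse (\<zeta> ^ (w * n)) * \<zeta> ^ (n * v) * g (t [^] n \<otimes> a [^] (r ^ v * l)))))"
      unfolding coeff_functional_def[of "twist_dual G p \<zeta> s t (\<lambda>(x, y). f x * g y)"] td
        sum_distrib_left by (simp add: mult_ac)
    then show ?thesis by (subst (asm) sum.swap) (simp add: sum_distrib_left)
  qed
  \<comment> \<open>The factor zeta^(n v) turns the idempotent of index w into that of index w - v;
    substituting w + v for w moves the shift onto the weight.\<close>
  have inner: "(\<Sum>w<p. \<kappa> w * (\<Sum>n<p. inverse (\<zeta> ^ (w * n)) * \<zeta> ^ (n * v) * G n))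
      = (\<Sum>w<p. \<kappa> (w + v) * (\<Sum>n<p. inverse (\<zeta> ^ (w * n)) * G n))" for v and G :: "nat \<Rightarrow> 'k"
  proof -
    define h where "h = (\<lambda>w. \<kappa> w * (\<Sum>n<p. inverse (\<zeta> ^ (w * n)) * \<zeta> ^ (n * v) * G n))"
    have "(\<Sum>w<p. h w) = (\<Sum>w<p. h (w + v))"
      by (rule sum_shift_periodic[symmetric]) (simp add: h_def assms zeta_periodic)
    also have "\<dots> = (\<Sum>w<p. \<kappa> (w + v) * (\<Sum>n<p. inverse (\<zeta> ^ (w * n)) * G n))"
    proof (unfold h_def, intro sum.cong arg_cong2[of _ _ _ _ "(*)"] HOL.refl)
      show "inverse (\<zeta> ^ ((w + v) * n)) * \<zeta> ^ (n * v) = inverse (\<zeta> ^ (w * n))" for w n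
        using zeta_nz by (simp add: add_mult_distrib2 power_add mult.commute)
    qed
    finally show ?thesis by (simp add: h_def)
  qed
  have "(\<Sum>w<p. \<kappa> w * coeff_functional (twist_dual G p \<zeta> s t (\<lambda>(x, y). f x * g y)) w l)
    = (\<Sum>v<p. coeff_functional f v l * (1 / of_nat p * (\<Sum>w<p. \<kappa> w *
         (\<Sum>n<p. inverse (\<zeta> ^ (w * n)) * \<zeta> ^ (n * v) * g (t [^] n \<otimes> a [^] (r ^ v * l))))))"
    unfolding conv sum_distrib_left by (subst sum.swap) (simp add: mult_ac)
  also have "\<dots> = (\<Sum>v<p. \<Sum>w<p. \<kappa> (w + v) * (coeff_functional f v l * coeff_functional g w (r ^ v * l)))"
    unfolding inner by (simp add: coeff_functional_def[of g] sum_distrib_left mult_ac)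
  finally show ?thesis .
qed

end

section \<open>The comodule indexed by the nonzero residues modulo q\<close>

locale half_twist_prime = half_twist G s t a p q r \<zeta>
  for G (structure) and s t a :: 'a and p q r :: nat and \<zeta> :: "'k::field" +
  assumes q_prime: "prime q" and q_r: "coprime q r"
    and r_pow_cong_1_iff: "\<And>n. [r ^ n = 1] (mod q) \<longleftrightarrow> p dvd n"
begin

lemma r_pow_periodic: "[r ^ (n + p) * l = r ^ n * l] (mod q)"
proof -
  have "[r ^ p * (r ^ n * l) = 1 * (r ^ n * l)] (mod q)"
    using r_pow_cong_1_iff[of p] by (intro cong_scalar_right) simp
  then show ?thesis by (simp add: power_add mult_ac)
qed

text \<open>The value of \<open>f\<close> at the matrix coefficient c_(l,k), the sum of e_w a^l over
  those w < p with r^w l = k modulo q. For l, k and m running over the nonzero residues,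
  \<open>\<Delta>\<^sub>J\<close>(c_(l,k)) is the sum over m of c_(l,m) (x) c_(m,k).\<close>

definition comodule_matrix :: "('a \<Rightarrow> 'k) \<Rightarrow> nat \<Rightarrow> nat \<Rightarrow> 'k" where
  "comodule_matrix f l k =
     (\<Sum>w<p. (if [r ^ w * l = k] (mod q) then 1 else 0) * coeff_functional f w l)"

lemma not_dvd_r_pow_mult: "0 < l \<Longrightarrow> l < q \<Longrightarrow> \<not> q dvd r ^ v * l"
proof
  assume "0 < l" "l < q" "q dvd r ^ v * l"
  moreover have "coprime q (r ^ v)" using q_r by simp
  ultimately have "q dvd l" by (simp add: coprime_dvd_mult_right_iff)
  then show False using \<open>0 < l\<close> \<open>l < q\<close> by (auto dest: dvd_imp_le)
qed

text \<open>The counit of e_w a^l is 1 for w = 0 and 0 for the other w, so the unit of D acts as the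
  identity matrix.\<close>

lemma comodule_matrix_one:
  assumes "0 < l" "l < q" "0 < k" "k < q"
  shows "comodule_matrix (\<lambda>_. 1) l k = (if l = k then 1 else 0)"
proof -
  have "coeff_functional (\<lambda>_. 1) w l = (if w = 0 then 1 else 0)" if "w < p" for w
    using sum_inverse_powers_root_of_unity[OF root p_pos, of w] that char
    by (auto simp: coeff_functional_def mult.commute dest: dvd_imp_le)
  then have "comodule_matrix (\<lambda>_. 1) l k
      = (\<Sum>w<p. if w = 0 then (if [r ^ w * l = k] (mod q) then 1 else 0) else 0)"
    unfolding comodule_matrix_def by (intro sum.cong) auto
  also have "\<dots> = (if [l = k] (mod q) then 1 else 0)"
    using p_pos by (simp add: sum.delta)
  also have "[l = k] (mod q) \<longleftrightarrow> l = k" using assms by (simp add: cong_def)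
  finally show ?thesis .
qed

text \<open>In the coproduct of e_w a^l the exponent l becomes r^v l in the second factor; m = r^v l
  mod q is the intermediate index on the way from l to k. It is nonzero because r is prime to
  q.\<close>

lemma comodule_matrix_twist_dual:
  assumes "0 < l" "l < q"
  shows "comodule_matrix (twist_dual G p \<zeta> s t (\<lambda>(x, y). f x * g y)) l k
    = (\<Sum>m\<in>{0<..<q}. comodule_matrix f l m * comodule_matrix g m k)"
proof -
  let ?\<kappa> = "\<lambda>w. if [r ^ w * l = k] (mod q) then 1 else 0 :: 'k"
  have step: "comodule_matrix g ((r ^ v * l) mod q) k
     = (\<Sum>w<p. ?\<kappa> (w + v) * coeff_functional g w (r ^ v * l))" for v
  proof -
    have "[r ^ w * (r ^ v * l mod q) = k] (mod q) \<longleftrightarrow> [r ^ (w + v) * l = k] (mod q)" for w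
      by (simp add: cong_def mod_mult_right_eq power_add mult.assoc)
    moreover have "coeff_functional g w (r ^ v * l mod q) = coeff_functional g w (r ^ v * l)" for w
      by (intro coeff_functional_cong) (simp add: cong_def)
    ultimately show ?thesis by (simp add: comodule_matrix_def)
  qed
  have "comodule_matrix (twist_dual G p \<zeta> s t (\<lambda>(x, y). f x * g y)) l k
    = (\<Sum>v<p. \<Sum>w<p. ?\<kappa> (w + v) * (coeff_functional f v l * coeff_functional g w (r ^ v * l)))"
    unfolding comodule_matrix_def
  proof (rule coeff_functional_twist_dual)
    show "?\<kappa> (w + p) = ?\<kappa> w" for w
      using r_pow_periodic[of w l] by (auto simp: cong_def)
  qed
  also have "\<dots> = (\<Sum>v<p. coeff_functional f v l * comodule_matrix g ((r ^ v * l) mod q) k)"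
    unfolding step by (simp add: sum_distrib_left mult_ac)
  also have "\<dots> = (\<Sum>v<p. \<Sum>m\<in>{0<..<q}. if m = (r ^ v * l) mod q
      then coeff_functional f v l * comodule_matrix g m k else 0)"
    using not_dvd_r_pow_mult[OF assms] prime_gt_0_nat[OF q_prime]
    by (intro sum.cong HOL.refl) (simp add: sum.delta' dvd_eq_mod_eq_0)
  also have "\<dots> = (\<Sum>m\<in>{0<..<q}. \<Sum>v<p. (if [r ^ v * l = m] (mod q) then 1 else 0)
      * coeff_functional f v l * comodule_matrix g m k)"
    by (subst sum.swap, intro sum.cong HOL.refl) (auto simp: cong_def)
  finally show ?thesis by (simp add: comodule_matrix_def[of f] sum_distrib_right)
qed

text \<open>For w < p, a nonzero residue l is fixed by multiplication with r^w only if w = 0, so the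
  diagonal entry at l is the value of \<open>f\<close> at e_0 a^l.\<close>

lemma comodule_matrix_trace:
  "(\<Sum>l\<in>{0<..<q}. comodule_matrix f l l)
    = 1 / of_nat p * (\<Sum>u<p. \<Sum>l\<in>{0<..<q}. f (t [^] u \<otimes> a [^] l))"
proof -
  have "comodule_matrix f l l = coeff_functional f 0 l" if "l \<in> {0<..<q}" for l
  proof -
    have "[r ^ w * l = l] (mod q) \<longleftrightarrow> w = 0" if "w < p" for w
    proof -
      have "coprime l q" using \<open>l \<in> _\<close> q_prime
        by (metis coprime_commute dvd_imp_le greaterThanLessThan_iff not_le prime_imp_coprime)
      then have "[r ^ w * l = 1 * l] (mod q) \<longleftrightarrow> [r ^ w = 1] (mod q)"
        by (rule cong_mult_rcancel_nat)
      then show ?thesis using r_pow_cong_1_iff[of w] that by (auto dest: dvd_imp_le)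
    qed
    then have "comodule_matrix f l l = (\<Sum>w<p. if w = 0 then coeff_functional f w l else 0)"
      unfolding comodule_matrix_def by (intro sum.cong) auto
    then show ?thesis using p_pos by (simp add: sum.delta)
  qed
  then have "(\<Sum>l\<in>{0<..<q}. comodule_matrix f l l) = (\<Sum>l\<in>{0<..<q}. coeff_functional f 0 l)"
    by simp
  also have "\<dots> = 1 / of_nat p * (\<Sum>l\<in>{0<..<q}. \<Sum>u<p. f (t [^] u \<otimes> a [^] l))"
    by (simp add: coeff_functional_def sum_distrib_left)
  finally show ?thesis by (subst (asm) sum.swap)
qed

lemma comodule_matrix_linear:
  assumes "\<And>g. g \<in> carrier G \<Longrightarrow> f g = (\<Sum>m\<in>T. c m * \<phi> m g)"
  shows "comodule_matrix f l k = (\<Sum>m\<in>T. c m * comodule_matrix (\<phi> m) l k)"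
proof -
  have "coeff_functional f w l = (\<Sum>m\<in>T. c m * coeff_functional (\<phi> m) w l)" for w
  proof -
    have "coeff_functional f w l
       = 1 / of_nat p * (\<Sum>u<p. \<Sum>m\<in>T. c m * (inverse (\<zeta> ^ (w * u)) * \<phi> m (t [^] u \<otimes> a [^] l)))"
      unfolding coeff_functional_def by (simp add: assms sum_distrib_left mult_ac)
    then show ?thesis
      by (subst (asm) sum.swap) (simp add: coeff_functional_def sum_distrib_left mult_ac)
  qed
  then show ?thesis
    unfolding comodule_matrix_def sum_distrib_left
    by (simp only: sum_distrib_left) (subst sum.swap, simp add: mult_ac)
qed

text \<open>The functions in \<open>D\<close> act on the comodule with matrix coefficients \<open>comodule_matrix\<close>; the sum
  below is the trace of this action.\<close>

lemma trace_functional_mem: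
  assumes "valuation_ring V" and "finite T" and "\<And>m. m \<in> T \<Longrightarrow> \<phi> m \<in> D"
    and gens: "\<And>f. f \<in> D \<Longrightarrow> \<exists>c. (\<forall>m\<in>T. c m \<in> V) \<and> (\<forall>g\<in>carrier G. f g = (\<Sum>m\<in>T. c m * \<phi> m g))"
    and one: "(\<lambda>_. 1) \<in> D"
    and conv: "\<And>f g. f \<in> D \<Longrightarrow> g \<in> D \<Longrightarrow> twist_dual G p \<zeta> s t (\<lambda>(x, y). f x * g y) \<in> D"
    and "f \<in> D"
  shows "1 / of_nat p * (\<Sum>u<p. \<Sum>l\<in>{0<..<q}. f (t [^] u \<otimes> a [^] l)) \<in> V"
proof -
  interpret valuation_ring V by fact
  have "(\<Sum>l\<in>{0<..<q}. comodule_matrix f l l) \<in> V"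
  proof (rule trace_mem[where T = T and A = "\<lambda>m. comodule_matrix (\<phi> m)" and \<A> = "comodule_matrix ` D"
        and B = "comodule_matrix f"])
    show "\<exists>c. (\<forall>m\<in>T. c m \<in> V) \<and> (\<forall>l\<in>{0<..<q}. \<forall>k\<in>{0<..<q}.
        B l k = (\<Sum>m\<in>T. c m * comodule_matrix (\<phi> m) l k))" if B: "B \<in> comodule_matrix ` D" for B
    proof -
      obtain h where h: "h \<in> D" "B = comodule_matrix h" using B by auto
      obtain c where "\<forall>m\<in>T. c m \<in> V" "\<forall>g\<in>carrier G. h g = (\<Sum>m\<in>T. c m * \<phi> m g)"
        using gens[OF h(1)] by blast
      then show ?thesis unfolding h(2) using comodule_matrix_linear[of h] by blast
    qed
    show "\<exists>E\<in>comodule_matrix ` D. \<forall>l\<in>{0<..<q}. \<forall>k\<in>{0<..<q}.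
        E l k = (\<Sum>m\<in>{0<..<q}. B l m * C m k)"
      if BC: "B \<in> comodule_matrix ` D" "C \<in> comodule_matrix ` D" for B C
    proof -
      obtain h h' where "h \<in> D" "B = comodule_matrix h" "h' \<in> D" "C = comodule_matrix h'"
        using BC by auto
      then show ?thesis
        using conv[of h h'] comodule_matrix_twist_dual[of _ h h']
        by (intro bexI[of _ "comodule_matrix (twist_dual G p \<zeta> s t (\<lambda>(x, y). h x * h' y))"]) auto
    qed
    show "\<exists>E\<in>comodule_matrix ` D. \<forall>l\<in>{0<..<q}. \<forall>k\<in>{0<..<q}. E l k = (if l = k then 1 else 0)"
      using one comodule_matrix_one by (intro bexI[of _ "comodule_matrix (\<lambda>_. 1)"]) auto
  qed (use assms in auto)
  then show ?thesis unfolding comodule_matrix_trace .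
qed

end

section \<open>The dual of an order\<close>

definition pairing :: "('g, 'm) monoid_scheme \<Rightarrow> ('g \<Rightarrow> 'k::field) \<Rightarrow> ('g \<Rightarrow> 'k) \<Rightarrow> 'k" where
  "pairing G f x = (\<Sum>g\<in>carrier G. x g * f g)"

lemma pairing_cong: "(\<And>g. g \<in> carrier G \<Longrightarrow> f g = f' g) \<Longrightarrow> pairing G f x = pairing G f' x"
  unfolding pairing_def by (intro sum.cong) auto

lemma pairing_swap:
  "pairing G (\<lambda>g. pairing H (\<lambda>h. F g h) y) x = pairing H (\<lambda>h. pairing G (\<lambda>g. F g h) x) y"
  unfolding pairing_def sum_distrib_left by (subst sum.swap) (simp add: mult_ac)

lemma pairing_scale: "pairing G (\<lambda>g. c * f g) x = c * pairing G f x"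
  unfolding pairing_def by (simp add: sum_distrib_left mult_ac)

lemma pairing_scale_right: "pairing G (\<lambda>g. f g * c) x = pairing G f x * c"
  unfolding pairing_def by (simp add: sum_distrib_left mult_ac)

lemma pairing_add: "pairing G (\<lambda>g. f g + f' g) x = pairing G f x + pairing G f' x"
  unfolding pairing_def by (simp add: algebra_simps sum.distrib)

lemma pairing_diff: "pairing G (\<lambda>g. f g - f' g) x = pairing G f x - pairing G f' x"
  unfolding pairing_def by (simp add: algebra_simps sum_subtractf)

lemma pairing_sum:
  "(\<And>g. g \<in> carrier G \<Longrightarrow> x g = (\<Sum>i\<in>I. c i * e i g)) \<Longrightarrow> pairing G f x = (\<Sum>i\<in>I. c i * pairing G f (e i))"
proof -
  assume "\<And>g. g \<in> carrier G \<Longrightarrow> x g = (\<Sum>i\<in>I. c i * e i g)"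
  then have "pairing G f x = (\<Sum>g\<in>carrier G. \<Sum>i\<in>I. c i * (e i g * f g))"
    unfolding pairing_def by (intro sum.cong HOL.refl) (simp add: sum_distrib_left sum_distrib_right mult_ac)
  then show ?thesis by (subst (asm) sum.swap) (simp add: pairing_def sum_distrib_left)
qed

lemma pairing_group_element:
  assumes "finite (carrier G)" "g \<in> carrier G"
  shows "pairing G f (group_element g) = f g"
proof -
  have "pairing G f (group_element g) = (\<Sum>x\<in>carrier G. if x = g then f x else 0)"
    unfolding pairing_def group_element_def by (intro sum.cong) auto
  then show ?thesis using assms by simp
qed

text \<open>Substituting z = g h turns the convolution product into an evaluation of
  \<open>f\<close> at products in G. Later computations use this form and never unfold the
  convolution.\<close>

lemma (in group) pairing_mult:
  fixes f :: "'a \<Rightarrow> 'k::field"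
  assumes "finite (carrier G)"
  shows "pairing G f (x \<otimes>\<^bsub>group_algebra G\<^esub> y) = pairing G (\<lambda>g. pairing G (\<lambda>h. f (g \<otimes> h)) y) x"
proof -
  have "pairing G f (x \<otimes>\<^bsub>group_algebra G\<^esub> y)
     = (\<Sum>z\<in>carrier G. \<Sum>g\<in>carrier G. x g * (y (inv g \<otimes> z) * f z))"
    unfolding pairing_def group_algebra_def by (simp add: sum_distrib_right mult.assoc)
  also have "\<dots> = (\<Sum>g\<in>carrier G. x g * (\<Sum>z\<in>carrier G. y (inv g \<otimes> z) * f z))"
    by (subst sum.swap) (simp add: sum_distrib_left)
  also have "\<dots> = (\<Sum>g\<in>carrier G. x g * (\<Sum>h\<in>carrier G. y h * f (g \<otimes> h)))"
  proof (rule sum.cong[OF HOL.refl], rule arg_cong2[of _ _ _ _ "(*)", OF HOL.refl])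
    fix g assume g: "g \<in> carrier G"
    show "(\<Sum>z\<in>carrier G. y (inv g \<otimes> z) * f z) = (\<Sum>h\<in>carrier G. y h * f (g \<otimes> h))"
      by (rule sum.reindex_bij_witness[of _ "\<lambda>h. g \<otimes> h" "\<lambda>z. inv g \<otimes> z"])
        (use g in \<open>auto simp: m_assoc[symmetric]\<close>)
  qed
  finally show ?thesis by (simp add: pairing_def)
qed

text \<open>\<open>M\<close> will be the original order over R; V occurs as the range of the
  coefficients and of the counit. \<open>span\<close> says that \<open>M\<close> spans KG over K,
  and \<open>comult_M\<close> that \<open>\<Delta>\<^sub>J\<close> sends \<open>M\<close> to sums of
  pure tensors of elements of \<open>M\<close>, tested against all functions F on pairs of group
  elements.\<close>

locale twisted_order = valuation_ring V + group G
  for V :: "'k::field set" and G :: "('g, 'm) monoid_scheme" (structure) +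
  fixes M :: "('g \<Rightarrow> 'k) set" and T :: "'t set" and e :: "'t \<Rightarrow> 'g \<Rightarrow> 'k"
    and p :: nat and \<zeta> :: 'k and s t :: 'g
  assumes finite_G: "finite (carrier G)"
    and finite_T: "finite T" and e_mem: "m \<in> T \<Longrightarrow> e m \<in> M"
    and generate: "x \<in> M \<Longrightarrow> \<exists>c. (\<forall>m\<in>T. c m \<in> V) \<and> (\<forall>g\<in>carrier G. x g = (\<Sum>m\<in>T. c m * e m g))"
    and span: "h \<in> carrier G \<Longrightarrow> \<exists>c. \<forall>g\<in>carrier G. group_element h g = (\<Sum>m\<in>T. c m * e m g)"
    and one_M: "group_element \<one> \<in> M"
    and mult_M: "x \<in> M \<Longrightarrow> y \<in> M \<Longrightarrow> x \<otimes>\<^bsub>group_algebra G\<^esub> y \<in> M"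
    and counit_M: "x \<in> M \<Longrightarrow> pairing G (\<lambda>_. 1) x \<in> V"
    and comult_M: "x \<in> M \<Longrightarrow> \<exists>S. set S \<subseteq> M \<times> M \<and>
      (\<forall>F. pairing G (twist_dual G p \<zeta> s t F) x
        = (\<Sum>(y, z)\<leftarrow>S. pairing G (\<lambda>g. pairing G (\<lambda>h. F (g, h)) z) y))"
begin

definition dual :: "('g \<Rightarrow> 'k) set" where
  "dual = {f. \<forall>x\<in>M. pairing G f x \<in> V}"

definition bidual :: "('g \<Rightarrow> 'k) set" where
  "bidual = {y. \<forall>f\<in>dual. pairing G f y \<in> V}"

lemma dualI: "(\<And>x. x \<in> M \<Longrightarrow> pairing G f x \<in> V) \<Longrightarrow> f \<in> dual"
  by (simp add: dual_def)

lemma dualD: "f \<in> dual \<Longrightarrow> x \<in> M \<Longrightarrow> pairing G f x \<in> V"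
  by (simp add: dual_def)

lemma bidualD: "y \<in> bidual \<Longrightarrow> f \<in> dual \<Longrightarrow> pairing G f y \<in> V"
  by (simp add: bidual_def)

lemma M_subset_bidual: "M \<subseteq> bidual"
  by (auto simp: bidual_def dual_def)

lemma dual_diff: "f \<in> dual \<Longrightarrow> f' \<in> dual \<Longrightarrow> (\<lambda>g. f g - f' g) \<in> dual"
  by (simp add: dual_def pairing_diff diff_mem)

lemma dual_one: "(\<lambda>_. 1) \<in> dual"
  using counit_M by (simp add: dual_def)

lemma dual_cong: "(\<And>g. g \<in> carrier G \<Longrightarrow> f g = f' g) \<Longrightarrow> f \<in> dual \<longleftrightarrow> f' \<in> dual"
  unfolding dual_def using pairing_cong[of G f f'] by simp

lemma dual_value_one: "f \<in> dual \<Longrightarrow> f \<one> \<in> V"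
  using dualD[OF _ one_M] pairing_group_element[OF finite_G one_closed] by metis

text \<open>Closure of D under the product dual to \<open>\<Delta>\<^sub>J\<close>: on a pure tensor
  of elements of \<open>M\<close> the value is a product of two elements of V.\<close>

lemma dual_twist_dual:
  assumes "f \<in> dual" "f' \<in> dual"
  shows "twist_dual G p \<zeta> s t (\<lambda>(x, y). f x * f' y) \<in> dual"
proof (rule dualI)
  fix x assume "x \<in> M"
  then obtain S where S: "set S \<subseteq> M \<times> M"
    "pairing G (twist_dual G p \<zeta> s t (\<lambda>(x, y). f x * f' y)) x
       = (\<Sum>(y, z)\<leftarrow>S. pairing G (\<lambda>g. pairing G (\<lambda>h. f g * f' h) z) y)"
    using comult_M by fastforce
  have "pairing G (\<lambda>g. pairing G (\<lambda>h. f g * f' h) z) y = pairing G f y * pairing G f' z" for y z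
    by (simp add: pairing_scale pairing_scale_right)
  then show "pairing G (twist_dual G p \<zeta> s t (\<lambda>(x, y). f x * f' y)) x \<in> V"
    using S assms by (auto intro!: sum_list_mem mult_mem dualD)
qed

text \<open>For x in \<open>M\<close> the functional sending h to f(x h) lies in D because
  \<open>M\<close> is closed under products, so it may be evaluated at a bidual element. Right
  translation by bidual elements thus acts on D.\<close>

lemma dual_contract_right:
  assumes "f \<in> dual" "y \<in> bidual"
  shows "(\<lambda>g. pairing G (\<lambda>h. f (g \<otimes> h)) y) \<in> dual"
proof (rule dualI)
  fix x assume x: "x \<in> M"
  have "(\<lambda>h. pairing G (\<lambda>g. f (g \<otimes> h)) x) \<in> dual"
  proof (rule dualI)
    fix z assume "z \<in> M"
    then have "pairing G f (x \<otimes>\<^bsub>group_algebra G\<^esub> z) \<in> V" using x assms(1) mult_M dualD by blast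
    then show "pairing G (\<lambda>h. pairing G (\<lambda>g. f (g \<otimes> h)) x) z \<in> V"
      by (subst pairing_swap) (simp add: pairing_mult[OF finite_G])
  qed
  then show "pairing G (\<lambda>g. pairing G (\<lambda>h. f (g \<otimes> h)) y) x \<in> V"
    using bidualD[OF assms(2)] by (subst pairing_swap) blast
qed

text \<open>The element below is \<open>(\<chi> \<otimes> f)(\<Delta>\<^sub>J(x) \<Delta>\<^sub>J(y))\<close>.\<close>

lemma contraction_mem:
  assumes "\<chi> \<in> dual" "f \<in> dual" "x \<in> bidual" "y \<in> bidual"
  shows "pairing G (twist_dual G p \<zeta> s t (\<lambda>(g1, g2). pairing G (twist_dual G p \<zeta> s t
     (\<lambda>(h1, h2). \<chi> (g1 \<otimes> h1) * f (g2 \<otimes> h2))) y)) x \<in> V"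
proof -
  let ?td = "twist_dual G p \<zeta> s t"
  let ?F = "\<lambda>(g1, g2) (h1, h2). \<chi> (g1 \<otimes> h1) * f (g2 \<otimes> h2)"
  have swap: "?td (\<lambda>z. pairing G (F z) w) g = pairing G (\<lambda>h. ?td (\<lambda>z. F z h) g) w"
    for F :: "'g \<times> 'g \<Rightarrow> 'g \<Rightarrow> 'k" and g w
    unfolding twist_dual_def pairing_def sum_distrib_left
    apply (simp only: sum.swap[of _ _ "carrier G"])
    apply (simp add: mult_ac)
    done
  \<comment> \<open>For two arguments in \<open>M\<close>, both coproducts are sums of pure tensors
    of \<open>M\<close>, and so is their product. The arguments are then moved from \<open>M\<close>
    to the bidual one at a time: with one of them fixed, the expression is a functional of the other
    that belongs to D.\<close>
  have M_case: "pairing G (?td (\<lambda>z. pairing G (?td (?F z)) w)) v \<in> V" if "v \<in> M" "w \<in> M" for v w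
  proof -
    obtain S where S: "set S \<subseteq> M \<times> M" "\<And>F. pairing G (?td F) v
       = (\<Sum>(y, z)\<leftarrow>S. pairing G (\<lambda>g. pairing G (\<lambda>h. F (g, h)) z) y)"
      using comult_M[OF \<open>v \<in> M\<close>] by blast
    obtain S' where S': "set S' \<subseteq> M \<times> M" "\<And>F. pairing G (?td F) w
       = (\<Sum>(y, z)\<leftarrow>S'. pairing G (\<lambda>g. pairing G (\<lambda>h. F (g, h)) z) y)"
      using comult_M[OF \<open>w \<in> M\<close>] by blast
    have prod: "pairing G (\<lambda>g1. pairing G (\<lambda>g2. pairing G (\<lambda>h1. pairing G (\<lambda>h2. \<chi> (g1 \<otimes> h1) * f (g2 \<otimes> h2)) z') y') z) y
        = pairing G \<chi> (y \<otimes>\<^bsub>group_algebra G\<^esub> y') * pairing G f (z \<otimes>\<^bsub>group_algebra G\<^esub> z')" for y z y' z'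
      by (simp add: pairing_mult[OF finite_G] pairing_scale pairing_scale_right)
    have pairing_list: "pairing G (\<lambda>g. \<Sum>u\<leftarrow>L. H u g) y = (\<Sum>u\<leftarrow>L. pairing G (H u) y)"
      for H :: "'u \<Rightarrow> 'g \<Rightarrow> 'k" and L y
      by (induction L) (simp_all add: pairing_add, simp add: pairing_def)
    have "pairing G (?td (\<lambda>z. pairing G (?td (?F z)) w)) v
      = (\<Sum>(y, z)\<leftarrow>S. pairing G (\<lambda>g1. pairing G (\<lambda>g2. \<Sum>(y', z')\<leftarrow>S'.
           pairing G (\<lambda>h1. pairing G (\<lambda>h2. \<chi> (g1 \<otimes> h1) * f (g2 \<otimes> h2)) z') y') z) y)"
      unfolding S(2) S'(2) by simp
    also have "\<dots> = (\<Sum>(y, z)\<leftarrow>S. \<Sum>(y', z')\<leftarrow>S'.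
        pairing G \<chi> (y \<otimes>\<^bsub>group_algebra G\<^esub> y') * pairing G f (z \<otimes>\<^bsub>group_algebra G\<^esub> z'))"
      unfolding case_prod_unfold pairing_list prod ..
    also have "\<dots> \<in> V"
      using S(1) S'(1) assms(1,2) by (auto intro!: sum_list_mem mult_mem dualD mult_M)
    finally show ?thesis .
  qed
  have left: "?td (\<lambda>z. pairing G (?td (?F z)) w) \<in> dual" if "w \<in> M" for w
    using M_case that by (intro dualI)
  have "(\<lambda>h. pairing G (?td (\<lambda>z. ?td (?F z) h)) x) \<in> dual"
  proof (rule dualI)
    fix w assume "w \<in> M"
    then have "pairing G (?td (\<lambda>z. pairing G (?td (?F z)) w)) x \<in> V"
      using left bidualD[OF assms(3)] by blast
    then show "pairing G (\<lambda>h. pairing G (?td (\<lambda>z. ?td (?F z) h)) x) w \<in> V"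
      unfolding swap by (subst pairing_swap)
  qed
  then have "pairing G (\<lambda>h. pairing G (?td (\<lambda>z. ?td (?F z) h)) x) y \<in> V"
    using bidualD[OF assms(4)] by blast
  then have "pairing G (?td (\<lambda>z. pairing G (?td (?F z)) y)) x \<in> V"
    unfolding swap by (subst pairing_swap)
  then show ?thesis by (simp add: case_prod_unfold)
qed

text \<open>The generators are the coefficient functionals of a dual system for the
  \<open>e i\<close> inside the bidual. The coefficients of f are its values at the
  \<open>b m\<close>, which lie in V because the \<open>b m\<close> are in the bidual. As
  \<open>M\<close> spans KG, the expansion passes from the \<open>e i\<close> to all group
  elements.\<close>

lemma dual_finitely_generated:
  "\<exists>(N::nat) \<phi>. (\<forall>m<N. \<phi> m \<in> dual) \<and>
    (\<forall>f\<in>dual. \<exists>c. (\<forall>m<N. c m \<in> V) \<and> (\<forall>g\<in>carrier G. f g = (\<Sum>m<N. c m * \<phi> m g)))"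
proof -
  have "is_submodule V bidual"
    unfolding is_submodule_def
  proof (intro conjI ballI)
    show "(\<lambda>_. 0) \<in> bidual" by (simp add: bidual_def pairing_def zero_mem)
    show "(\<lambda>i. x i + y i) \<in> bidual" if "x \<in> bidual" "y \<in> bidual" for x y
      using that by (auto simp: bidual_def pairing_def algebra_simps sum.distrib intro: add_mem)
    show "(\<lambda>i. c * x i) \<in> bidual" if "c \<in> V" "x \<in> bidual" for c x
      using that by (auto simp: bidual_def pairing_def mult.assoc sum_distrib_left[symmetric] intro: mult_mem)
  qed
  then obtain N :: nat and b \<phi> where b: "\<forall>m<N. b m \<in> bidual"
    and \<phi>: "\<forall>m<N. \<forall>i\<in>T. (\<Sum>g\<in>carrier G. \<phi> m g * e i g) \<in> V"
    and expand: "\<forall>i\<in>T. \<forall>g\<in>carrier G. e i g = (\<Sum>m<N. (\<Sum>h\<in>carrier G. \<phi> m h * e i h) * b m g)"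
    using dual_basis[OF finite_G finite_T, of bidual e] e_mem M_subset_bidual by blast
  have pairing: "(\<Sum>g\<in>carrier G. \<phi> m g * x g) = pairing G (\<phi> m) x" for m x
    by (simp add: pairing_def mult.commute)
  have "\<phi> m \<in> dual" if "m < N" for m
  proof (rule dualI)
    fix x assume "x \<in> M"
    then obtain c where c: "\<forall>i\<in>T. c i \<in> V" "\<forall>g\<in>carrier G. x g = (\<Sum>i\<in>T. c i * e i g)"
      using generate by blast
    then have "pairing G (\<phi> m) x = (\<Sum>i\<in>T. c i * pairing G (\<phi> m) (e i))"
      by (intro pairing_sum) auto
    then show "pairing G (\<phi> m) x \<in> V"
      using c(1) \<phi> that unfolding pairing by (auto intro!: sum_mem mult_mem)
  qed
  moreover have "\<exists>c. (\<forall>m<N. c m \<in> V) \<and> (\<forall>g\<in>carrier G. f g = (\<Sum>m<N. c m * \<phi> m g))"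
    if f: "f \<in> dual" for f
  proof (intro exI[of _ "\<lambda>m. pairing G f (b m)"] conjI allI impI ballI)
    show "pairing G f (b m) \<in> V" if "m < N" for m using b that f bidualD by blast
    fix h assume h: "h \<in> carrier G"
    obtain c where c: "\<forall>g\<in>carrier G. group_element h g = (\<Sum>i\<in>T. c i * e i g)"
      using span[OF h] by blast
    have "group_element h g = (\<Sum>m<N. \<phi> m h * b m g)" if g: "g \<in> carrier G" for g
    proof -
      have "group_element h g = (\<Sum>i\<in>T. \<Sum>m<N. c i * (pairing G (\<phi> m) (e i) * b m g))"
        using c expand g unfolding pairing by (simp add: sum_distrib_left cong: sum.cong)
      also have "\<dots> = (\<Sum>m<N. (\<Sum>i\<in>T. c i * pairing G (\<phi> m) (e i)) * b m g)"
        by (subst sum.swap) (simp add: sum_distrib_right mult.assoc)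
      also have "\<dots> = (\<Sum>m<N. pairing G (\<phi> m) (group_element h) * b m g)"
        using c by (intro sum.cong HOL.refl arg_cong2[of _ _ _ _ "(*)"] pairing_sum[symmetric]) blast
      finally show ?thesis by (simp add: pairing_group_element[OF finite_G h])
    qed
    then have "pairing G f (group_element h) = (\<Sum>m<N. \<phi> m h * pairing G f (b m))"
      by (rule pairing_sum)
    then show "f h = (\<Sum>m<N. pairing G f (b m) * \<phi> m h)"
      by (simp add: pairing_group_element[OF finite_G h] mult.commute)
  qed
  ultimately show ?thesis by blast
qed

text \<open>The number of fixed points is the trace of the permutation matrix. The matrices by which
  \<open>M\<close> acts contain the identity, are closed under products and are generated over V by
  finitely many of them, so their traces lie in V.\<close>

lemma permutation_character_dual:
  fixes act :: "'g \<Rightarrow> 'x \<Rightarrow> 'x"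
  assumes "finite \<Omega>" and closed: "\<And>g x. g \<in> carrier G \<Longrightarrow> x \<in> \<Omega> \<Longrightarrow> act g x \<in> \<Omega>"
    and hom: "\<And>g h x. g \<in> carrier G \<Longrightarrow> h \<in> carrier G \<Longrightarrow> x \<in> \<Omega> \<Longrightarrow> act (g \<otimes> h) x = act g (act h x)"
    and one: "\<And>x. x \<in> \<Omega> \<Longrightarrow> act \<one> x = x"
  shows "(\<lambda>g. of_nat (card {x \<in> \<Omega>. act g x = x})) \<in> dual"
proof (rule dualI)
  fix x assume "x \<in> M"
  define mat :: "('g \<Rightarrow> 'k) \<Rightarrow> 'x \<Rightarrow> 'x \<Rightarrow> 'k"
    where "mat = (\<lambda>x i j. pairing G (\<lambda>g. if act g j = i then 1 else 0) x)"
  have "(\<Sum>i\<in>\<Omega>. mat x i i) \<in> V"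
  proof (rule trace_mem[where T = T and A = "\<lambda>m. mat (e m)" and \<A> = "mat ` M" and B = "mat x"])
    show "\<exists>c. (\<forall>m\<in>T. c m \<in> V) \<and> (\<forall>i\<in>\<Omega>. \<forall>j\<in>\<Omega>. B i j = (\<Sum>m\<in>T. c m * mat (e m) i j))"
      if B: "B \<in> mat ` M" for B
    proof -
      obtain y where y: "y \<in> M" "B = mat y" using B by auto
      obtain c where c: "\<forall>m\<in>T. c m \<in> V" "\<forall>g\<in>carrier G. y g = (\<Sum>m\<in>T. c m * e m g)"
        using generate[OF y(1)] by blast
      have "B i j = (\<Sum>m\<in>T. c m * mat (e m) i j)" for i j
        unfolding y(2) mat_def using c(2) by (intro pairing_sum) auto
      then show ?thesis using c(1) by blast
    qed
    show "\<exists>E\<in>mat ` M. \<forall>i\<in>\<Omega>. \<forall>j\<in>\<Omega>. E i j = (\<Sum>k\<in>\<Omega>. B i k * C k j)"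
      if BC: "B \<in> mat ` M" "C \<in> mat ` M" for B C
    proof -
      obtain y z where yz: "y \<in> M" "B = mat y" "z \<in> M" "C = mat z" using BC by auto
      have "mat (y \<otimes>\<^bsub>group_algebra G\<^esub> z) i j = (\<Sum>k\<in>\<Omega>. B i k * C k j)" if "i \<in> \<Omega>" "j \<in> \<Omega>" for i j
      proof -
        have "mat (y \<otimes>\<^bsub>group_algebra G\<^esub> z) i j
          = (\<Sum>g\<in>carrier G. \<Sum>h\<in>carrier G. y g * (z h * (if act (g \<otimes> h) j = i then 1 else 0)))"
          unfolding mat_def pairing_mult[OF finite_G] by (simp add: pairing_def sum_distrib_left)
        also have "\<dots> = (\<Sum>g\<in>carrier G. \<Sum>h\<in>carrier G. \<Sum>k\<in>\<Omega>.
            y g * (if act g k = i then 1 else 0) * (z h * (if act h j = k then 1 else 0)))"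
        proof (intro sum.cong HOL.refl)
          fix g h assume gh: "g \<in> carrier G" "h \<in> carrier G"
          have "(\<Sum>k\<in>\<Omega>. y g * (if act g k = i then 1 else 0) * (z h * (if act h j = k then 1 else 0)))
            = (\<Sum>k\<in>\<Omega>. if k = act h j then y g * (if act g k = i then 1 else 0) * z h else 0)"
            by (intro sum.cong) auto
          also have "\<dots> = y g * (if act g (act h j) = i then 1 else 0) * z h"
            using closed[OF gh(2) that(2)] assms(1) by simp
          finally show "y g * (z h * (if act (g \<otimes> h) j = i then 1 else 0)) = (\<Sum>k\<in>\<Omega>.
            y g * (if act g k = i then 1 else 0) * (z h * (if act h j = k then 1 else 0)))"
            using hom[OF gh that(2)] by simp
        qed
        also have "\<dots> = (\<Sum>g\<in>carrier G. \<Sum>k\<in>\<Omega>. \<Sum>h\<in>carrier G.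
            y g * (if act g k = i then 1 else 0) * (z h * (if act h j = k then 1 else 0)))"
          by (rule sum.cong[OF HOL.refl], rule sum.swap)
        also have "\<dots> = (\<Sum>k\<in>\<Omega>. \<Sum>g\<in>carrier G. \<Sum>h\<in>carrier G.
            y g * (if act g k = i then 1 else 0) * (z h * (if act h j = k then 1 else 0)))"
          by (rule sum.swap)
        also have "\<dots> = (\<Sum>k\<in>\<Omega>. B i k * C k j)"
          unfolding yz mat_def pairing_def sum_product ..
        finally show ?thesis .
      qed
      then show ?thesis using mult_M[OF yz(1,3)] by blast
    qed
    show "\<exists>E\<in>mat ` M. \<forall>i\<in>\<Omega>. \<forall>j\<in>\<Omega>. E i j = (if i = j then 1 else 0)"
      by (rule bexI[OF _ imageI[OF one_M]])
        (auto simp: mat_def pairing_group_element[OF finite_G one_closed] one)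
  qed (use \<open>x \<in> M\<close> e_mem finite_T \<open>finite \<Omega>\<close> in auto)
  also have "(\<Sum>i\<in>\<Omega>. mat x i i) = pairing G (\<lambda>g. of_nat (card {i \<in> \<Omega>. act g i = i})) x"
  proof -
    have "(\<Sum>i\<in>\<Omega>. if act g i = i then 1 else 0) = (of_nat (card {i \<in> \<Omega>. act g i = i}) :: 'k)" for g
      using \<open>finite \<Omega>\<close> by (simp add: sum.If_cases Int_def)
    then show ?thesis
      unfolding mat_def pairing_def by (subst sum.swap) (simp add: sum_distrib_left[symmetric])
  qed
  finally show "pairing G (\<lambda>g. of_nat (card {i \<in> \<Omega>. act g i = i})) x \<in> V" .
qed

end

section \<open>Integrality forces \<open>p\<close> to be invertible\<close>

text \<open>Bezout replaces m by gcd(m, p^n) = p^i, where i < n because m < p^n; multiplying p^i /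
  p^n by p^(n-i-1) leaves 1/p.\<close>

lemma (in field_subring) inverse_prime_mem:
  assumes "of_nat m / of_nat p ^ n \<in> V" and "0 < m" "m < p ^ n" and "prime p"
    and p: "of_nat p \<noteq> (0 :: 'k)"
  shows "1 / of_nat p \<in> V"
proof -
  obtain i where i: "i \<le> n" "gcd m (p ^ n) = p ^ i"
    using divides_primepow_nat[OF \<open>prime p\<close>, of "gcd m (p ^ n)" n] by auto
  have "p ^ i \<le> m" using i(2) \<open>0 < m\<close> by (metis dvd_imp_le gcd_dvd1)
  then have "i \<noteq> n" using \<open>m < p ^ n\<close> by auto
  then have n: "n = i + (n - i - 1) + 1" using i(1) by simp
  obtain x y where xy: "x * int m + y * int (p ^ n) = int (p ^ i)"
    using bezout_int[of "int m" "int (p ^ n)"] i(2) by (metis gcd_int_int_eq)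
  have "of_int x * of_nat m + of_int y * of_nat p ^ n = (of_nat p ^ i :: 'k)"
    using arg_cong[OF xy, of "of_int :: int \<Rightarrow> 'k"] by simp
  then have "of_nat p ^ i / of_nat p ^ n = of_int x * (of_nat m / of_nat p ^ n) + (of_int y :: 'k)"
    using p by (simp add: field_simps)
  moreover have "of_int x * (of_nat m / of_nat p ^ n) + of_int y \<in> V"
    by (intro add_mem mult_mem of_int_mem assms(1))
  ultimately have "of_nat p ^ i / of_nat p ^ n \<in> V" by simp
  then have "of_nat p ^ (n - i - 1) * (of_nat p ^ i / of_nat p ^ n) \<in> V"
    by (intro mult_mem power_mem of_nat_mem)
  also have "of_nat p ^ (n - i - 1) * (of_nat p ^ i / of_nat p ^ n) = (1 / of_nat p :: 'k)"
    using p by (subst n) (simp add: power_add)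
  finally show ?thesis .
qed

section \<open>Fixed points of affine maps modulo q\<close>

lemma card_affine_fixed_points:
  fixes q R L :: nat
  assumes "prime q" and R: "\<not> [R = 1] (mod q)"
  shows "card {x \<in> {..<q}. (R * x + L) mod q = x} = 1"
proof -
  have q: "0 < q" using assms(1) by (rule prime_gt_0_nat)
  \<comment> \<open>\<open>N\<close> is R - 1 modulo q, written so that R = 0 causes no truncation.
    It is prime to q, so N x + L = 0 has exactly one solution modulo q.\<close>
  define N where "N = R + (q - 1)"
  have "coprime N q"
  proof -
    have "\<not> q dvd N"
    proof
      assume "q dvd N"
      then have "[R + (q - 1) + 1 = 0 + 1] (mod q)"
        unfolding N_def cong_add_rcancel_nat by (simp add: cong_0_iff)
      then show False using R q by (simp add: cong_def)
    qed
    then show ?thesis using prime_imp_coprime[OF assms(1)] by (simp add: coprime_commute)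
  qed
  define f where "f = (\<lambda>x. (N * x + L) mod q)"
  have "inj_on f {..<q}"
  proof (rule inj_onI)
    fix x y assume xy: "x \<in> {..<q}" "y \<in> {..<q}" "f x = f y"
    then have "[N * x = N * y] (mod q)"
      using cong_add_rcancel_nat[of "N * x" L "N * y" q] by (simp add: f_def cong_def)
    then have "[x = y] (mod q)" using \<open>coprime N q\<close> by (simp add: cong_mult_lcancel_nat)
    then show "x = y" using xy by (simp add: cong_def)
  qed
  moreover have "f ` {..<q} \<subseteq> {..<q}" using q by (auto simp: f_def)
  ultimately have bij: "bij_betw f {..<q} {..<q}"
    by (metis bij_betw_def endo_inj_surj finite_lessThan)
  have "(R * x + L) mod q = x \<longleftrightarrow> f x = 0" if "x < q" for x
  proof -
    have "f x = 0 \<longleftrightarrow> [N * x + L + x = 0 + x] (mod q)"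
      unfolding cong_add_rcancel_nat by (simp add: f_def cong_def)
    also have "N * x + L + x = R * x + L + q * x"
      using q by (cases q) (simp_all add: N_def algebra_simps)
    also have "[R * x + L + q * x = 0 + x] (mod q) \<longleftrightarrow> (R * x + L) mod q = x"
      using that by (simp add: cong_def)
    finally show ?thesis by simp
  qed
  then have "{x \<in> {..<q}. (R * x + L) mod q = x} = {x \<in> {..<q}. f x = 0}" by auto
  moreover have "\<exists>!x. x \<in> {..<q} \<and> f x = 0"
    using bij q by (simp add: bij_betw_iff_bijections) (metis lessThan_iff)
  ultimately show ?thesis by (auto simp: card_1_singleton_iff)
qed

lemma card_translation_fixed_points:
  fixes q R L :: nat
  assumes "[R = 1] (mod q)" and "\<not> q dvd L"
  shows "card {x \<in> {..<q}. (R * x + L) mod q = x} = 0"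
proof -
  have "(R * x + L) mod q \<noteq> x" if "x < q" for x
  proof
    assume "(R * x + L) mod q = x"
    then have "[R * x + L = x] (mod q)" using that by (simp add: cong_def)
    moreover have "[R * x + L = 1 * x + L] (mod q)"
      using assms(1) by (intro cong_add cong_mult) auto
    ultimately have "[x + L = x + 0] (mod q)"
      by (metis add.right_neutral cong_sym cong_trans mult_1)
    then have "[L = 0] (mod q)" unfolding cong_add_lcancel_nat .
    then show False using assms(2) by (simp add: cong_0_iff)
  qed
  then show ?thesis by auto
qed

text \<open>With y = x + l modulo q the condition reads f(y) = x, so each y contributes exactly one
  pair. For f the action of g this says that the character counting fixed points, minus 1, sums to 0
  over the products of g with the powers of the translation.\<close>

lemma sum_card_shifted_fixed_points:
  fixes f :: "nat \<Rightarrow> nat"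
  assumes "\<And>y. y < q \<Longrightarrow> f y < q"
  shows "(\<Sum>l<q. of_nat (card {x \<in> {..<q}. f ((x + l) mod q) = x})) = (of_nat q :: 'k::comm_ring_1)"
proof -
  have "(\<Sum>l<q. of_nat (card {x \<in> {..<q}. f ((x + l) mod q) = x}))
     = (\<Sum>l<q. \<Sum>x<q. if f ((x + l) mod q) = x then 1 else 0 :: 'k)"
    by (simp add: sum.If_cases Int_def)
  also have "\<dots> = (\<Sum>x<q. \<Sum>l<q. if f ((l + x) mod q) = x then 1 else 0)"
    by (subst sum.swap) (simp add: add.commute)
  also have "\<dots> = (\<Sum>x<q. \<Sum>l<q. if f (l mod q) = x then 1 else 0)"
    by (intro sum.cong HOL.refl sum_shift_periodic[of "\<lambda>l. if f (l mod q) = _ then 1 else 0"]) simp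
  also have "\<dots> = (\<Sum>l<q. \<Sum>x<q. if x = f l then 1 else 0)"
    by (subst sum.swap) (intro sum.cong HOL.refl, auto)
  also have "\<dots> = of_nat q" using assms by simp
  finally show ?thesis .
qed

lemma (in half_twist_prime) sum_r_pow_reindex:
  fixes f :: "nat \<Rightarrow> 'k"
  shows "(\<Sum>l\<in>{0<..<q}. f ((r ^ v * l) mod q)) = (\<Sum>l\<in>{0<..<q}. f l)"
proof (rule sum.reindex_bij_betw)
  let ?h = "\<lambda>l. (r ^ v * l) mod q"
  have "inj_on ?h {0<..<q}"
  proof (rule inj_onI)
    fix x y assume xy: "x \<in> {0<..<q}" "y \<in> {0<..<q}" "?h x = ?h y"
    have "coprime (r ^ v) q" using q_r by (simp add: coprime_commute)
    then have "[x = y] (mod q)"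
      using xy(3) cong_mult_lcancel_nat[of "r ^ v" q x y] by (simp add: cong_def)
    then show "x = y" using xy by (simp add: cong_def)
  qed
  moreover have "?h ` {0<..<q} \<subseteq> {0<..<q}"
    using not_dvd_r_pow_mult[of _ v] prime_gt_0_nat[OF q_prime]
    by (auto simp: dvd_eq_mod_eq_0 intro!: gr0I)
  ultimately show "bij_betw ?h {0<..<q} {0<..<q}"
    by (metis bij_betw_def endo_inj_surj finite_greaterThanLessThan)
qed

text \<open>One factor \<open>\<int>\<^sub>q \<rtimes> \<int>\<^sub>p = \<langle>a, s\<rangle>\<close> of the group acts on \<open>\<int>\<^sub>q\<close> by affine maps; the other factor, generated
  by \<open>K\<close>, acts trivially.\<close>

locale affine_action = group G for G (structure) +
  fixes act :: "'a \<Rightarrow> nat \<Rightarrow> nat" and q r :: nat and s a :: 'a and K :: "'a set"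
  assumes act_less: "g \<in> carrier G \<Longrightarrow> x < q \<Longrightarrow> act g x < q"
    and act_mult: "g \<in> carrier G \<Longrightarrow> h \<in> carrier G \<Longrightarrow> x < q \<Longrightarrow> act (g \<otimes> h) x = act g (act h x)"
    and act_one: "x < q \<Longrightarrow> act \<one> x = x"
    and s_carrier: "s \<in> carrier G" and a_carrier: "a \<in> carrier G"
    and act_s: "x < q \<Longrightarrow> act s x = (r * x) mod q"
    and act_a: "x < q \<Longrightarrow> act a x = (x + 1) mod q"
    and K_carrier: "K \<subseteq> carrier G" and act_K: "k \<in> K \<Longrightarrow> x < q \<Longrightarrow> act k x = x"
begin

lemma act_s_pow: "x < q \<Longrightarrow> act (s [^] (n::nat)) x = (r ^ n * x) mod q"
proof (induction n arbitrary: x)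
  case (Suc n)
  then have "(r * x) mod q < q" by simp
  then show ?case using Suc s_carrier
    by (simp add: act_mult act_s mod_mult_right_eq mult.assoc mult.left_commute)
qed (simp add: act_one)

lemma act_a_pow: "x < q \<Longrightarrow> act (a [^] (n::nat)) x = (x + n) mod q"
proof (induction n arbitrary: x)
  case (Suc n)
  then have "(x + 1) mod q < q" by simp
  then show ?case using Suc a_carrier
    by (simp add: act_mult act_a mod_add_left_eq)
qed (simp add: act_one)

lemma act_K_pow: "k \<in> K \<Longrightarrow> x < q \<Longrightarrow> act (k [^] (n::nat)) x = x"
proof (induction n)
  case (Suc n)
  then show ?case using K_carrier act_K by (auto simp: act_mult)
qed (simp add: act_one)

end

section \<open>Bidual elements and the character of the two affine actions\<close>

locale galindo_natale_order = twisted_order V G M T e p \<zeta> \<sigma> \<tau>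
  for V :: "'k::field set" and G :: "('g, 'm) monoid_scheme" (structure)
    and M :: "('g \<Rightarrow> 'k) set" and T :: "'t set" and e :: "'t \<Rightarrow> 'g \<Rightarrow> 'k"
    and p :: nat and \<zeta> :: 'k and \<sigma> \<tau> :: 'g +
  fixes a b :: 'g and q r :: nat and act1 act2 :: "'g \<Rightarrow> nat \<Rightarrow> nat"
  assumes half1: "half_twist_prime G \<sigma> \<tau> a p q r \<zeta>"
    and half2: "half_twist_prime G \<tau> \<sigma> b p q r \<zeta>"
    and action1: "affine_action G act1 q r \<sigma> a {\<tau>, b}"
    and action2: "affine_action G act2 q r \<tau> b {\<sigma>, a}"
    and p_prime: "prime p"
begin

sublocale A: half_twist_prime G \<sigma> \<tau> a p q r \<zeta> by (rule half1)
sublocale B: half_twist_prime G \<tau> \<sigma> b p q r \<zeta> by (rule half2)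
sublocale A1: affine_action G act1 q r \<sigma> a "{\<tau>, b}" by (rule action1)
sublocale A2: affine_action G act2 q r \<tau> b "{\<sigma>, a}" by (rule action2)

lemma q_pos: "0 < q"
  using A.q_prime by (rule prime_gt_0_nat)

definition z_a :: "'g \<Rightarrow> 'k" where
  "z_a = (\<lambda>x. \<Sum>(u, l)\<in>{..<p} \<times> {0<..<q}. 1 / of_nat p * group_element (\<tau> [^] u \<otimes> a [^] l) x)"

definition z_b :: "'g \<Rightarrow> 'k" where
  "z_b = (\<lambda>x. \<Sum>(u, l)\<in>{..<p} \<times> {0<..<q}. 1 / of_nat p * group_element (\<sigma> [^] u \<otimes> b [^] l) x)"

definition w :: "'g \<Rightarrow> 'k" where
  "w = (\<lambda>x. \<Sum>(l, j)\<in>{0<..<q} \<times> {0<..<q}. 1 / of_nat p ^ 2 * group_element (a [^] l \<otimes> b [^] j) x)"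

lemma pairing_sum_group_elements:
  assumes "\<And>i j. g i j \<in> carrier G"
  shows "pairing G f (\<lambda>x. \<Sum>(i, j)\<in>I \<times> J. c * group_element (g i j) x)
    = c * (\<Sum>i\<in>I. \<Sum>j\<in>J. f (g i j))"
proof -
  have "pairing G f (\<lambda>x. \<Sum>(i, j)\<in>I \<times> J. c * group_element (g i j) x)
    = (\<Sum>z\<in>I \<times> J. c * pairing G f (group_element (g (fst z) (snd z))))"
    by (intro pairing_sum) (simp add: case_prod_unfold)
  also have "\<dots> = (\<Sum>z\<in>I \<times> J. c * f (g (fst z) (snd z)))"
    by (simp add: pairing_group_element[OF finite_G assms])
  finally show ?thesis
    by (simp add: sum_distrib_left[symmetric] sum.cartesian_product case_prod_unfold)
qed

lemma pairing_z_a: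
  "pairing G f z_a = 1 / of_nat p * (\<Sum>u<p. \<Sum>l\<in>{0<..<q}. f (\<tau> [^] u \<otimes> a [^] l))"
  unfolding z_a_def by (rule pairing_sum_group_elements) simp

lemma pairing_z_b:
  "pairing G f z_b = 1 / of_nat p * (\<Sum>u<p. \<Sum>l\<in>{0<..<q}. f (\<sigma> [^] u \<otimes> b [^] l))"
  unfolding z_b_def by (rule pairing_sum_group_elements) simp

lemma pairing_w:
  "pairing G f w = 1 / of_nat p ^ 2 * (\<Sum>l\<in>{0<..<q}. \<Sum>j\<in>{0<..<q}. f (a [^] l \<otimes> b [^] j))"
  unfolding w_def by (rule pairing_sum_group_elements) simp

lemma z_a_bidual: "z_a \<in> bidual"
proof -
  obtain N :: nat and \<phi> where \<phi>: "\<forall>m\<in>{..<N}. \<phi> m \<in> dual"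
    "\<forall>f\<in>dual. \<exists>c. (\<forall>m\<in>{..<N}. c m \<in> V) \<and> (\<forall>g\<in>carrier G. f g = (\<Sum>m<N. c m * \<phi> m g))"
    using dual_finitely_generated unfolding Ball_def lessThan_iff by blast
  have "1 / of_nat p * (\<Sum>u<p. \<Sum>l\<in>{0<..<q}. f (\<tau> [^] u \<otimes> a [^] l)) \<in> V" if "f \<in> dual" for f
    using \<phi> that valuation_ring_axioms
    by (intro A.trace_functional_mem[where T = "{..<N}" and \<phi> = \<phi> and D = dual]
        dual_one dual_twist_dual) auto
  then show ?thesis by (simp add: bidual_def pairing_z_a)
qed

lemma z_b_bidual: "z_b \<in> bidual"
proof -
  obtain N :: nat and \<phi> where \<phi>: "\<forall>m\<in>{..<N}. \<phi> m \<in> dual"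
    "\<forall>f\<in>dual. \<exists>c. (\<forall>m\<in>{..<N}. c m \<in> V) \<and> (\<forall>g\<in>carrier G. f g = (\<Sum>m<N. c m * \<phi> m g))"
    using dual_finitely_generated unfolding Ball_def lessThan_iff by blast
  \<comment> \<open>Exchanging sigma and tau flips the coproduct and hence reverses the factors in
    the product of D, under which D is still closed.\<close>
  have conv: "twist_dual G p \<zeta> \<tau> \<sigma> (\<lambda>(x, y). f x * g y) \<in> dual" if "f \<in> dual" "g \<in> dual" for f g
  proof -
    have "twist_dual G p \<zeta> \<tau> \<sigma> (\<lambda>(x, y). f x * g y) = twist_dual G p \<zeta> \<sigma> \<tau> (\<lambda>(x, y). g x * f y)"
      by (rule ext) (simp add: twist_dual_swap[of G p \<zeta> \<tau>] mult.commute)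
    then show ?thesis using dual_twist_dual[OF that(2,1)] by simp
  qed
  have "1 / of_nat p * (\<Sum>u<p. \<Sum>l\<in>{0<..<q}. f (\<sigma> [^] u \<otimes> b [^] l)) \<in> V" if "f \<in> dual" for f
    using \<phi> that valuation_ring_axioms
    by (intro B.trace_functional_mem[where T = "{..<N}" and \<phi> = \<phi> and D = dual] dual_one conv) auto
  then show ?thesis by (simp add: bidual_def pairing_z_b)
qed

definition fix1 :: "'g \<Rightarrow> nat" where "fix1 g = card {x \<in> {..<q}. act1 g x = x}"
definition fix2 :: "'g \<Rightarrow> nat" where "fix2 g = card {x \<in> {..<q}. act2 g x = x}"

definition \<chi> :: "'g \<Rightarrow> 'k" where
  "\<chi> g = (of_nat (fix1 g) - 1) * (of_nat (fix2 g) - 1)"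

text \<open>The product of D is dual to the twisted coproduct, so it does not provide the pointwise
  product of \<open>fix1\<close> and \<open>fix2\<close>. That product is instead the permutation
  character of the action on pairs of residues.\<close>

lemma \<chi>_dual: "\<chi> \<in> dual"
proof -
  have f1: "(\<lambda>g. of_nat (fix1 g)) \<in> dual"
    unfolding fix1_def by (rule permutation_character_dual)
      (auto simp: A1.act_less A1.act_mult A1.act_one)
  have f2: "(\<lambda>g. of_nat (fix2 g)) \<in> dual"
    unfolding fix2_def by (rule permutation_character_dual)
      (auto simp: A2.act_less A2.act_mult A2.act_one)
  have "(\<lambda>g. of_nat (card {x \<in> {..<q} \<times> {..<q}. map_prod (act1 g) (act2 g) x = x})) \<in> dual"
    by (rule permutation_character_dual)
      (auto simp: A1.act_less A1.act_mult A1.act_one A2.act_less A2.act_mult A2.act_one)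
  moreover have "{x \<in> {..<q} \<times> {..<q}. map_prod (act1 g) (act2 g) x = x}
     = {x \<in> {..<q}. act1 g x = x} \<times> {x \<in> {..<q}. act2 g x = x}" for g by auto
  ultimately have f12: "(\<lambda>g. of_nat (fix1 g) * of_nat (fix2 g)) \<in> dual"
    by (simp add: fix1_def fix2_def card_cartesian_product)
  have "(\<lambda>g. of_nat (fix1 g) * of_nat (fix2 g) - of_nat (fix1 g) - (of_nat (fix2 g) - 1)) \<in> dual"
    by (intro dual_diff f12 f1 f2 dual_one)
  then show ?thesis by (simp add: \<chi>_def[abs_def] algebra_simps)
qed

text \<open>The first action has multiplier r^d and translation l, the second has multiplier r^c and
  translation r^c j. A multiplier other than 1 gives exactly one fixed point and makes its factor 0;
  two nontrivial translations have no fixed points, and the value is (-1)(-1) = 1.\<close>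

lemma \<chi>_value:
  assumes "0 < l" "l < q" "\<not> q dvd j"
  shows "\<chi> ((\<tau> [^] c \<otimes> a [^] l) \<otimes> (\<sigma> [^] d \<otimes> b [^] j)) = (if p dvd c \<and> p dvd d then 1 else 0)"
    (is "\<chi> ?g = _")
proof -
  have "act1 ?g x = (r ^ d * x + l) mod q" if "x < q" for x
    using that q_pos by (simp add: A1.act_mult A1.act_less A1.act_K_pow A1.act_a_pow A1.act_s_pow mod_add_left_eq)
  then have "fix1 ?g = card {x \<in> {..<q}. (r ^ d * x + l) mod q = x}"
    unfolding fix1_def by (intro arg_cong[of _ _ card]) auto
  moreover have "\<not> q dvd l" using assms by (auto dest: dvd_imp_le)
  ultimately have f1: "fix1 ?g = (if p dvd d then 0 else 1)"
    using card_affine_fixed_points[OF A.q_prime, of "r ^ d" l]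
      card_translation_fixed_points[of "r ^ d" q l] by (simp add: A.r_pow_cong_1_iff del: One_nat_def)
  have "act2 ?g x = (r ^ c * x + r ^ c * j) mod q" if "x < q" for x
    using that q_pos by (simp add: A2.act_mult A2.act_less A2.act_K_pow A2.act_a_pow A2.act_s_pow
        mod_mult_right_eq add_mult_distrib2)
  then have "fix2 ?g = card {x \<in> {..<q}. (r ^ c * x + r ^ c * j) mod q = x}"
    unfolding fix2_def by (intro arg_cong[of _ _ card]) auto
  moreover have "\<not> q dvd r ^ c * j"
    using A.q_r assms(3) by (simp add: coprime_dvd_mult_right_iff)
  ultimately have f2: "fix2 ?g = (if p dvd c then 0 else 1)"
    using card_affine_fixed_points[OF A.q_prime, of "r ^ c" "r ^ c * j"]
      card_translation_fixed_points[of "r ^ c" q "r ^ c * j"] by (simp add: A.r_pow_cong_1_iff del: One_nat_def)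
  show ?thesis unfolding \<chi>_def f1 f2 by auto
qed

lemma w_bidual: "w \<in> bidual"
proof -
  let ?td = "twist_dual G p \<zeta> \<sigma> \<tau>"
  have p0: "of_nat p \<noteq> (0 :: 'k)" by (rule A.char)
  have orth: "(\<Sum>v<p. inverse (\<zeta> ^ (u * v))) = (if u = 0 then of_nat p else 0)" if "u < p" for u
    using sum_inverse_powers_root_of_unity[OF A.root A.p_pos, of u] that
    by (auto simp: mult.commute dest: dvd_imp_le)
  have td_b: "?td F (\<sigma> [^] n \<otimes> b [^] j) = 1 / of_nat p * (\<Sum>u<p. \<Sum>v<p. inverse (\<zeta> ^ (u * v)) *
     F (\<sigma> [^] n \<otimes> b [^] (r ^ v * j), \<sigma> [^] (u + n) \<otimes> b [^] j))" for F :: "'g \<times> 'g \<Rightarrow> 'k" and n j :: nat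
    unfolding twist_dual_swap[of G p \<zeta> \<sigma> \<tau>] B.twist_dual_t_a by simp
  \<comment> \<open>The coproduct of \<open>z_b\<close>: \<open>\<chi>\<close> vanishes unless the
    power of sigma in \<open>z_b\<close> is trivial and p divides c, and its value does not depend
    on v. The sum over v then leaves only u = 0.\<close>
  have inner: "pairing G (?td (\<lambda>(h1, h2). \<chi> ((\<tau> [^] c \<otimes> a [^] l) \<otimes> h1) * f (y \<otimes> h2))) z_b
     = (if p dvd c then 1 / of_nat p * (\<Sum>j\<in>{0<..<q}. f (y \<otimes> b [^] j)) else 0)"
    if l: "l \<in> {0<..<q}" for c l :: nat and y and f :: "'g \<Rightarrow> 'k"
  proof -
    have "?td (\<lambda>(h1, h2). \<chi> ((\<tau> [^] c \<otimes> a [^] l) \<otimes> h1) * f (y \<otimes> h2)) (\<sigma> [^] n \<otimes> b [^] j)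
       = (if n = 0 then if p dvd c then f (y \<otimes> b [^] j) else 0 else 0)"
      if n: "n < p" and j: "j \<in> {0<..<q}" for n j
    proof -
      have val: "\<chi> ((\<tau> [^] c \<otimes> a [^] l) \<otimes> (\<sigma> [^] n \<otimes> b [^] (r ^ v * j))) = (if p dvd c \<and> n = 0 then 1 else 0)" for v
        using l j n A.not_dvd_r_pow_mult[of j v] by (subst \<chi>_value) (auto dest: dvd_imp_le)
      have "?td (\<lambda>(h1, h2). \<chi> ((\<tau> [^] c \<otimes> a [^] l) \<otimes> h1) * f (y \<otimes> h2)) (\<sigma> [^] n \<otimes> b [^] j)
        = 1 / of_nat p * (\<Sum>u<p. (\<Sum>v<p. inverse (\<zeta> ^ (u * v))) *
            ((if p dvd c \<and> n = 0 then 1 else 0) * f (y \<otimes> (\<sigma> [^] (u + n) \<otimes> b [^] j))))"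
        unfolding td_b by (simp add: val sum_distrib_right mult.assoc)
      also have "\<dots> = 1 / of_nat p * (\<Sum>u<p. if u = 0 then of_nat p *
            ((if p dvd c \<and> n = 0 then 1 else 0) * f (y \<otimes> (\<sigma> [^] (u + n) \<otimes> b [^] j))) else 0)"
        by (intro arg_cong2[of _ _ _ _ "(*)"] sum.cong HOL.refl) (simp add: orth)
      also have "\<dots> = (if p dvd c \<and> n = 0 then 1 else 0) * f (y \<otimes> (\<sigma> [^] n \<otimes> b [^] j))"
        using A.p_pos p0 by (simp add: sum.delta)
      finally show ?thesis by simp
    qed
    then have "pairing G (?td (\<lambda>(h1, h2). \<chi> ((\<tau> [^] c \<otimes> a [^] l) \<otimes> h1) * f (y \<otimes> h2))) z_b
      = 1 / of_nat p * (\<Sum>n<p. if n = 0 then \<Sum>j\<in>{0<..<q}. if p dvd c then f (y \<otimes> b [^] j) else 0 else 0)"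
      unfolding pairing_z_b by (intro arg_cong2[of _ _ _ _ "(*)"] sum.cong HOL.refl) auto
    then show ?thesis using A.p_pos by (simp add: sum.delta)
  qed
  have "pairing G f w \<in> V" if f: "f \<in> dual" for f
  proof -
    define S where "S n = (\<Sum>l\<in>{0<..<q}. \<Sum>j\<in>{0<..<q}. f (\<tau> [^] n \<otimes> a [^] l \<otimes> b [^] j))" for n :: nat
    let ?F = "\<lambda>(g1, g2). pairing G (?td (\<lambda>(h1, h2). \<chi> (g1 \<otimes> h1) * f (g2 \<otimes> h2))) z_b"
    have "pairing G (?td ?F) z_a
      = 1 / of_nat p * (\<Sum>n<p. \<Sum>l\<in>{0<..<q}. 1 / of_nat p * (\<Sum>u<p. \<Sum>v<p. inverse (\<zeta> ^ (u * v)) *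
          (if p dvd u + n then 1 / of_nat p * (\<Sum>j\<in>{0<..<q}. f (\<tau> [^] n \<otimes> a [^] (r ^ v * l) \<otimes> b [^] j)) else 0)))"
      unfolding pairing_z_a A.twist_dual_t_a
      by (intro arg_cong2[of _ _ _ _ "(*)"] sum.cong HOL.refl) (simp add: inner)
    \<comment> \<open>After summation over l the terms f(...) no longer depend on v, because
      multiplication by r^v permutes the nonzero residues. The sum over v thus forces u = 0, and
      then p dividing u + n forces n = 0.\<close>
    also have "\<dots> = 1 / of_nat p * (\<Sum>n<p. 1 / of_nat p * (\<Sum>u<p. \<Sum>v<p. inverse (\<zeta> ^ (u * v)) *
          (if p dvd u + n then 1 / of_nat p * S n else 0)))"
    proof (intro arg_cong2[of _ _ _ _ "(*)"] sum.cong HOL.refl)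
      fix n
      have S: "(\<Sum>l\<in>{0<..<q}. \<Sum>j\<in>{0<..<q}. f (\<tau> [^] n \<otimes> a [^] (r ^ v * l) \<otimes> b [^] j)) = S n" for v
      proof -
        have "a [^] (r ^ v * l) = a [^] (r ^ v * l mod q)" for l
          by (rule A.a_pow_cong) (simp add: cong_def)
        then show ?thesis
          using A.sum_r_pow_reindex[of "\<lambda>l. \<Sum>j\<in>{0<..<q}. f (\<tau> [^] n \<otimes> a [^] l \<otimes> b [^] j)" v]
          by (simp add: S_def)
      qed
      have "(\<Sum>l\<in>{0<..<q}. \<Sum>u<p. \<Sum>v<p. inverse (\<zeta> ^ (u * v)) *
          (if p dvd u + n then 1 / of_nat p * (\<Sum>j\<in>{0<..<q}. f (\<tau> [^] n \<otimes> a [^] (r ^ v * l) \<otimes> b [^] j)) else 0))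
        = (\<Sum>u<p. \<Sum>v<p. \<Sum>l\<in>{0<..<q}. inverse (\<zeta> ^ (u * v)) *
          (if p dvd u + n then 1 / of_nat p * (\<Sum>j\<in>{0<..<q}. f (\<tau> [^] n \<otimes> a [^] (r ^ v * l) \<otimes> b [^] j)) else 0))"
        by (subst sum.swap) (rule sum.cong[OF HOL.refl], rule sum.swap)
      also have "\<dots> = (\<Sum>u<p. \<Sum>v<p. inverse (\<zeta> ^ (u * v)) * (if p dvd u + n then 1 / of_nat p * S n else 0))"
      proof (intro sum.cong HOL.refl)
        show "(\<Sum>l\<in>{0<..<q}. inverse (\<zeta> ^ (u * v)) *
            (if p dvd u + n then 1 / of_nat p * (\<Sum>j\<in>{0<..<q}. f (\<tau> [^] n \<otimes> a [^] (r ^ v * l) \<otimes> b [^] j)) else 0))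
          = inverse (\<zeta> ^ (u * v)) * (if p dvd u + n then 1 / of_nat p * S n else 0)" for u v
          by (simp add: S[of v, symmetric] sum_distrib_left)
      qed
      finally show "(\<Sum>l\<in>{0<..<q}. 1 / of_nat p * (\<Sum>u<p. \<Sum>v<p. inverse (\<zeta> ^ (u * v)) *
          (if p dvd u + n then 1 / of_nat p * (\<Sum>j\<in>{0<..<q}. f (\<tau> [^] n \<otimes> a [^] (r ^ v * l) \<otimes> b [^] j)) else 0)))
        = 1 / of_nat p * (\<Sum>u<p. \<Sum>v<p. inverse (\<zeta> ^ (u * v)) * (if p dvd u + n then 1 / of_nat p * S n else 0))"
        by (simp only: sum_distrib_left[symmetric])
    qed
    also have "\<dots> = 1 / of_nat p * (\<Sum>n<p. 1 / of_nat p * (\<Sum>u<p. if u = 0 then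
          (if p dvd u + n then S n else 0) else 0))"
    proof (intro arg_cong2[of _ _ _ _ "(*)"] sum.cong HOL.refl)
      fix n u assume u: "u \<in> {..<p}"
      have "(\<Sum>v<p. inverse (\<zeta> ^ (u * v)) * (if p dvd u + n then 1 / of_nat p * S n else 0))
        = (\<Sum>v<p. inverse (\<zeta> ^ (u * v))) * (if p dvd u + n then 1 / of_nat p * S n else 0)"
        by (simp add: sum_distrib_right)
      then show "(\<Sum>v<p. inverse (\<zeta> ^ (u * v)) * (if p dvd u + n then 1 / of_nat p * S n else 0))
        = (if u = 0 then (if p dvd u + n then S n else 0) else 0)"
        using u orth p0 by simp
    qed
    also have "\<dots> = 1 / of_nat p * (\<Sum>n<p. if n = 0 then 1 / of_nat p * S n else 0)"
      using A.p_pos by (intro arg_cong2[of _ _ _ _ "(*)"] sum.cong HOL.refl) (auto simp: sum.delta dest: dvd_imp_le)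
    also have "\<dots> = pairing G f w"
      using A.p_pos by (simp add: sum.delta S_def pairing_w power2_eq_square)
    finally show ?thesis using contraction_mem[OF \<chi>_dual f z_a_bidual z_b_bidual] by simp
  qed
  then show ?thesis by (simp add: bidual_def)
qed

text \<open>Over all powers of a, including the zeroth, the values of \<open>fix1\<close> - 1 at g
  a^l sum to 0, so the nontrivial powers contribute minus the value at g. The same holds for b, and
  the two signs cancel.\<close>

lemma \<chi>_w:
  assumes g: "g \<in> carrier G"
  shows "pairing G (\<lambda>h. \<chi> (g \<otimes> h)) w = \<chi> g / of_nat p ^ 2"
proof -
  define k1 where "k1 = (\<lambda>l. of_nat (card {x \<in> {..<q}. act1 g ((x + l) mod q) = x}) - 1 :: 'k)"
  define k2 where "k2 = (\<lambda>l. of_nat (card {x \<in> {..<q}. act2 g ((x + l) mod q) = x}) - 1 :: 'k)"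
  have q: "{..<q} = insert 0 {0<..<q}" using q_pos by auto
  \<comment> \<open>Since a is trivial in the second action and b in the first, the value splits
    into a factor depending on l and one depending on j.\<close>
  have "\<chi> (g \<otimes> (a [^] l \<otimes> b [^] j)) = k1 l * k2 j" for l j :: nat
  proof -
    have "act1 (g \<otimes> (a [^] l \<otimes> b [^] j)) x = act1 g ((x + l) mod q)" if "x < q" for x
      using that g by (simp add: A1.act_mult A1.act_K_pow A1.act_a_pow)
    moreover have "act2 (g \<otimes> (a [^] l \<otimes> b [^] j)) x = act2 g ((x + j) mod q)" if "x < q" for x
      using that g q_pos by (simp add: A2.act_mult A2.act_K_pow A2.act_a_pow)
    ultimately show ?thesis
      unfolding \<chi>_def fix1_def fix2_def k1_def k2_def
      by (intro arg_cong2[of _ _ _ _ "(*)"] arg_cong2[of _ _ _ _ "(-)"] arg_cong[of _ _ of_nat]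
          arg_cong[of _ _ card] HOL.refl) auto
  qed
  then have "pairing G (\<lambda>h. \<chi> (g \<otimes> h)) w = 1 / of_nat p ^ 2 * ((\<Sum>l\<in>{0<..<q}. k1 l) * (\<Sum>j\<in>{0<..<q}. k2 j))"
    unfolding pairing_w by (simp add: sum_product)
  also have "(\<Sum>l\<in>{0<..<q}. k1 l) = - k1 0"
  proof -
    have "(\<Sum>l<q. k1 l) = 0"
      using sum_card_shifted_fixed_points[of q "act1 g", where 'k = 'k] A1.act_less[OF g]
      by (simp add: k1_def sum_subtractf)
    then show ?thesis unfolding q by (simp add: eq_neg_iff_add_eq_0 add.commute)
  qed
  also have "(\<Sum>l\<in>{0<..<q}. k2 l) = - k2 0"
  proof -
    have "(\<Sum>l<q. k2 l) = 0"
      using sum_card_shifted_fixed_points[of q "act2 g", where 'k = 'k] A2.act_less[OF g]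
      by (simp add: k2_def sum_subtractf)
    then show ?thesis unfolding q by (simp add: eq_neg_iff_add_eq_0 add.commute)
  qed
  also have "k1 0 = of_nat (fix1 g) - 1"
    unfolding k1_def fix1_def by (intro arg_cong2[of _ _ _ _ "(-)"] arg_cong[of _ _ of_nat] arg_cong[of _ _ card]) auto
  also have "k2 0 = of_nat (fix2 g) - 1"
    unfolding k2_def fix2_def by (intro arg_cong2[of _ _ _ _ "(-)"] arg_cong[of _ _ of_nat] arg_cong[of _ _ card]) auto
  finally show ?thesis unfolding minus_mult_minus by (simp add: \<chi>_def)
qed

text \<open>Right translation by \<open>w\<close> preserves D, and on multiples of
  \<open>\<chi>\<close> it is division by p^2.\<close>

lemma \<chi>_divided_dual: "(\<lambda>g. \<chi> g / of_nat p ^ (2 * n)) \<in> dual"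
proof (induction n)
  case (Suc n)
  have "pairing G (\<lambda>h. \<chi> (g \<otimes> h) / of_nat p ^ (2 * n)) w = \<chi> g / of_nat p ^ (2 * Suc n)"
    if "g \<in> carrier G" for g
    using pairing_scale_right[of G "\<lambda>h. \<chi> (g \<otimes> h)" "1 / of_nat p ^ (2 * n)" w] \<chi>_w[OF that]
    by (simp add: power_add power2_eq_square mult_ac)
  then show ?case
    using dual_contract_right[OF Suc w_bidual] dual_cong by (metis (no_types, lifting))
qed (use \<chi>_dual in simp)

lemma inverse_p_mem: "1 / of_nat p \<in> V"
proof -
  have "fix1 \<one> = q" "fix2 \<one> = q"
  proof -
    have "{x \<in> {..<q}. act1 \<one> x = x} = {..<q}" "{x \<in> {..<q}. act2 \<one> x = x} = {..<q}"
      by (auto simp: A1.act_one A2.act_one)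
    then show "fix1 \<one> = q" "fix2 \<one> = q" by (simp_all add: fix1_def fix2_def)
  qed
  then have \<chi>: "\<chi> \<one> = of_nat ((q - 1) ^ 2)" using q_pos by (simp add: \<chi>_def power2_eq_square)
  let ?m = "(q - 1) ^ 2"
  \<comment> \<open>Evaluation at the identity. Taking n equal to the degree (q - 1)^2 of
    \<open>\<chi>\<close> makes p^(2 n) larger than that degree, so at least one factor p stays in
    the denominator after cancellation.\<close>
  have "of_nat ?m / of_nat p ^ (2 * ?m) \<in> V"
    using dual_value_one[OF \<chi>_divided_dual] \<chi> by simp
  moreover have "0 < ?m" using prime_gt_1_nat[OF A.q_prime] by simp
  moreover have "?m < p ^ (2 * ?m)"
  proof -
    have "?m < 2 ^ ?m" by (rule less_exp)
    also have "\<dots> \<le> p ^ ?m" using prime_ge_2_nat[OF p_prime] by (intro power_mono) auto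
    also have "\<dots> \<le> p ^ (2 * ?m)" using prime_ge_1_nat[OF p_prime] by (intro power_increasing) auto
    finally show ?thesis .
  qed
  ultimately show ?thesis by (intro inverse_prime_mem[OF _ _ _ p_prime A.char])
qed

end

section \<open>Presented groups\<close>

lemma word_eq_append:
  "word_eq rels u v \<Longrightarrow> word_eq rels (x @ u @ y) (x @ v @ y)"
proof (induction rule: word_eq.induct)
  case (cancel u g e v)
  then show ?case using word_eq.cancel[of rels "x @ u" g e "v @ y"] by simp
next
  case (relation s t u v)
  then show ?case using word_eq.relation[of s t rels "x @ u" "v @ y"] by simp
next
  case (refl u)
  then show ?case by (rule word_eq.refl)
next
  case (sym u v)
  then show ?case by (blast intro: word_eq.sym)
next
  case (trans u v w)
  then show ?case by (blast intro: word_eq.trans)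
qed

lemma word_class_eq_iff: "word_class rels u = word_class rels v \<longleftrightarrow> word_eq rels u v"
  unfolding word_class_def set_eq_iff mem_Collect_eq
  by (metis word_eq.refl word_eq.sym word_eq.trans)

lemma word_eq_mult:
  assumes "word_eq rels u u'" "word_eq rels v v'"
  shows "word_eq rels (u @ v) (u' @ v')"
  using word_eq_append[OF assms(1), of "[]" v] word_eq_append[OF assms(2), of u' "[]"]
  by (simp add: word_eq.trans[of rels "u @ v" "u' @ v"])

lemma presented_group_simps:
  "carrier (presented_group rels) = range (word_class rels)"
  "\<one>\<^bsub>presented_group rels\<^esub> = word_class rels []"
  "word_class rels u \<otimes>\<^bsub>presented_group rels\<^esub> word_class rels v = word_class rels (u @ v)"
proof -
  show "word_class rels u \<otimes>\<^bsub>presented_group rels\<^esub> word_class rels v = word_class rels (u @ v)"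
  proof (intro equalityI subsetI)
    fix w assume "w \<in> word_class rels u \<otimes>\<^bsub>presented_group rels\<^esub> word_class rels v"
    then obtain u' v' where "word_eq rels u u'" "word_eq rels v v'" "word_eq rels (u' @ v') w"
      by (auto simp: presented_group_def word_class_def)
    then show "w \<in> word_class rels (u @ v)"
      unfolding word_class_def mem_Collect_eq by (metis word_eq.trans word_eq_mult)
  next
    fix w assume "w \<in> word_class rels (u @ v)"
    then have "word_eq rels (u @ v) w" "word_eq rels u u" "word_eq rels v v"
      by (auto simp: word_class_def word_eq.refl)
    then show "w \<in> word_class rels u \<otimes>\<^bsub>presented_group rels\<^esub> word_class rels v"
      by (auto simp: presented_group_def word_class_def)
  qed
qed (simp_all add: presented_group_def)

definition inverse_word :: "'x word \<Rightarrow> 'x word" where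
  "inverse_word w = rev (map (\<lambda>(x, e). (x, \<not> e)) w)"

lemma word_eq_inverse_word: "word_eq rels (inverse_word w @ w) []"
proof (induction w)
  case (Cons g w)
  obtain x e where g: "g = (x, e)" by force
  have "word_eq rels (inverse_word w @ [(x, \<not> e), (x, \<not> \<not> e)] @ w) (inverse_word w @ w)"
    by (rule word_eq.cancel)
  then have "word_eq rels (inverse_word w @ [(x, \<not> e), (x, \<not> \<not> e)] @ w) []"
    using Cons by (rule word_eq.trans)
  then show ?case by (simp add: g inverse_word_def)
qed (simp add: inverse_word_def word_eq.refl)

lemma group_presented_group: "group (presented_group rels)"
proof (rule groupI)
  fix x assume "x \<in> carrier (presented_group rels)"
  then obtain w where w: "x = word_class rels w" by (auto simp: presented_group_simps)
  show "\<exists>y\<in>carrier (presented_group rels). y \<otimes>\<^bsub>presented_group rels\<^esub> x = \<one>\<^bsub>presented_group rels\<^esub>"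
    using word_eq_inverse_word[of rels w]
    by (intro bexI[of _ "word_class rels (inverse_word w)"])
      (auto simp: w presented_group_simps word_class_eq_iff)
qed (auto simp: presented_group_simps)

lemma word_class_pow:
  "word_class rels [(x, True)] [^]\<^bsub>presented_group rels\<^esub> n = word_class rels (gen_power x n)"
proof (induction n)
  case 0
  then show ?case using group_presented_group[of rels]
    by (simp add: group_def monoid.nat_pow_0 presented_group_simps gen_power_def)
next
  case (Suc n)
  then show ?case using group_presented_group[of rels]
    by (simp add: group_def monoid.nat_pow_Suc presented_group_simps gen_power_def
        replicate_append_same)
qed

lemma word_class_relation: "(u, v) \<in> rels \<Longrightarrow> word_class rels u = word_class rels v"
  unfolding word_class_eq_iff using word_eq.relation[of u v rels "[]" "[]"] by simp

text \<open>Right multiplication by x turns x y x^-1 = v into x y = v x, where inverse letters no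
  longer occur on the left.\<close>

lemma word_class_gen_conj:
  assumes "(gen_conj x y, v) \<in> rels"
  shows "word_class rels ([(x, True)] @ [(y, True)]) = word_class rels (v @ [(x, True)])"
proof -
  have "word_eq rels ([(x, True), (y, True)] @ [(x, False), (x, \<not> False)] @ []) ([(x, True), (y, True)] @ [])"
    by (rule word_eq.cancel)
  then have 1: "word_eq rels [(x, True), (y, True), (x, False), (x, True)] [(x, True), (y, True)]"
    by simp
  have "word_eq rels ([] @ gen_conj x y @ [(x, True)]) ([] @ v @ [(x, True)])"
    using assms by (rule word_eq.relation)
  then have 2: "word_eq rels [(x, True), (y, True), (x, False), (x, True)] (v @ [(x, True)])"
    by (simp add: gen_conj_def)
  show ?thesis
    unfolding word_class_eq_iff using word_eq.trans[OF word_eq.sym[OF 1] 2] by simp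
qed

lemma word_class_gen_commutator:
  assumes "(gen_commutator x y, []) \<in> rels"
  shows "word_class rels ([(x, True)] @ [(y, True)]) = word_class rels ([(y, True)] @ [(x, True)])"
proof -
  have "word_eq rels ([(x, True), (y, True), (x, False)] @ [(y, False), (y, \<not> False)] @ [(x, True)])
     ([(x, True), (y, True), (x, False)] @ [(x, True)])"
    by (rule word_eq.cancel)
  then have 1: "word_eq rels [(x, True), (y, True), (x, False), (y, False), (y, True), (x, True)]
     [(x, True), (y, True), (x, False), (x, True)]"
    by simp
  have "word_eq rels ([(x, True), (y, True)] @ [(x, False), (x, \<not> False)] @ []) ([(x, True), (y, True)] @ [])"
    by (rule word_eq.cancel)
  then have 2: "word_eq rels [(x, True), (y, True), (x, False), (x, True)] [(x, True), (y, True)]"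
    by simp
  have "word_eq rels ([] @ gen_commutator x y @ [(y, True), (x, True)]) ([] @ [] @ [(y, True), (x, True)])"
    using assms by (rule word_eq.relation)
  then have 3: "word_eq rels [(x, True), (y, True), (x, False), (y, False), (y, True), (x, True)]
     [(y, True), (x, True)]"
    by (simp add: gen_commutator_def)
  show ?thesis
    unfolding word_class_eq_iff
    using word_eq.trans[OF word_eq.sym[OF word_eq.trans[OF 1 2]] 3] by simp
qed

text \<open>A class acts through an arbitrarily chosen word in it, and a word through its letters
  starting from the right end. Once the choice is known not to matter, this is a left
  action.\<close>

definition class_action :: "('x \<times> bool \<Rightarrow> 's \<Rightarrow> 's) \<Rightarrow> 'x word set \<Rightarrow> 's \<Rightarrow> 's" where
  "class_action L A = foldr L (SOME w. w \<in> A)"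

text \<open>The universal property of a presentation, in terms of actions. Everything is demanded on
  \<open>S\<close> only because the affine letters permute the residues below q but are not
  bijections of the natural numbers.\<close>

lemma class_action_word_class:
  assumes closed: "\<And>g s. s \<in> S \<Longrightarrow> L g s \<in> S"
    and cancel: "\<And>x e s. s \<in> S \<Longrightarrow> L (x, e) (L (x, \<not> e) s) = s"
    and rels: "\<And>u v s. (u, v) \<in> rels \<Longrightarrow> s \<in> S \<Longrightarrow> foldr L u s = foldr L v s"
    and "s \<in> S"
  shows "class_action L (word_class rels w) s = foldr L w s"
proof -
  have fold_closed: "foldr L u s \<in> S" if "s \<in> S" for u s
    using that closed by (induction u) auto
  have "\<forall>s\<in>S. foldr L u s = foldr L v s" if "word_eq rels u v" for u v
    using that
  proof (induction rule: word_eq.induct)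
    case (cancel u x e v)
    show ?case
    proof
      fix s assume "s \<in> S"
      then show "foldr L (u @ [(x, e), (x, \<not> e)] @ v) s = foldr L (u @ v) s"
        using assms(2)[OF fold_closed[of s v], of x e] by simp
    qed
  next
    case (relation x y u v)
    show ?case
    proof
      fix s assume "s \<in> S"
      then show "foldr L (u @ x @ v) s = foldr L (u @ y @ v) s"
        using rels[OF relation fold_closed[of s v]] by simp
    qed
  next
    case (sym u v)
    then show ?case by (blast intro: HOL.sym)
  next
    case (trans u v w)
    then show ?case by (blast intro: HOL.trans)
  qed simp
  moreover have "word_eq rels w (SOME v. v \<in> word_class rels w)"
    using someI[of "\<lambda>v. v \<in> word_class rels w" w] by (simp add: word_class_def word_eq.refl)
  ultimately show ?thesis using \<open>s \<in> S\<close> by (simp add: class_action_def)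
qed

section \<open>The group \<open>(\<int>\<^sub>q \<times> \<int>\<^sub>q) \<rtimes> (\<int>\<^sub>p \<times> \<int>\<^sub>p)\<close>\<close>

lemma group_group_G: "group (group_G p q r)"
  unfolding group_G_def by (rule group_presented_group)

lemma gen_G_carrier: "gen_G p q r x \<in> carrier (group_G p q r)"
  by (simp add: gen_G_def group_G_def presented_group_simps)

lemma gen_G_pow: "gen_G p q r x [^]\<^bsub>group_G p q r\<^esub> n = word_class (relations_G p q r) (gen_power x n)"
  unfolding gen_G_def group_G_def by (rule word_class_pow)

lemma gen_G_order:
  "gen_G p q r Gen_sigma [^]\<^bsub>group_G p q r\<^esub> p = \<one>\<^bsub>group_G p q r\<^esub>"
  "gen_G p q r Gen_tau [^]\<^bsub>group_G p q r\<^esub> p = \<one>\<^bsub>group_G p q r\<^esub>"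
  "gen_G p q r Gen_a [^]\<^bsub>group_G p q r\<^esub> q = \<one>\<^bsub>group_G p q r\<^esub>"
  "gen_G p q r Gen_b [^]\<^bsub>group_G p q r\<^esub> q = \<one>\<^bsub>group_G p q r\<^esub>"
  unfolding gen_G_pow
  by (auto simp: group_G_def presented_group_simps relations_G_def intro!: word_class_relation)

lemma gen_G_conj:
  assumes "(x, y) \<in> {(Gen_sigma, Gen_a), (Gen_tau, Gen_b)}"
  shows "gen_G p q r x \<otimes>\<^bsub>group_G p q r\<^esub> gen_G p q r y
    = gen_G p q r y [^]\<^bsub>group_G p q r\<^esub> r \<otimes>\<^bsub>group_G p q r\<^esub> gen_G p q r x"
proof -
  have "(gen_conj x y, gen_power y r) \<in> relations_G p q r"
    using assms by (auto simp: relations_G_def)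
  then show ?thesis unfolding gen_G_pow unfolding gen_G_def group_G_def presented_group_simps
    by (rule word_class_gen_conj)
qed

lemma gen_G_commute:
  assumes "(x, y) \<in> {(Gen_sigma, Gen_b), (Gen_tau, Gen_a), (Gen_a, Gen_b), (Gen_sigma, Gen_tau)}"
  shows "gen_G p q r x \<otimes>\<^bsub>group_G p q r\<^esub> gen_G p q r y
    = gen_G p q r y \<otimes>\<^bsub>group_G p q r\<^esub> gen_G p q r x"
proof -
  have "(gen_commutator x y, []) \<in> relations_G p q r"
    using assms by (auto simp: relations_G_def)
  then show ?thesis unfolding gen_G_def group_G_def presented_group_simps
    by (rule word_class_gen_commutator)
qed

text \<open>The inverse letters are explicit: r^(p-1) inverts r modulo q, and adding q - 1 undoes
  adding 1 without truncated subtraction. Letters other than s and a act trivially.\<close>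

fun affine_letter :: "nat \<Rightarrow> nat \<Rightarrow> nat \<Rightarrow> 'x \<Rightarrow> 'x \<Rightarrow> 'x \<times> bool \<Rightarrow> nat \<Rightarrow> nat" where
  "affine_letter p q r s a (x, e) k =
     (if x = s then (if e then r * k mod q else r ^ (p - 1) * k mod q)
      else if x = a then (if e then (k + 1) mod q else (k + (q - 1)) mod q)
      else k)"

context
  fixes p q r :: nat
  assumes q: "0 < q" and p: "0 < p" and r: "[r ^ p = 1] (mod q)"
begin

lemma affine_letter_less: "k < q \<Longrightarrow> affine_letter p q r s a g k < q"
  using q by (cases g) auto

lemma affine_letter_cancel:
  assumes "k < q"
  shows "affine_letter p q r s a (x, e) (affine_letter p q r s a (x, \<not> e) k) = k"
proof -
  have "r * r ^ (p - 1) = r ^ p" using p by (metis Suc_diff_1 power_Suc)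
  moreover have "r ^ p * k mod q = k"
    using assms cong_scalar_right[OF r, of k] by (simp add: cong_def)
  ultimately have "r * (r ^ (p - 1) * k mod q) mod q = k" "r ^ (p - 1) * (r * k mod q) mod q = k"
    by (simp_all only: mod_mult_right_eq mult.assoc[symmetric] mult.commute[of "r ^ (p - 1)" r])
  moreover have "((k + 1) mod q + (q - 1)) mod q = k" "((k + (q - 1)) mod q + 1) mod q = k"
    unfolding mod_add_left_eq using assms q by simp_all
  ultimately show ?thesis by auto
qed

lemma foldr_affine_letter_gen_power:
  assumes "k < q"
  shows "foldr (affine_letter p q r s a) (gen_power x n) k
    = (if x = s then r ^ n * k mod q else if x = a then (k + n) mod q else k)"
  unfolding gen_power_def
proof (induction n)
  case (Suc n)
  then show ?case using assms
    by (auto simp: mod_mult_right_eq mult.assoc mod_Suc_eq)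
qed (use assms in simp)

lemma foldr_affine_letter_relations:
  assumes "(s, a) \<in> {(Gen_sigma, Gen_a), (Gen_tau, Gen_b)}" and "(u, v) \<in> relations_G p q r" and k: "k < q"
  shows "foldr (affine_letter p q r s a) u k = foldr (affine_letter p q r s a) v k"
proof -
  have rp: "r ^ p * k mod q = k"
    using k cong_scalar_right[OF r, of k] by (simp add: cong_def)
  have cancel: "affine_letter p q r s a (x, True) (affine_letter p q r s a (x, False) k) = k" if "k < q" for x k
    using affine_letter_cancel[OF that, of s a x True] by simp
  have sa: "s \<noteq> a" using assms(1) by auto
  have power: "foldr (affine_letter p q r s a) (gen_power x n) k
    = (if x = s then r ^ n * k mod q else if x = a then (k + n) mod q else k)" for x n
    by (rule foldr_affine_letter_gen_power[OF k])
  have fixed: "affine_letter p q r s a (x, e) j = j" if "x \<noteq> s" "x \<noteq> a" for x e j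
    using that by simp
  \<comment> \<open>The one relation in which both moving generators occur: r (r^(p-1) k + 1) = k +
    r modulo q.\<close>
  have conj: "foldr (affine_letter p q r s a) (gen_conj s a) k = (k + r) mod q"
  proof -
    let ?c = "r ^ (p - 1) * k mod q"
    have "r * ((?c + 1) mod q) mod q = r * (?c + 1) mod q" by (rule mod_mult_right_eq)
    also have "\<dots> = (r * ?c + r) mod q" by (simp only: add_mult_distrib2 mult_1_right)
    also have "\<dots> = (r * ?c mod q + r) mod q" by (rule mod_add_left_eq[symmetric])
    also have "r * ?c mod q = k" using cancel[OF k, of s] by simp
    finally have "r * ((?c + 1) mod q) mod q = (k + r) mod q" .
    then show ?thesis using sa sa[symmetric] by (simp only: gen_conj_def foldr.simps comp_apply id_apply
      affine_letter.simps if_True if_False simp_thms)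
  qed
  have conj_fixed: "foldr (affine_letter p q r s a) (gen_conj x y) k = k"
    if "x \<noteq> s" "x \<noteq> a" "y \<noteq> s" "y \<noteq> a" for x y
    using that by (simp add: gen_conj_def)
  have commutator: "foldr (affine_letter p q r s a) (gen_commutator x y) k = k"
    if "x \<noteq> s \<and> x \<noteq> a \<or> y \<noteq> s \<and> y \<noteq> a" for x y
    using that cancel[OF k, of x] cancel[OF k, of y]
    by (auto simp: gen_commutator_def fixed simp del: affine_letter.simps)
  consider "s = Gen_sigma" "a = Gen_a" | "s = Gen_tau" "a = Gen_b" using assms(1) by auto
  then show ?thesis
  proof cases
    case 1
    show ?thesis using assms(2) k rp unfolding relations_G_def 1
      by (auto simp: power[unfolded 1] conj[unfolded 1] conj_fixed[unfolded 1] commutator[unfolded 1]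
          simp del: affine_letter.simps)
  next
    case 2
    show ?thesis using assms(2) k rp unfolding relations_G_def 2
      by (auto simp: power[unfolded 2] conj[unfolded 2] conj_fixed[unfolded 2] commutator[unfolded 2]
          simp del: affine_letter.simps)
  qed
qed

lemma affine_action_group_G:
  assumes "(s, a) \<in> {(Gen_sigma, Gen_a), (Gen_tau, Gen_b)}"
    and K: "\<And>x. x \<in> K \<Longrightarrow> x \<noteq> s \<and> x \<noteq> a"
  shows "affine_action (group_G p q r) (class_action (affine_letter p q r s a)) q r
    (gen_G p q r s) (gen_G p q r a) (gen_G p q r ` K)"
proof -
  interpret group "group_G p q r" by (rule group_group_G)
  let ?L = "affine_letter p q r s a"
  have act: "class_action ?L (word_class (relations_G p q r) w) k = foldr ?L w k" if "k < q" for w k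
    using that by (intro class_action_word_class[where S = "{..<q}"])
      (auto simp: affine_letter_less affine_letter_cancel foldr_affine_letter_relations[OF assms(1)]
        simp del: affine_letter.simps)
  have less: "foldr ?L w k < q" if "k < q" for w k
    using that by (induction w) (auto simp: affine_letter_less simp del: affine_letter.simps)
  have sa: "s \<noteq> a" using assms(1) by auto
  show ?thesis
  proof
    show "class_action ?L g k < q" if "g \<in> carrier (group_G p q r)" "k < q" for g k
      using that act less by (auto simp: group_G_def presented_group_simps)
    show "class_action ?L (g \<otimes>\<^bsub>group_G p q r\<^esub> h) k = class_action ?L g (class_action ?L h k)"
      if "g \<in> carrier (group_G p q r)" "h \<in> carrier (group_G p q r)" "k < q" for g h k
      using that act less by (auto simp: group_G_def presented_group_simps)
    show "class_action ?L \<one>\<^bsub>group_G p q r\<^esub> k = k" if "k < q" for k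
      using that act by (simp add: group_G_def presented_group_simps)
    show "gen_G p q r ` K \<subseteq> carrier (group_G p q r)" using gen_G_carrier by auto
    show "class_action ?L g k = k" if "g \<in> gen_G p q r ` K" "k < q" for g k
      using that act K by (auto simp: gen_G_def)
  qed (use act sa in \<open>auto simp: gen_G_carrier gen_G_carrier[unfolded gen_G_def] gen_G_def\<close>)
qed

end

lemma (in group) pow_mod:
  assumes "x \<in> carrier G" "x [^] (n::nat) = \<one>"
  shows "x [^] (i::nat) = x [^] (i mod n)"
proof -
  have "x [^] i = x [^] (n * (i div n) + i mod n)" by simp
  also have "\<dots> = (x [^] n) [^] (i div n) \<otimes> x [^] (i mod n)"
    using assms(1) by (simp add: nat_pow_mult nat_pow_pow)
  finally show ?thesis using assms by simp
qed

text \<open>Left multiplication by a generator sends a product a^i b^j sigma^k tau^l to another one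
  of this shape, so these products exhaust G; reducing the exponents leaves finitely many.\<close>

lemma finite_carrier_group_G:
  assumes "0 < p" "0 < q"
  shows "finite (carrier (group_G p q r))"
proof -
  let ?G = "group_G p q r"
  interpret group ?G by (rule group_group_G)
  define s t a b where "s = gen_G p q r Gen_sigma" and "t = gen_G p q r Gen_tau"
    and "a = gen_G p q r Gen_a" and "b = gen_G p q r Gen_b"
  have c [simp]: "s \<in> carrier ?G" "t \<in> carrier ?G" "a \<in> carrier ?G" "b \<in> carrier ?G"
    by (simp_all add: s_def t_def a_def b_def gen_G_carrier)
  have ord: "s [^]\<^bsub>?G\<^esub> p = \<one>\<^bsub>?G\<^esub>" "t [^]\<^bsub>?G\<^esub> p = \<one>\<^bsub>?G\<^esub>" "a [^]\<^bsub>?G\<^esub> q = \<one>\<^bsub>?G\<^esub>" "b [^]\<^bsub>?G\<^esub> q = \<one>\<^bsub>?G\<^esub>"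
    by (simp_all add: s_def t_def a_def b_def gen_G_order)
  define nf where "nf = (\<lambda>(i::nat) (j::nat) (k::nat) (l::nat). a [^]\<^bsub>?G\<^esub> i \<otimes>\<^bsub>?G\<^esub> (b [^]\<^bsub>?G\<^esub> j \<otimes>\<^bsub>?G\<^esub> (s [^]\<^bsub>?G\<^esub> k \<otimes>\<^bsub>?G\<^esub> t [^]\<^bsub>?G\<^esub> l)))"
  \<comment> \<open>Moving x past y^i multiplies the exponent by m, with m = r for the two
    conjugation relations and m = 1 for commuting generators.\<close>
  have slide: "x \<otimes>\<^bsub>?G\<^esub> (y [^]\<^bsub>?G\<^esub> i \<otimes>\<^bsub>?G\<^esub> z) = y [^]\<^bsub>?G\<^esub> (m * i) \<otimes>\<^bsub>?G\<^esub> (x \<otimes>\<^bsub>?G\<^esub> z)"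
    if "x \<in> carrier ?G" "y \<in> carrier ?G" "z \<in> carrier ?G"
      "x \<otimes>\<^bsub>?G\<^esub> y = y [^]\<^bsub>?G\<^esub> m \<otimes>\<^bsub>?G\<^esub> x" for x y z and i m :: nat
    using that(3)
  proof (induction i arbitrary: z)
    case (Suc i)
    have "x \<otimes>\<^bsub>?G\<^esub> (y [^]\<^bsub>?G\<^esub> Suc i \<otimes>\<^bsub>?G\<^esub> z) = x \<otimes>\<^bsub>?G\<^esub> (y [^]\<^bsub>?G\<^esub> i \<otimes>\<^bsub>?G\<^esub> (y \<otimes>\<^bsub>?G\<^esub> z))"
      using that Suc.prems by (simp add: m_assoc)
    also have "\<dots> = y [^]\<^bsub>?G\<^esub> (m * i) \<otimes>\<^bsub>?G\<^esub> (x \<otimes>\<^bsub>?G\<^esub> (y \<otimes>\<^bsub>?G\<^esub> z))"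
      using that Suc.prems by (intro Suc.IH) simp
    also have "x \<otimes>\<^bsub>?G\<^esub> (y \<otimes>\<^bsub>?G\<^esub> z) = y [^]\<^bsub>?G\<^esub> m \<otimes>\<^bsub>?G\<^esub> (x \<otimes>\<^bsub>?G\<^esub> z)"
      using that(1,2,4) Suc.prems by (simp add: m_assoc[symmetric])
    also have "y [^]\<^bsub>?G\<^esub> (m * i) \<otimes>\<^bsub>?G\<^esub> (y [^]\<^bsub>?G\<^esub> m \<otimes>\<^bsub>?G\<^esub> (x \<otimes>\<^bsub>?G\<^esub> z)) = y [^]\<^bsub>?G\<^esub> (m * Suc i) \<otimes>\<^bsub>?G\<^esub> (x \<otimes>\<^bsub>?G\<^esub> z)"
      using that(1,2) Suc.prems by (simp add: m_assoc[symmetric] nat_pow_mult add.commute)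
    finally show ?case .
  qed (use that in simp)
  have shift: "x \<otimes>\<^bsub>?G\<^esub> (x [^]\<^bsub>?G\<^esub> i \<otimes>\<^bsub>?G\<^esub> z) = x [^]\<^bsub>?G\<^esub> Suc i \<otimes>\<^bsub>?G\<^esub> z"
    if "x \<in> carrier ?G" "z \<in> carrier ?G" for x z and i :: nat
    using that by (simp only: nat_pow_Suc2 m_assoc nat_pow_closed)
  have gens: "\<exists>i' j' k' l'. g \<otimes>\<^bsub>?G\<^esub> nf i j k l = nf i' j' k' l'" if "g \<in> {s, t, a, b}" for g i j k l
  proof -
    have comm: "b \<otimes>\<^bsub>?G\<^esub> a = a [^]\<^bsub>?G\<^esub> (1::nat) \<otimes>\<^bsub>?G\<^esub> b" "s \<otimes>\<^bsub>?G\<^esub> b = b [^]\<^bsub>?G\<^esub> (1::nat) \<otimes>\<^bsub>?G\<^esub> s"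
      "t \<otimes>\<^bsub>?G\<^esub> a = a [^]\<^bsub>?G\<^esub> (1::nat) \<otimes>\<^bsub>?G\<^esub> t" "t \<otimes>\<^bsub>?G\<^esub> s = s [^]\<^bsub>?G\<^esub> (1::nat) \<otimes>\<^bsub>?G\<^esub> t"
      "s \<otimes>\<^bsub>?G\<^esub> a = a [^]\<^bsub>?G\<^esub> r \<otimes>\<^bsub>?G\<^esub> s" "t \<otimes>\<^bsub>?G\<^esub> b = b [^]\<^bsub>?G\<^esub> r \<otimes>\<^bsub>?G\<^esub> t"
      using gen_G_commute[of Gen_a Gen_b p q r] gen_G_commute[of Gen_sigma Gen_b p q r]
        gen_G_commute[of Gen_tau Gen_a p q r] gen_G_commute[of Gen_sigma Gen_tau p q r]
        gen_G_conj[of Gen_sigma Gen_a p q r] gen_G_conj[of Gen_tau Gen_b p q r]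
      by (simp_all add: s_def t_def a_def b_def gen_G_carrier)
    have "a \<otimes>\<^bsub>?G\<^esub> nf i j k l = nf (Suc i) j k l"
      unfolding nf_def by (subst shift) simp_all
    moreover have "b \<otimes>\<^bsub>?G\<^esub> nf i j k l = nf (1 * i) (Suc j) k l"
      unfolding nf_def by (subst slide[OF _ _ _ comm(1)], simp_all only: c m_closed nat_pow_closed, subst shift, simp_all)
    moreover have "s \<otimes>\<^bsub>?G\<^esub> nf i j k l = nf (r * i) (1 * j) (Suc k) l"
      unfolding nf_def by (subst slide[OF _ _ _ comm(5)], simp_all only: c m_closed nat_pow_closed,
        subst slide[OF _ _ _ comm(2)], simp_all only: c m_closed nat_pow_closed, subst shift, simp_all)
    moreover have "t \<otimes>\<^bsub>?G\<^esub> nf i j k l = nf (1 * i) (r * j) (1 * k) (Suc l)"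
      unfolding nf_def by (subst slide[OF _ _ _ comm(3)], simp_all only: c m_closed nat_pow_closed,
        subst slide[OF _ _ _ comm(6)], simp_all only: c m_closed nat_pow_closed,
        subst slide[OF _ _ _ comm(4)], simp_all only: c m_closed nat_pow_closed nat_pow_Suc2)
    ultimately show ?thesis using that by blast
  qed
  have pows: "\<exists>i' j' k' l'. g [^]\<^bsub>?G\<^esub> n \<otimes>\<^bsub>?G\<^esub> nf i j k l = nf i' j' k' l'" if g: "g \<in> {s, t, a, b}" for g i j k l and n :: nat
  proof (induction n arbitrary: i j k l)
    case 0
    have "nf i j k l \<in> carrier ?G" by (simp add: nf_def)
    then show ?case by (auto simp: nat_pow_0)
  next
    case (Suc n)
    have gc: "g \<in> carrier ?G" "nf i j k l \<in> carrier ?G" using g by (auto simp: nf_def)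
    obtain i' j' k' l' where "g \<otimes>\<^bsub>?G\<^esub> nf i j k l = nf i' j' k' l'" using gens[OF g] by blast
    then have "g [^]\<^bsub>?G\<^esub> Suc n \<otimes>\<^bsub>?G\<^esub> nf i j k l = g [^]\<^bsub>?G\<^esub> n \<otimes>\<^bsub>?G\<^esub> nf i' j' k' l'"
      using gc by (simp add: m_assoc)
    then show ?case using Suc[of i' j' k' l'] by simp
  qed
  \<comment> \<open>Every generator has finite order, so an inverse letter is also a nonnegative
    power of its generator.\<close>
  have letter: "\<exists>g\<in>{s, t, a, b}. \<exists>n::nat. word_class (relations_G p q r) [x] = g [^]\<^bsub>?G\<^esub> n" for x
  proof -
    obtain y e where x: "x = (y, e)" by force
    have y: "gen_G p q r y \<in> {s, t, a, b}"
      by (cases y) (simp_all add: s_def t_def a_def b_def)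
    show ?thesis
    proof (cases e)
      case True
      then have "word_class (relations_G p q r) [x] = gen_G p q r y [^]\<^bsub>?G\<^esub> (1::nat)"
        using gen_G_carrier[of p q r y] by (simp add: x gen_G_def)
      then show ?thesis using y by blast
    next
      case False
      let ?y = "gen_G p q r y" and ?x = "word_class (relations_G p q r) [x]"
      obtain m where m: "?y [^]\<^bsub>?G\<^esub> Suc m = \<one>\<^bsub>?G\<^esub>"
        using y ord assms by (auto dest!: gr0_implies_Suc)
      have yc: "?y \<in> carrier ?G" "?x \<in> carrier ?G"
        using gen_G_carrier by (simp_all add: group_G_def presented_group_simps)
      have "word_eq (relations_G p q r) ([] @ [(y, False), (y, \<not> False)] @ []) ([] @ [])"
        by (rule word_eq.cancel)
      then have xy: "?x \<otimes>\<^bsub>?G\<^esub> ?y = \<one>\<^bsub>?G\<^esub>"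
        using False by (simp add: x gen_G_def group_G_def presented_group_simps word_class_eq_iff)
      have "?x = ?x \<otimes>\<^bsub>?G\<^esub> ?y [^]\<^bsub>?G\<^esub> Suc m" using yc unfolding m by simp
      also have "\<dots> = ?x \<otimes>\<^bsub>?G\<^esub> ?y \<otimes>\<^bsub>?G\<^esub> ?y [^]\<^bsub>?G\<^esub> m"
        using yc by (simp only: nat_pow_Suc2 m_assoc nat_pow_closed)
      also have "\<dots> = ?y [^]\<^bsub>?G\<^esub> m" using yc by (simp add: xy)
      finally show ?thesis using y by blast
    qed
  qed
  have "\<exists>i j k l. word_class (relations_G p q r) w = nf i j k l" for w
  proof (induction w)
    case Nil
    have "nf 0 0 0 0 = word_class (relations_G p q r) []"
      by (simp add: nf_def) (simp add: group_G_def presented_group_simps)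
    then show ?case by (metis (no_types))
  next
    case (Cons x w)
    then obtain i j k l where "word_class (relations_G p q r) w = nf i j k l" by blast
    moreover have "word_class (relations_G p q r) (x # w)
      = word_class (relations_G p q r) [x] \<otimes>\<^bsub>?G\<^esub> word_class (relations_G p q r) w"
      by (simp add: group_G_def presented_group_simps)
    moreover obtain g n where "g \<in> {s, t, a, b}" "word_class (relations_G p q r) [x] = g [^]\<^bsub>?G\<^esub> (n :: nat)"
      using letter[of x] by blast
    ultimately show ?case using pows[of g n i j k l] by simp
  qed
  note normal_form = this
  have nf_mod: "nf i j k l = nf (i mod q) (j mod q) (k mod p) (l mod p)" for i j k l
    unfolding nf_def by (simp only: pow_mod[OF c(1) ord(1), symmetric] pow_mod[OF c(2) ord(2), symmetric]
      pow_mod[OF c(3) ord(3), symmetric] pow_mod[OF c(4) ord(4), symmetric])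
  have nf_bounded: "\<exists>i<q. \<exists>j<q. \<exists>k<p. \<exists>l<p. word_class (relations_G p q r) w = nf i j k l" for w
  proof -
    obtain i j k l where "word_class (relations_G p q r) w = nf i j k l" using normal_form by blast
    then have "word_class (relations_G p q r) w = nf (i mod q) (j mod q) (k mod p) (l mod p)"
      by (rule HOL.trans[OF _ nf_mod])
    moreover have "i mod q < q" "j mod q < q" "k mod p < p" "l mod p < p" using assms by simp_all
    ultimately show ?thesis by blast
  qed
  have "carrier ?G \<subseteq> (\<lambda>(i, j, k, l). nf i j k l) ` ({..<q} \<times> {..<q} \<times> {..<p} \<times> {..<p})"
  proof
    fix g assume "g \<in> carrier ?G"
    then obtain w where w: "g = word_class (relations_G p q r) w"
      by (auto simp: group_G_def presented_group_simps)
    obtain i j k l where "i < q" "j < q" "k < p" "l < p" "g = nf i j k l"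
      using nf_bounded[of w] unfolding w by blast
    then show "g \<in> (\<lambda>(i, j, k, l). nf i j k l) ` ({..<q} \<times> {..<q} \<times> {..<p} \<times> {..<p})"
      by (intro image_eqI[of _ _ "(i, j, k, l)"]) auto
  qed
  then show ?thesis by (rule finite_subset) simp
qed

section \<open>The twisted group algebra\<close>

lemma group_algebra_simps:
  "carrier (group_algebra G) = {f. \<forall>x. x \<notin> carrier G \<longrightarrow> f x = 0}"
  "\<one>\<^bsub>group_algebra G\<^esub> = group_element \<one>\<^bsub>G\<^esub>"
  by (simp_all add: group_algebra_def)

lemma group_algebra_mult_closed: "x \<otimes>\<^bsub>group_algebra G\<^esub> y \<in> carrier (group_algebra G)"
  by (simp add: group_algebra_def)

lemma group_element_carrier: "g \<in> carrier G \<Longrightarrow> group_element g \<in> carrier (group_algebra G)"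
  by (auto simp: group_algebra_simps group_element_def)

text \<open>Coordinate functions are among the functionals, so functionals separate elements.
  Associativity of the group algebra and the formula for the inverse of J are derived from
  \<open>pairing\<close> by this.\<close>

lemma group_algebra_eqI:
  assumes "finite (carrier G)" "x \<in> carrier (group_algebra G)" "y \<in> carrier (group_algebra G)"
    and "\<And>F :: 'g \<Rightarrow> 'k::field. pairing G F x = pairing G F y"
  shows "x = y"
proof
  fix g
  have "pairing G (\<lambda>h. if h = g then 1 else 0) z = z g" if "z \<in> carrier (group_algebra G)" for z :: "'g \<Rightarrow> 'k"
  proof -
    have "pairing G (\<lambda>h. if h = g then 1 else 0) z = (\<Sum>h\<in>carrier G. if h = g then z h else 0)"
      unfolding pairing_def by (intro sum.cong) auto
    then show ?thesis using assms(1) that by (auto simp: group_algebra_simps)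
  qed
  then show "x g = y g" using assms(2-4) by metis
qed

lemma (in group) monoid_group_algebra:
  assumes "finite (carrier G)"
  shows "monoid (group_algebra G :: ('a \<Rightarrow> 'k::field) ring)"
proof (rule monoidI)
  let ?A = "group_algebra G :: ('a \<Rightarrow> 'k) ring"
  show "x \<otimes>\<^bsub>?A\<^esub> y \<in> carrier ?A" for x y by (rule group_algebra_mult_closed)
  show one: "\<one>\<^bsub>?A\<^esub> \<in> carrier ?A" by (simp add: group_algebra_simps(2) group_element_carrier)
  show "x \<otimes>\<^bsub>?A\<^esub> y \<otimes>\<^bsub>?A\<^esub> z = x \<otimes>\<^bsub>?A\<^esub> (y \<otimes>\<^bsub>?A\<^esub> z)" for x y z
  proof (rule group_algebra_eqI[OF assms group_algebra_mult_closed group_algebra_mult_closed])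
    fix F :: "'a \<Rightarrow> 'k"
    show "pairing G F (x \<otimes>\<^bsub>?A\<^esub> y \<otimes>\<^bsub>?A\<^esub> z) = pairing G F (x \<otimes>\<^bsub>?A\<^esub> (y \<otimes>\<^bsub>?A\<^esub> z))"
      unfolding pairing_mult[OF assms] by (intro pairing_cong) (simp add: m_assoc)
  qed
  show "\<one>\<^bsub>?A\<^esub> \<otimes>\<^bsub>?A\<^esub> x = x" if "x \<in> carrier ?A" for x
  proof (rule group_algebra_eqI[OF assms group_algebra_mult_closed that])
    fix F :: "'a \<Rightarrow> 'k"
    have "pairing G F (\<one>\<^bsub>?A\<^esub> \<otimes>\<^bsub>?A\<^esub> x) = pairing G (\<lambda>h. F (\<one> \<otimes> h)) x"
      unfolding pairing_mult[OF assms] group_algebra_simps by (rule pairing_group_element[OF assms one_closed])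
    then show "pairing G F (\<one>\<^bsub>?A\<^esub> \<otimes>\<^bsub>?A\<^esub> x) = pairing G F x"
      using pairing_cong[of G "\<lambda>h. F (\<one> \<otimes> h)" F x] by simp
  qed
  show "x \<otimes>\<^bsub>?A\<^esub> \<one>\<^bsub>?A\<^esub> = x" if "x \<in> carrier ?A" for x
  proof (rule group_algebra_eqI[OF assms group_algebra_mult_closed that])
    fix F :: "'a \<Rightarrow> 'k"
    show "pairing G F (x \<otimes>\<^bsub>?A\<^esub> \<one>\<^bsub>?A\<^esub>) = pairing G F x"
      unfolding pairing_mult[OF assms] group_algebra_simps
      by (rule pairing_cong) (simp add: pairing_group_element[OF assms one_closed])
  qed
qed

lemma carrier_DirProd: "carrier (G \<times>\<times> H) = carrier G \<times> carrier H"
  by (simp add: DirProd_def)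

lemma pairing_DirProd:
  "pairing (G \<times>\<times> H) F x = (\<Sum>g\<in>carrier G. \<Sum>h\<in>carrier H. x (g, h) * F (g, h))"
  by (simp add: pairing_def carrier_DirProd sum.cartesian_product case_prod_unfold)

lemma pairing_tensor:
  "pairing (G \<times>\<times> H) F (tensor x y) = pairing G (\<lambda>g. pairing H (\<lambda>h. F (g, h)) y) x"
  unfolding pairing_DirProd by (simp add: pairing_def tensor_def sum_distrib_left mult.assoc)

lemma pairing_diagonal:
  assumes "finite (carrier G)"
  shows "pairing (G \<times>\<times> G) F (\<lambda>(x, y). if x = y then f x else 0) = pairing G (\<lambda>g. F (g, g)) f"
proof -
  have "pairing (G \<times>\<times> G) F (\<lambda>(x, y). if x = y then f x else 0)
    = (\<Sum>x\<in>carrier G. \<Sum>y\<in>carrier G. if y = x then f x * F (x, x) else 0)"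
    unfolding pairing_DirProd by (intro sum.cong HOL.refl) auto
  then show ?thesis using assms by (simp add: pairing_def)
qed

text \<open>The element \<open>J\<close> for a root of unity \<open>\<omega>\<close>; its inverse is the element for \<open>\<omega>\<^sup>-\<^sup>1\<close>.\<close>

definition bicharacter_element ::
    "('g, 'm) monoid_scheme \<Rightarrow> nat \<Rightarrow> 'k::field \<Rightarrow> 'g \<Rightarrow> 'g \<Rightarrow> 'g \<times> 'g \<Rightarrow> 'k" where
  "bicharacter_element G p \<omega> s t = (\<lambda>z. 1 / of_nat p * (\<Sum>u<p. \<Sum>v<p. inverse (\<omega> ^ (u * v)) *
     tensor (group_element (t [^]\<^bsub>G\<^esub> u)) (group_element (s [^]\<^bsub>G\<^esub> v)) z))"

context half_twist
begin

lemma bicharacter_element_carrier: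
  fixes \<omega> :: "'l::field"
  shows "bicharacter_element G p \<omega> s t \<in> carrier (group_algebra (G \<times>\<times> G))"
proof -
  have "tensor (group_element (t [^] u)) (group_element (s [^] v)) z = (0 :: 'l)"
    if "z \<notin> carrier (G \<times>\<times> G)" for z and u v :: nat
    using that by (cases z) (auto simp: tensor_def group_element_def carrier_DirProd)
  then show ?thesis
    unfolding group_algebra_simps by (intro CollectI allI impI) (simp add: bicharacter_element_def)
qed

lemma pairing_bicharacter_element:
  assumes "finite (carrier G)"
  shows "pairing (G \<times>\<times> G) F (bicharacter_element G p \<omega> s t)
    = 1 / of_nat p * (\<Sum>u<p. \<Sum>v<p. inverse (\<omega> ^ (u * v)) * F (t [^] u, s [^] v))"
proof -
  have "pairing (G \<times>\<times> G) F (bicharacter_element G p \<omega> s t)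
    = (\<Sum>z\<in>{..<p} \<times> {..<p}. 1 / of_nat p * inverse (\<omega> ^ (fst z * snd z)) *
        pairing (G \<times>\<times> G) F (tensor (group_element (t [^] fst z)) (group_element (s [^] snd z))))"
    by (intro pairing_sum)
      (simp add: bicharacter_element_def sum_distrib_left sum.cartesian_product case_prod_unfold mult.assoc)
  also have "\<dots> = (\<Sum>z\<in>{..<p} \<times> {..<p}. 1 / of_nat p * inverse (\<omega> ^ (fst z * snd z)) * F (t [^] fst z, s [^] snd z))"
    unfolding pairing_tensor by (simp add: pairing_group_element[OF assms])
  finally show ?thesis
    by (simp add: sum_distrib_left sum.cartesian_product case_prod_unfold mult.assoc)
qed

text \<open>The functional form of J 1 J^-1 = 1, read off from the formula for t^n a^l at n = l = 0.
  It is the source of the invertibility of J.\<close>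

lemma twist_dual_one:
  fixes F :: "'a \<times> 'a \<Rightarrow> 'k"
  shows "twist_dual G p \<zeta> s t F \<one> = F (\<one>, \<one>)"
proof -
  have "twist_dual G p \<zeta> s t F \<one> = 1 / of_nat p * (\<Sum>u<p. \<Sum>v<p. inverse (\<zeta> ^ (u * v)) * F (t [^] u, \<one>))"
    using twist_dual_t_a[of F 0 0] by simp
  also have "\<dots> = 1 / of_nat p * (\<Sum>u<p. if u = 0 then of_nat p * F (t [^] u, \<one>) else 0)"
  proof (intro arg_cong2[of _ _ _ _ "(*)"] sum.cong HOL.refl)
    fix u assume u: "u \<in> {..<p}"
    have "(\<Sum>v<p. inverse (\<zeta> ^ (u * v)) * F (t [^] u, \<one>)) = (\<Sum>v<p. inverse (\<zeta> ^ (v * u))) * F (t [^] u, \<one>)"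
      by (simp add: sum_distrib_left mult.commute)
    then show "(\<Sum>v<p. inverse (\<zeta> ^ (u * v)) * F (t [^] u, \<one>)) = (if u = 0 then of_nat p * F (t [^] u, \<one>) else 0)"
      unfolding sum_inverse_powers_root_of_unity[OF root p_pos] using u by (auto dest: dvd_imp_le)
  qed
  also have "\<dots> = F (\<one>, \<one>)" using p_pos char by (simp add: sum.delta)
  finally show ?thesis .
qed

text \<open>Paired with any F, both products of the two elements give the sum that defines
  \<open>twist_dual\<close> at the identity: in one order directly, in the other because powers of
  one element commute.\<close>

lemma inv_bicharacter_element:
  assumes "finite (carrier G)"
  shows "inv\<^bsub>group_algebra (G \<times>\<times> G)\<^esub> (bicharacter_element G p \<zeta> s t) = bicharacter_element G p (inverse \<zeta>) s t"
proof -
  let ?A = "group_algebra (G \<times>\<times> G) :: ('a \<times> 'a \<Rightarrow> 'k) ring"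
  let ?J = "bicharacter_element G p \<zeta> s t" and ?J' = "bicharacter_element G p (inverse \<zeta>) s t"
  interpret GG: group "G \<times>\<times> G" by (intro DirProd_group is_group)
  have fin: "finite (carrier (G \<times>\<times> G))" using assms by (simp add: carrier_DirProd)
  interpret A: monoid ?A by (rule GG.monoid_group_algebra[OF fin])
  have one: "pairing (G \<times>\<times> G) F \<one>\<^bsub>?A\<^esub> = F (\<one>, \<one>)" for F :: "'a \<times> 'a \<Rightarrow> 'k"
    unfolding group_algebra_simps(2) using pairing_group_element[OF fin GG.one_closed] by simp
  have td: "twist_dual G p \<zeta> s t F \<one> = 1 / of_nat p ^ 2 *
     (\<Sum>u<p. \<Sum>v<p. \<Sum>u'<p. \<Sum>v'<p. inverse (\<zeta> ^ (u * v)) * \<zeta> ^ (u' * v') *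
        F (t [^] u \<otimes> t [^] u', s [^] v \<otimes> s [^] v'))" for F :: "'a \<times> 'a \<Rightarrow> 'k"
    unfolding twist_dual_def by simp
  have "?J \<otimes>\<^bsub>?A\<^esub> ?J' = \<one>\<^bsub>?A\<^esub>"
  proof (rule group_algebra_eqI[OF fin group_algebra_mult_closed A.one_closed])
    fix F :: "'a \<times> 'a \<Rightarrow> 'k"
    have "pairing (G \<times>\<times> G) F (?J \<otimes>\<^bsub>?A\<^esub> ?J') = twist_dual G p \<zeta> s t F \<one>"
      unfolding GG.pairing_mult[OF fin] pairing_bicharacter_element[OF assms] td
      by (simp add: sum_distrib_left power2_eq_square mult.assoc power_inverse)
    then show "pairing (G \<times>\<times> G) F (?J \<otimes>\<^bsub>?A\<^esub> ?J') = pairing (G \<times>\<times> G) F \<one>\<^bsub>?A\<^esub>"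
      by (simp add: twist_dual_one one)
  qed
  moreover have "?J' \<otimes>\<^bsub>?A\<^esub> ?J = \<one>\<^bsub>?A\<^esub>"
  proof (rule group_algebra_eqI[OF fin group_algebra_mult_closed A.one_closed])
    fix F :: "'a \<times> 'a \<Rightarrow> 'k"
    have "pairing (G \<times>\<times> G) F (?J' \<otimes>\<^bsub>?A\<^esub> ?J)
       = pairing (G \<times>\<times> G) (\<lambda>g. pairing (G \<times>\<times> G) (\<lambda>h. F (h \<otimes>\<^bsub>G \<times>\<times> G\<^esub> g)) ?J') ?J"
      unfolding GG.pairing_mult[OF fin] by (rule pairing_swap)
    also have "\<dots> = twist_dual G p \<zeta> s t F \<one>"
      unfolding pairing_bicharacter_element[OF assms] td
      by (simp add: sum_distrib_left power2_eq_square mult.assoc power_inverse nat_pow_mult add.commute)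
    finally show "pairing (G \<times>\<times> G) F (?J' \<otimes>\<^bsub>?A\<^esub> ?J) = pairing (G \<times>\<times> G) F \<one>\<^bsub>?A\<^esub>"
      by (simp add: twist_dual_one one)
  qed
  ultimately show ?thesis
    by (intro A.inv_char bicharacter_element_carrier)
qed

text \<open>The bridge from conjugation by J inside the group algebra of the direct product to the
  explicit sum \<open>twist_dual\<close>: J, the diagonal element and the inverse of J are paired
  one after the other.\<close>

lemma pairing_twisted_coproduct:
  fixes F :: "'a \<times> 'a \<Rightarrow> 'k"
  assumes fin_G: "finite (carrier G)"
  shows "pairing (G \<times>\<times> G) F (bicharacter_element G p \<zeta> s t \<otimes>\<^bsub>group_algebra (G \<times>\<times> G)\<^esub>
      (\<lambda>(x, y). if x = y then f x else 0) \<otimes>\<^bsub>group_algebra (G \<times>\<times> G)\<^esub>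
      inv\<^bsub>group_algebra (G \<times>\<times> G)\<^esub> (bicharacter_element G p \<zeta> s t))
    = pairing G (twist_dual G p \<zeta> s t F) f"
proof -
  interpret GG: group "G \<times>\<times> G" by (intro DirProd_group is_group)
  have fin: "finite (carrier (G \<times>\<times> G))" using assms by (simp add: carrier_DirProd)
  have scale: "pairing G (\<lambda>g. \<Sum>i<p. h i g) f = (\<Sum>i<p. pairing G (h i) f)" for h :: "nat \<Rightarrow> 'a \<Rightarrow> 'k"
    unfolding pairing_def by (simp add: sum_distrib_left) (rule sum.swap)
  have divide: "pairing G (\<lambda>g. h g / c) f = pairing G h f / c" for h :: "'a \<Rightarrow> 'k" and c
    by (simp add: pairing_def sum_divide_distrib)
  show ?thesis
    unfolding inv_bicharacter_element[OF fin_G] GG.pairing_mult[OF fin] pairing_bicharacter_element[OF fin_G]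
      pairing_diagonal[OF fin_G] twist_dual_def
    by (simp add: pairing_scale divide scale sum_distrib_left power2_eq_square mult.assoc power_inverse)
qed

end

lemma group_hopf_algebra_simps:
  "carrier (group_hopf_algebra G) = carrier (group_algebra G)"
  "\<one>\<^bsub>group_hopf_algebra G\<^esub> = group_element \<one>\<^bsub>G\<^esub>"
  "x \<otimes>\<^bsub>group_hopf_algebra G\<^esub> y = x \<otimes>\<^bsub>group_algebra G\<^esub> y"
  "counit (group_hopf_algebra G) x = pairing G (\<lambda>_. 1) x"
  "comult (group_hopf_algebra G) x = (\<lambda>(g, h). if g = h then x g else 0)"
  by (simp_all add: group_hopf_algebra_def ring.extend_def hopf_algebra.fields_def pairing_def
      group_algebra_simps)

lemma hopf_B_simps:
  fixes p q r :: nat and \<zeta> :: "'k::field"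
  defines "G \<equiv> group_G p q r" and "\<sigma> \<equiv> gen_G p q r Gen_sigma" and "\<tau> \<equiv> gen_G p q r Gen_tau"
  shows "carrier (hopf_B p q r \<zeta>) = carrier (group_algebra G)"
    and "\<one>\<^bsub>hopf_B p q r \<zeta>\<^esub> = group_element \<one>\<^bsub>G\<^esub>"
    and "x \<otimes>\<^bsub>hopf_B p q r \<zeta>\<^esub> y = x \<otimes>\<^bsub>group_algebra G\<^esub> y"
    and "counit (hopf_B p q r \<zeta>) x = pairing G (\<lambda>_. 1) x"
    and "comult (hopf_B p q r \<zeta>) x = bicharacter_element G p \<zeta> \<sigma> \<tau> \<otimes>\<^bsub>group_algebra (G \<times>\<times> G)\<^esub>
      (\<lambda>(g, h). if g = h then x g else 0) \<otimes>\<^bsub>group_algebra (G \<times>\<times> G)\<^esub>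
      inv\<^bsub>group_algebra (G \<times>\<times> G)\<^esub> (bicharacter_element G p \<zeta> \<sigma> \<tau>)"
proof -
  have "twist_J p q r \<zeta> = bicharacter_element G p \<zeta> \<sigma> \<tau>"
    by (simp add: twist_J_def bicharacter_element_def Let_def G_def \<sigma>_def \<tau>_def)
  then have B: "hopf_B p q r \<zeta> = drinfeld_twist G (bicharacter_element G p \<zeta> \<sigma> \<tau>)"
    by (simp add: hopf_B_def G_def)
  show "carrier (hopf_B p q r \<zeta>) = carrier (group_algebra G)"
    and "\<one>\<^bsub>hopf_B p q r \<zeta>\<^esub> = group_element \<one>\<^bsub>G\<^esub>"
    and "x \<otimes>\<^bsub>hopf_B p q r \<zeta>\<^esub> y = x \<otimes>\<^bsub>group_algebra G\<^esub> y"
    and "counit (hopf_B p q r \<zeta>) x = pairing G (\<lambda>_. 1) x"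
    and "comult (hopf_B p q r \<zeta>) x = bicharacter_element G p \<zeta> \<sigma> \<tau> \<otimes>\<^bsub>group_algebra (G \<times>\<times> G)\<^esub>
      (\<lambda>(g, h). if g = h then x g else 0) \<otimes>\<^bsub>group_algebra (G \<times>\<times> G)\<^esub>
      inv\<^bsub>group_algebra (G \<times>\<times> G)\<^esub> (bicharacter_element G p \<zeta> \<sigma> \<tau>)"
    by (simp_all add: B drinfeld_twist_def Let_def group_hopf_algebra_simps)
qed

lemma field_subring_ring_of_type_algebra:
  assumes "subring R (ring_of_type_algebra :: 'k::field ring)"
  shows "field_subring R"
proof -
  let ?K = "ring_of_type_algebra :: 'k ring"
  interpret K: ring ?K by (rule ring_from_type_algebra)
  note closed = subringE[OF assms]
  have uminus: "\<ominus>\<^bsub>?K\<^esub> y = - y" for y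
    by (rule K.minus_equality) (simp_all add: ring_of_type_algebra_def)
  show ?thesis
  proof
    show "1 \<in> R" using closed(3) by (simp add: ring_of_type_algebra_def)
    show "x * y \<in> R" if "x \<in> R" "y \<in> R" for x y
      using closed(6)[OF that] by (simp add: ring_of_type_algebra_def)
    show "x - y \<in> R" if "x \<in> R" "y \<in> R" for x y
    proof -
      have "x \<oplus>\<^bsub>?K\<^esub> - y \<in> R"
        using closed(7)[OF that(1) closed(5)[OF that(2)]] unfolding uminus .
      then show ?thesis by (simp add: ring_of_type_algebra_def)
    qed
  qed
qed

lemma inverse_p_mem_of_hopf_order:
  fixes p q r :: nat and \<zeta> :: "'k::number_field"
  assumes "prime p" and "prime q" and "coprime q r" and ord: "ord q r = p"
    and root: "primitive_root_of_unity p \<zeta>"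
    and hopf: "hopf_order R (hopf_B p q r \<zeta>) M"
  shows "1 / of_nat p \<in> R"
proof (rule ccontr)
  assume "1 / of_nat p \<notin> R"
  then have inv: "inverse (of_nat p) \<notin> R" by (simp add: inverse_eq_divide)
  have "field_subring R"
    using hopf by (intro field_subring_ring_of_type_algebra) (simp add: hopf_order_def)
  then interpret R: field_subring R .
  obtain V where V: "valuation_ring V" "R \<subseteq> V" "inverse (of_nat p) \<notin> V"
    using valuation_ring_excluding_inverse[OF \<open>field_subring R\<close> R.of_nat_mem inv] by blast
  interpret V: valuation_ring V by (rule V(1))
  let ?G = "group_G p q r"
  define s t a b where "s = gen_G p q r Gen_sigma" and "t = gen_G p q r Gen_tau"
    and "a = gen_G p q r Gen_a" and "b = gen_G p q r Gen_b"
  interpret group ?G by (rule group_group_G)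
  have pq: "0 < p" "0 < q" using assms(1,2) by (simp_all add: prime_gt_0_nat)
  have fin: "finite (carrier ?G)" by (rule finite_carrier_group_G[OF pq])
  have r_pow: "[r ^ n = 1] (mod q) \<longleftrightarrow> p dvd n" for n
    using ord_divides[of r n q] ord by simp
  have gens: "s \<in> carrier ?G" "t \<in> carrier ?G" "a \<in> carrier ?G" "b \<in> carrier ?G"
    by (simp_all add: s_def t_def a_def b_def gen_G_carrier)
  note defs = s_def t_def a_def b_def
  have char: "of_nat p \<noteq> (0 :: 'k)" using pq(1) by simp
  have order: "s [^]\<^bsub>?G\<^esub> p = \<one>\<^bsub>?G\<^esub>" "t [^]\<^bsub>?G\<^esub> p = \<one>\<^bsub>?G\<^esub>" "a [^]\<^bsub>?G\<^esub> q = \<one>\<^bsub>?G\<^esub>" "b [^]\<^bsub>?G\<^esub> q = \<one>\<^bsub>?G\<^esub>"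
    unfolding defs by (rule gen_G_order)+
  have conj: "s \<otimes>\<^bsub>?G\<^esub> a = a [^]\<^bsub>?G\<^esub> r \<otimes>\<^bsub>?G\<^esub> s" "t \<otimes>\<^bsub>?G\<^esub> b = b [^]\<^bsub>?G\<^esub> r \<otimes>\<^bsub>?G\<^esub> t"
    unfolding defs by (rule gen_G_conj; simp)+
  have comm: "s \<otimes>\<^bsub>?G\<^esub> t = t \<otimes>\<^bsub>?G\<^esub> s" "t \<otimes>\<^bsub>?G\<^esub> a = a \<otimes>\<^bsub>?G\<^esub> t" "s \<otimes>\<^bsub>?G\<^esub> b = b \<otimes>\<^bsub>?G\<^esub> s"
    unfolding defs by (rule gen_G_commute; simp)+
  have half1: "half_twist_prime ?G s t a p q r \<zeta>"
    by unfold_locales (fact gens order conj comm comm[symmetric] pq char root r_pow assms(2,3))+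
  have half2: "half_twist_prime ?G t s b p q r \<zeta>"
    by unfold_locales (fact gens order conj comm comm[symmetric] pq char root r_pow assms(2,3))+
  interpret half1: half_twist_prime ?G s t a p q r \<zeta> by (rule half1)
  have rp: "[r ^ p = 1] (mod q)" unfolding r_pow by (rule dvd_refl)
  have action1: "affine_action ?G (class_action (affine_letter p q r Gen_sigma Gen_a)) q r s a {t, b}"
  proof -
    have "affine_action ?G (class_action (affine_letter p q r Gen_sigma Gen_a)) q r
        (gen_G p q r Gen_sigma) (gen_G p q r Gen_a) (gen_G p q r ` {Gen_tau, Gen_b})"
      by (rule affine_action_group_G[OF pq(2,1) rp]) auto
    then show ?thesis by (simp add: s_def t_def a_def b_def)
  qed
  have action2: "affine_action ?G (class_action (affine_letter p q r Gen_tau Gen_b)) q r t b {s, a}"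
  proof -
    have "affine_action ?G (class_action (affine_letter p q r Gen_tau Gen_b)) q r
        (gen_G p q r Gen_tau) (gen_G p q r Gen_b) (gen_G p q r ` {Gen_sigma, Gen_a})"
      by (rule affine_action_group_G[OF pq(2,1) rp]) auto
    then show ?thesis by (simp add: s_def t_def a_def b_def)
  qed
  obtain n :: nat and e where e: "\<forall>j<n. e j \<in> M"
    "\<forall>x\<in>M. \<exists>c. (\<forall>j<n. c j \<in> R) \<and> x = (\<lambda>i. \<Sum>j<n. c j * e j i)"
    using hopf unfolding hopf_order_def finitely_generated_def by blast
  have order_M: "group_element \<one>\<^bsub>?G\<^esub> \<in> M"
    "\<And>x y. x \<in> M \<Longrightarrow> y \<in> M \<Longrightarrow> x \<otimes>\<^bsub>group_algebra ?G\<^esub> y \<in> M"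
    "\<And>x. x \<in> M \<Longrightarrow> pairing ?G (\<lambda>_. 1) x \<in> R"
    "\<And>x. x \<in> M \<Longrightarrow> comult (hopf_B p q r \<zeta>) x \<in> tensor_square M"
    "natural_map ` {s. set s \<subseteq> M \<times> UNIV} = carrier (group_algebra ?G)"
    using hopf unfolding hopf_order_def natural_map_iso_def hopf_B_simps by blast+
  have "twisted_order V ?G M {..<n} e p \<zeta> s t"
  proof unfold_locales
    show "\<exists>c. (\<forall>m\<in>{..<n}. c m \<in> V) \<and> (\<forall>g\<in>carrier ?G. x g = (\<Sum>m<n. c m * e m g))"
      if x: "x \<in> M" for x
    proof -
      obtain c where c: "\<forall>j<n. c j \<in> R" "x = (\<lambda>i. \<Sum>j<n. c j * e j i)"
        using e(2)[rule_format, OF x] by blast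
      show ?thesis
      proof (intro exI[of _ c] conjI ballI)
        show "c m \<in> V" if "m \<in> {..<n}" for m using c(1) V(2) that by blast
        show "x g = (\<Sum>m<n. c m * e m g)" for g by (simp only: c(2))
      qed
    qed
    \<comment> \<open>Surjectivity of the natural map writes a group element as a K-combination of
      elements of \<open>M\<close>, each of which expands in the generators
      \<open>e\<close>.\<close>
    show "\<exists>c. \<forall>g\<in>carrier ?G. group_element h g = (\<Sum>m<n. c m * e m g)" if h: "h \<in> carrier ?G" for h
    proof -
      have "group_element h \<in> natural_map ` {s. set s \<subseteq> M \<times> UNIV}"
        unfolding order_M(5) by (rule group_element_carrier[OF h])
      then obtain S where S: "set S \<subseteq> M \<times> UNIV" "group_element h = natural_map S"
        by blast
      have "\<exists>c. \<forall>g. natural_map S g = (\<Sum>m<n. c m * e m g)" using S(1)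
      proof (induction S)
        case Nil
        show ?case by (rule exI[of _ "\<lambda>_. 0"]) (simp add: natural_map_def)
      next
        case (Cons z S)
        obtain x k where z: "z = (x, k)" by force
        have "set S \<subseteq> M \<times> UNIV" "x \<in> M" using Cons.prems z by auto
        then obtain c where c: "\<And>g. natural_map S g = (\<Sum>m<n. c m * e m g)"
          using Cons.IH by blast
        obtain d where d: "x = (\<lambda>i. \<Sum>j<n. d j * e j i)"
          using e(2)[rule_format, OF \<open>x \<in> M\<close>] by blast
        have "natural_map (z # S) g = (\<Sum>m<n. (k * d m + c m) * e m g)" for g
        proof -
          have "natural_map (z # S) g = k * x g + natural_map S g" by (simp add: natural_map_def z)
          then show ?thesis
            by (simp add: c d algebra_simps sum.distrib sum_distrib_left)
        qed
        then show ?case by (intro exI[of _ "\<lambda>m. k * d m + c m"] allI)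
      qed
      then obtain c where c: "\<And>g. natural_map S g = (\<Sum>m<n. c m * e m g)" by blast
      show ?thesis unfolding S(2) by (intro exI[of _ c] ballI) (rule c)
    qed
    show "\<exists>S. set S \<subseteq> M \<times> M \<and> (\<forall>F. pairing ?G (twist_dual ?G p \<zeta> s t F) x
        = (\<Sum>(y, z)\<leftarrow>S. pairing ?G (\<lambda>g. pairing ?G (\<lambda>h. F (g, h)) z) y))" if x: "x \<in> M" for x
    proof -
      obtain S where S: "set S \<subseteq> M \<times> M"
        "comult (hopf_B p q r \<zeta>) x = (\<lambda>z. \<Sum>(x, y)\<leftarrow>S. tensor x y z)"
        using order_M(4)[OF x] by (auto simp: tensor_square_def)
      have "pairing ?G (twist_dual ?G p \<zeta> s t F) x
        = (\<Sum>(y, z)\<leftarrow>S. pairing ?G (\<lambda>g. pairing ?G (\<lambda>h. F (g, h)) z) y)" for F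
      proof -
        have list: "pairing (?G \<times>\<times> ?G) F (\<lambda>z. \<Sum>(x, y)\<leftarrow>L. tensor x y z)
          = (\<Sum>(x, y)\<leftarrow>L. pairing (?G \<times>\<times> ?G) F (tensor x y))" for L
          by (induction L) (simp_all add: pairing_def algebra_simps sum.distrib case_prod_unfold)
        show ?thesis
          using half1.pairing_twisted_coproduct[OF fin, of F x] S(2)
          unfolding hopf_B_simps s_def t_def by (simp add: list pairing_tensor)
      qed
      then show ?thesis using S(1) by blast
    qed
    show "finite (carrier ?G)" by (rule fin)
    show "finite {..<n}" by simp
    show "e m \<in> M" if "m \<in> {..<n}" for m using e(1) that by simp
    show "group_element \<one>\<^bsub>?G\<^esub> \<in> M" by (rule order_M(1))
    show "x \<otimes>\<^bsub>group_algebra ?G\<^esub> y \<in> M" if "x \<in> M" "y \<in> M" for x y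
      using that by (rule order_M(2))
    show "pairing ?G (\<lambda>_. 1) x \<in> V" if "x \<in> M" for x
      using order_M(3)[OF that] V(2) by blast
  qed
  then interpret order: galindo_natale_order V ?G M "{..<n}" e p \<zeta> s t a b q r
    "class_action (affine_letter p q r Gen_sigma Gen_a)" "class_action (affine_letter p q r Gen_tau Gen_b)"
    using half1 half2 action1 action2 assms(1)
    by (intro galindo_natale_order.intro galindo_natale_order_axioms.intro)
  show False using order.inverse_p_mem V(3) by (simp add: inverse_eq_divide)
qed

text \<open>A rational algebraic integer is an integer, and n p = 1 has no integer solution n. This
  keeps 1/p out of every number ring.\<close>

lemma inverse_prime_not_algebraic_int:
  assumes "prime p"
  shows "\<not> algebraic_int (1 / of_nat p :: 'k::field_char_0)"
proof
  assume "algebraic_int (1 / of_nat p :: 'k)"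
  then have "(1 / of_nat p :: 'k) \<in> \<int>"
    by (rule rational_algebraic_int_is_int) simp
  then obtain n where "(1 / of_nat p :: 'k) = of_int n" by (auto elim: Ints_cases)
  then have "(of_int (n * int p) :: 'k) = of_int 1"
    using prime_gt_0_nat[OF assms] by (simp add: field_simps)
  then have "n * int p = 1" unfolding of_int_eq_iff .
  then have "int p dvd 1" by (metis dvd_triv_right)
  then show False using prime_gt_1_nat[OF assms] by simp
qed

theorem theorem2p3:
  fixes p q r :: nat and \<zeta> :: "'k::number_field"
  assumes "prime p" and "prime q" and "p dvd q - 1"
    and "coprime q r" and "ord q r = p"
    and "primitive_root_of_unity p \<zeta>"
  shows "(\<forall>R :: 'k set. dedekind_subring R \<longrightarrow> ring_of_integers \<subseteq> R \<longrightarrow>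
            admits_hopf_order R (hopf_B p q r \<zeta>) \<longrightarrow> 1 / of_nat p \<in> R) \<and>
         (\<forall>R :: 'k set. number_ring R \<longrightarrow> \<not> admits_hopf_order R (hopf_B p q r \<zeta>))"
proof -
  have "1 / of_nat p \<in> R" if "admits_hopf_order R (hopf_B p q r \<zeta>)" for R
    using that inverse_p_mem_of_hopf_order[OF assms(1,2,4,5,6)] by (auto simp: admits_hopf_order_def)
  moreover have "1 / of_nat p \<notin> R" if "number_ring R" for R :: "'k set"
    using that inverse_prime_not_algebraic_int[OF assms(1), where 'k = 'k]
    by (auto simp: number_ring_def)
  ultimately show ?thesis by blast
qed

end
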